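(* Let $d>2$, let $W=[0,1]^d$, $W_R=RW$, and let $\Lambda=\sum_{i=1}^d\int_{-\infty}^{+\infty}\delta_{re_i+e_i^{\perp}}\,dr$, where $e_1,\dots,e_d$ is the standard orthonormal basis of $\mathbb R^d$ and $\delta_{re_i+e_i^\perp}$ is the unit point mass at the hyperplane orthogonal to $e_i$ at signed distance $r$ from the origin. Then $$R^{-(d-1)}\Big[\mathrm{Vol}_{d-1}(Y(1,W_R))-\mathbb E\,\mathrm{Vol}_{d-1}(Y(1,W_R))\Big]$$ converges in law, as $R\to\infty$, to a non-Gaussian square-integrable random variable $\Xi(W)$ with $$\mathrm{Var}(\Xi(W))=\int_{[W]}\int_{W\cap H}\int_{W\cap H}\frac{1}{\Lambda([xy])}\,dx\,dy\,\Lambda(dH),$$ where $[xy]$ is the set of hyperplanes hitting the segment with endpoints $x,y$ and $dx,dy$ denote $(d-1)$-dimensional Lebesgue measure on $H$.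
   Context: $\mathcal H$ is the space of affine hyperplanes in $\mathbb R^d$; for a compact convex set $c$, $[c]=\{H\in\mathcal H:H\cap c\ne\emptyset\}$. STIT tessellation via the MNW-construction: for compact convex $W$ with interior points and $t>0$, $Y(t,W)=Y(t\Lambda,W)$ is the state at time $t$ of the following continuous-time random cell-splitting process. At time $0$ there is the single cell $W$. Each existing cell $c$, independently of all other cells, lives for an exponentially distributed time with parameter $\Lambda([c])$; at the end of its lifetime it is split into the two cells $c\cap H^+$ and $c\cap H^-$ (intersections with the two closed half-spaces bounded by $H$), where $H$ is a random hyperplane with law $\Lambda(\cdot\cap[c])/\Lambda([c])$ independent of everything else; the two new cells then evolve in the same way. Each split creates a $(d-1)$-dimensional facet $c\cap H$; $\mathrm{Vol}_{d-1}(Y(t,W))$ denotes the sum of the $(d-1)$-volumes of all facets created during $[0,t]$ (the total surface area of cell boundaries in the interior of $W$). *)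

theory Defs
  imports "HOL-Probability.Probability"
begin

(* Points of R^d are functions nat => real; only coordinates j < d matter.
   The ambient Lebesgue measure space is  PiM {..<d} (\<lambda>_. lborel). *)

definition hyp :: "nat \<times> real \<Rightarrow> (nat \<Rightarrow> real) set" where
  "hyp H = {x. x (fst H) = snd H}"

definition Lambda :: "nat \<Rightarrow> (nat \<times> real) measure" where
  "Lambda d = count_space {..<d} \<Otimes>\<^sub>M lborel"

definition hits :: "nat \<Rightarrow> (nat \<Rightarrow> real) set \<Rightarrow> (nat \<times> real) set" where
  "hits d c = {H. fst H < d \<and> hyp H \<inter> c \<noteq> {}}"

definition box_d :: "nat \<Rightarrow> (nat \<Rightarrow> real) \<Rightarrow> (nat \<Rightarrow> real) \<Rightarrow> (nat \<Rightarrow> real) set" where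
  "box_d d a b = PiE {..<d} (\<lambda>j. {a j .. b j})"

definition seg :: "(nat \<Rightarrow> real) \<Rightarrow> (nat \<Rightarrow> real) \<Rightarrow> (nat \<Rightarrow> real) set" where
  "seg x y = {(\<lambda>j. (1 - u) * x j + u * y j) | u. 0 \<le> u \<and> u \<le> 1}"

definition hyp_emb :: "nat \<times> real \<Rightarrow> (nat \<Rightarrow> real) \<Rightarrow> (nat \<Rightarrow> real)" where
  "hyp_emb H y = (\<lambda>j. if j = fst H then snd H else y j)"

definition hyp_meas :: "nat \<Rightarrow> nat \<times> real \<Rightarrow> (nat \<Rightarrow> real) measure" where
  "hyp_meas d H = distr (PiM ({..<d} - {fst H}) (\<lambda>_. lborel)) (PiM {..<d} (\<lambda>_. lborel)) (hyp_emb H)"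

(* Choice of the splitting hyperplane of the box cell [a,b] from a uniform u in [0,1]:
   quantile transform of the probability law Lambda(. \<inter> [c]) / Lambda([c]),
   hyperplanes being ordered lexicographically by (direction, position). *)
definition split_hyp :: "nat \<Rightarrow> (nat \<Rightarrow> real) \<Rightarrow> (nat \<Rightarrow> real) \<Rightarrow> real \<Rightarrow> nat \<times> real" where
  "split_hyp d a b u =
     (let s = u * (\<Sum>j<d. b j - a j);
          i = (LEAST k. s \<le> (\<Sum>j<Suc k. b j - a j))
      in (i, a i + (s - (\<Sum>j<i. b j - a j))))"

(* Randomness of the MNW construction: each node v of the infinite binary tree
   (v :: bool list) carries an independent pair (E_v, U_v) with E_v ~ Exp(1)
   and U_v ~ Unif[0,1]. *)
definition Omega :: "(bool list \<Rightarrow> real \<times> real) measure" where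
  "Omega = PiM UNIV (\<lambda>_. density lborel (exponential_density 1) \<Otimes>\<^sub>M uniform_measure lborel {0..1})"

(* cellof d \<omega> pre a b \<tau> path: starting from node pre with box cell [a,b] born at time \<tau>,
   follow path; returns (lower corner, upper corner, birth time) of the reached node.
   Cell c=[a,b] at node v lives for E_v / Lambda([c]) (an Exp(Lambda([c])) time),
   then is split by hyperplane split_hyp; child False = c \<inter> {x i \<le> r}, True = c \<inter> {x i \<ge> r}. *)
fun cellof :: "nat \<Rightarrow> (bool list \<Rightarrow> real \<times> real) \<Rightarrow> bool list \<Rightarrow> (nat \<Rightarrow> real) \<Rightarrow> (nat \<Rightarrow> real)
      \<Rightarrow> real \<Rightarrow> bool list \<Rightarrow> (nat \<Rightarrow> real) \<times> (nat \<Rightarrow> real) \<times> real" where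
  "cellof d \<omega> pre a b \<tau> [] = (a, b, \<tau>)"
| "cellof d \<omega> pre a b \<tau> (x # xs) =
     (let H = split_hyp d a b (snd (\<omega> pre));
          \<tau>' = \<tau> + fst (\<omega> pre) / measure (Lambda d) (hits d (box_d d a b))
      in if x then cellof d \<omega> (pre @ [True]) (a(fst H := snd H)) b \<tau>' xs
         else cellof d \<omega> (pre @ [False]) a (b(fst H := snd H)) \<tau>' xs)"

definition death_time :: "nat \<Rightarrow> (nat \<Rightarrow> real) \<Rightarrow> (nat \<Rightarrow> real) \<Rightarrow> (bool list \<Rightarrow> real \<times> real) \<Rightarrow> bool list \<Rightarrow> real" where
  "death_time d a0 b0 \<omega> v =
     (case cellof d \<omega> [] a0 b0 0 v of (a, b, \<tau>) \<Rightarrow>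
        \<tau> + fst (\<omega> v) / measure (Lambda d) (hits d (box_d d a b)))"

definition facet_area :: "nat \<Rightarrow> (nat \<Rightarrow> real) \<Rightarrow> (nat \<Rightarrow> real) \<Rightarrow> (bool list \<Rightarrow> real \<times> real) \<Rightarrow> bool list \<Rightarrow> real" where
  "facet_area d a0 b0 \<omega> v =
     (case cellof d \<omega> [] a0 b0 0 v of (a, b, \<tau>) \<Rightarrow>
        measure (hyp_meas d (split_hyp d a b (snd (\<omega> v)))) (box_d d a b))"

definition stit_surface :: "nat \<Rightarrow> real \<Rightarrow> (nat \<Rightarrow> real) \<Rightarrow> (nat \<Rightarrow> real) \<Rightarrow> (bool list \<Rightarrow> real \<times> real) \<Rightarrow> real" where
  "stit_surface d t a0 b0 \<omega> =
     infsum (\<lambda>v. if death_time d a0 b0 \<omega> v \<le> t then facet_area d a0 b0 \<omega> v else 0) UNIV"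

definition centered_law :: "nat \<Rightarrow> real \<Rightarrow> real measure" where
  "centered_law d R =
     distr Omega borel (\<lambda>\<omega>. R powr (- (real d - 1)) *
        (stit_surface d 1 (\<lambda>_. 0) (\<lambda>_. R) \<omega>
         - integral\<^sup>L Omega (stit_surface d 1 (\<lambda>_. 0) (\<lambda>_. R))))"

definition conv_in_law_at_top :: "(real \<Rightarrow> real measure) \<Rightarrow> real measure \<Rightarrow> bool" where
  "conv_in_law_at_top \<mu> \<nu> \<longleftrightarrow>
     (\<forall>Rs :: nat \<Rightarrow> real. filterlim Rs at_top sequentially \<longrightarrow> weak_conv_m (\<lambda>n. \<mu> (Rs n)) \<nu>)"

definition gaussian :: "real measure \<Rightarrow> bool" where
  "gaussian \<nu> \<longleftrightarrow> (\<exists>m \<sigma>. \<sigma> > 0 \<and> \<nu> = density lborel (normal_density m \<sigma>))"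

definition var_formula :: "nat \<Rightarrow> (nat \<Rightarrow> real) set \<Rightarrow> real" where
  "var_formula d W =
     (\<integral>H. indicator (hits d W) H *
        (\<integral>y. indicator W y *
           (\<integral>x. indicator W x / measure (Lambda d) (hits d (seg x y)) \<partial>hyp_meas d H)
         \<partial>hyp_meas d H) \<partial>Lambda d)"

end

theory Submission
  imports Defs
begin

text \<open>
  By scaling, \<open>R\<^bsup>-(d-1)\<^esup> Vol (Y(1, W\<^sub>R))\<close> is the surface area at time \<open>R\<close> in the unit cube. A cell of volume
  \<open>v\<close> creates facet area at rate \<open>d * v\<close> and the cells partition the cube, so the surface area at time
  \<open>t\<close> minus \<open>d * t\<close> is a martingale. Conditioning on the first split turns it into a recursion over
  the tree of cells with two independent centred subtrees. Two points \<open>x, y\<close> of a hyperplane stay in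
  one cell for an exponential time of rate \<open>\<Lambda>([xy])\<close>, whence the second moments are bounded by the
  integral of \<open>1 / \<Lambda>([xy])\<close>, which is finite as \<open>d > 2\<close>, and dropping all generations from \<open>n\<close> on
  costs at most the integral of \<open>(1 - \<Lambda>([xy]) / d) ^ n / \<Lambda>([xy])\<close> in \<open>L\<^sup>2\<close>, uniformly in time. The
  truncated martingale is eventually constant in time, which gives the limit and its variance.
  The lifetime \<open>E\<close> of the cube enters the limit only as a summand \<open>- E\<close> that is independent of the
  rest; as \<open>E\<close> is exponential, the limit has an infinite exponential moment and is not Gaussian.
\<close>

subsection \<open>The marks of the cells and their branching structure\<close>

text \<open>The kernel 1/L arises as a fixed point. Let l be \<open>lam\<close> of a cell and L =
  Lambda([xy]). The first split passes through both points with density 1/l relative to Lambda, and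
  it leaves them together with probability 1 - L/l; and 1/l + (1 - L/l)/L = 1/L. So second moments
  are handed from a cell to its children by one algebraic identity. Truncation is by generation
  rather than by time: every cell of the unit cube has l <= d, so the same recursion gains a factor
  1 - L/d per generation whatever the time is. This uniformity is what permits exchanging the limits
  in generation and in time. The kernel is infinite on the diagonal. Pair integrals are therefore
  taken in the extended nonnegative reals, and their agreement with the real integrals of
  \<open>var_formula\<close> is a separate argument. Another obstacle is that the surface is an
  \<open>infsum\<close>, 0 if not summable, over marks that may produce degenerate boxes. It agrees
  with the recursion only almost surely, and its integrability at a fixed time is drawn from the
  geometric decay of the drift that is left to late generations.\<close>

abbreviation corner :: "(nat \<Rightarrow> real) measure" where
  "corner \<equiv> PiM UNIV (\<lambda>_. borel)"

definition expo :: "real measure" where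
  "expo = density lborel (exponential_density 1)"

definition unif :: "real measure" where
  "unif = uniform_measure lborel {0..1}"

definition mark_law :: "(real \<times> real) measure" where
  "mark_law = expo \<Otimes>\<^sub>M unif"

lemma sets_expo [simp, measurable_cong]: "sets expo = sets borel"
  by (simp add: expo_def)

lemma space_expo [simp]: "space expo = UNIV"
  by (simp add: expo_def)

lemma sets_unif [simp, measurable_cong]: "sets unif = sets borel"
  by (simp add: unif_def)

lemma space_unif [simp]: "space unif = UNIV"
  by (simp add: unif_def)

lemma sets_mark_law [measurable_cong]: "sets mark_law = sets (borel \<Otimes>\<^sub>M borel)"
  unfolding mark_law_def by (intro sets_pair_measure_cong) simp_all

lemma space_mark_law [simp]: "space mark_law = UNIV"
  by (simp add: mark_law_def space_pair_measure)

lemma prob_space_expo: "prob_space expo"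
  unfolding expo_def by (rule prob_space_exponential_density) simp

lemma prob_space_unif: "prob_space unif"
  unfolding unif_def by (rule prob_space_uniform_measure) simp_all

lemma prob_space_mark_law: "prob_space mark_law"
  unfolding mark_law_def by (intro prob_space_pair prob_space_expo prob_space_unif)

lemma Omega_eq: "Omega = PiM UNIV (\<lambda>_. mark_law)"
  by (simp add: Omega_def mark_law_def expo_def unif_def)

lemma prob_space_Omega: "prob_space Omega"
  unfolding Omega_eq by (intro prob_space_PiM prob_space_mark_law)

lemma sets_Omega [measurable_cong]: "sets Omega = sets (PiM UNIV (\<lambda>_. borel \<Otimes>\<^sub>M borel))"
  unfolding Omega_eq by (intro sets_PiM_cong) (simp_all add: sets_mark_law)

lemma space_Omega [simp]: "space Omega = UNIV"
  by (simp add: Omega_eq space_PiM)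

definition graft :: "(real \<times> real) \<Rightarrow> (bool list \<Rightarrow> real \<times> real) \<Rightarrow> (bool list \<Rightarrow> real \<times> real)
    \<Rightarrow> bool list \<Rightarrow> real \<times> real" where
  "graft x l r v = (case v of [] \<Rightarrow> x | c # w \<Rightarrow> if c then r w else l w)"

lemma graft_simps [simp]:
  "graft x l r [] = x" "graft x l r (False # w) = l w" "graft x l r (True # w) = r w"
  by (simp_all add: graft_def)

lemma measurable_graft [measurable]:
  "(\<lambda>(x, l, r). graft x l r) \<in> (mark_law \<Otimes>\<^sub>M (Omega \<Otimes>\<^sub>M Omega)) \<rightarrow>\<^sub>M Omega"
proof -
  have "(\<lambda>y v. graft (fst y) (fst (snd y)) (snd (snd y)) v)
      \<in> (mark_law \<Otimes>\<^sub>M (Omega \<Otimes>\<^sub>M Omega)) \<rightarrow>\<^sub>M PiM UNIV (\<lambda>_. borel \<Otimes>\<^sub>M borel)"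
  proof (rule measurable_abs_UNIV)
    fix v :: "bool list"
    show "(\<lambda>y. graft (fst y) (fst (snd y)) (snd (snd y)) v)
        \<in> (mark_law \<Otimes>\<^sub>M (Omega \<Otimes>\<^sub>M Omega)) \<rightarrow>\<^sub>M borel \<Otimes>\<^sub>M borel"
    proof (cases v)
      case Nil
      then show ?thesis by simp
    next
      case (Cons c w)
      then show ?thesis by (cases c) simp_all
    qed
  qed
  then show ?thesis
    by (simp add: split_beta' cong: measurable_cong_sets[OF refl sets_Omega])
qed

text \<open>The branching property: the root mark and the marks of the two subtrees are independent,
  and each subtree is marked like the whole tree. It suffices to compare finite cylinders, and the
  preimage of a cylinder under \<open>graft\<close> is a product of a set for the root mark and two
  cylinders.\<close>

lemma Omega_decomp:
  "distr (mark_law \<Otimes>\<^sub>M (Omega \<Otimes>\<^sub>M Omega)) Omega (\<lambda>(x, l, r). graft x l r) = Omega" (is "?P = Omega")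
proof -
  interpret r: prob_space mark_law by (rule prob_space_mark_law)
  interpret O: prob_space Omega by (rule prob_space_Omega)
  interpret OO: pair_prob_space Omega Omega ..
  interpret rOO: pair_prob_space mark_law "Omega \<Otimes>\<^sub>M Omega" ..
  show ?thesis
  proof (rule measure_eqI_PiM_infinite[where I = UNIV and M = "\<lambda>_. mark_law"])
    show "sets ?P = sets (PiM UNIV (\<lambda>_. mark_law))" "sets Omega = sets (PiM UNIV (\<lambda>_. mark_law))"
      by (simp_all add: Omega_eq)
    show "finite_measure ?P"
      by (rule prob_space.finite_measure, rule rOO.prob_space_distr) simp
    fix A :: "bool list \<Rightarrow> (real \<times> real) set" and J :: "bool list set"
    assume J: "finite J" "J \<subseteq> UNIV" and A: "\<And>v. v \<in> J \<Longrightarrow> A v \<in> sets mark_law"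
    \<comment> \<open>The constraints of the cylinder are distributed over the root
      (\<open>S\<close>, no constraint if \<open>[] \<notin> J\<close>) and the nodes
      \<open>K c\<close> below either child.\<close>
    define S where "S = (if [] \<in> J then A [] else UNIV)"
    define K where "K c = {w. c # w \<in> J}" for c
    define cyl where "cyl c = prod_emb UNIV (\<lambda>_. mark_law) (K c) (PiE (K c) (\<lambda>w. A (c # w)))" for c
    have K: "finite (K c)" for c
      using finite_vimageI[OF J(1), of "\<lambda>w. c # w"] by (simp add: K_def vimage_def inj_on_def)
    have cyl_meas: "emeasure Omega (cyl c) = (\<Prod>w\<in>K c. emeasure mark_law (A (c # w)))" for c
      unfolding cyl_def Omega_eq
      by (rule emeasure_PiM_emb) (use K in \<open>auto simp: K_def intro: A prob_space_mark_law\<close>)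
    have cyl_sets [measurable]: "cyl c \<in> sets Omega" for c
      unfolding cyl_def Omega_eq by (rule sets_PiM_I) (use K in \<open>auto simp: K_def intro: A\<close>)
    have S_sets [measurable]: "S \<in> sets mark_law" using A sets.top[of mark_law] by (auto simp: S_def)
    have Jeq: "J = ({[]} \<inter> J) \<union> (Cons False ` K False \<union> Cons True ` K True)"
    proof (intro set_eqI)
      fix v show "v \<in> J \<longleftrightarrow> v \<in> ({[]} \<inter> J) \<union> (Cons False ` K False \<union> Cons True ` K True)"
      proof (cases v)
        case (Cons c w) then show ?thesis by (cases c) (auto simp: K_def)
      qed auto
    qed
    have pre: "(\<lambda>(x, l, r). graft x l r) -` prod_emb UNIV (\<lambda>_. mark_law) J (PiE J A)
        = S \<times> (cyl False \<times> cyl True)"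
    proof -
      have "(\<forall>v\<in>J. graft x l r v \<in> A v) \<longleftrightarrow> x \<in> S \<and> (\<forall>w\<in>K False. l w \<in> A (False # w))
         \<and> (\<forall>w\<in>K True. r w \<in> A (True # w))" for x l r
        by (subst Jeq) (auto simp: S_def ball_Un)
      then show ?thesis
        by (auto simp: prod_emb_iff cyl_def PiE_iff)
    qed
    have "emeasure ?P (prod_emb UNIV (\<lambda>_. mark_law) J (PiE J A))
        = emeasure (mark_law \<Otimes>\<^sub>M (Omega \<Otimes>\<^sub>M Omega)) (S \<times> (cyl False \<times> cyl True))"
    proof (subst emeasure_distr[OF measurable_graft])
      show "prod_emb UNIV (\<lambda>_. mark_law) J (PiE J A) \<in> sets Omega"
        unfolding Omega_eq by (rule sets_PiM_I) (use J A in auto)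
    qed (simp add: pre space_pair_measure)
    also have "\<dots> = emeasure mark_law S * (emeasure Omega (cyl False) * emeasure Omega (cyl True))"
      by (simp add: O.emeasure_pair_measure_Times OO.emeasure_pair_measure_Times)
    also have "emeasure mark_law S = (\<Prod>v\<in>{[]} \<inter> J. emeasure mark_law (A v))"
      using r.emeasure_space_1 by (cases "[] \<in> J") (auto simp: S_def)
    also have "\<dots> * (emeasure Omega (cyl False) * emeasure Omega (cyl True)) = (\<Prod>v\<in>J. emeasure mark_law (A v))"
    proof -
      have "(\<Prod>v\<in>Cons False ` K False \<union> Cons True ` K True. emeasure mark_law (A v))
          = emeasure Omega (cyl False) * emeasure Omega (cyl True)"
        unfolding cyl_meas
        by (subst prod.union_disjoint) (auto intro: finite_imageI K simp: prod.reindex)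
      then show ?thesis
        by (subst (2) Jeq, subst prod.union_disjoint) (auto intro: finite_imageI K simp: J)
    qed
    also have "\<dots> = emeasure Omega (prod_emb UNIV (\<lambda>_. mark_law) J (PiE J A))"
      unfolding Omega_eq
      by (rule emeasure_PiM_emb[symmetric]) (auto intro: J A prob_space_mark_law)
    finally show "emeasure ?P (prod_emb UNIV (\<lambda>_. mark_law) J (PiE J A))
        = emeasure Omega (prod_emb UNIV (\<lambda>_. mark_law) J (PiE J A))" .
  qed
qed

lemma measurable_graft_comp [measurable (raw)]:
  assumes [measurable]: "f \<in> N \<rightarrow>\<^sub>M mark_law" "g \<in> N \<rightarrow>\<^sub>M Omega" "h \<in> N \<rightarrow>\<^sub>M Omega"
  shows "(\<lambda>x. graft (f x) (g x) (h x)) \<in> N \<rightarrow>\<^sub>M Omega"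
proof -
  have "(\<lambda>x. (\<lambda>(x, l, r). graft x l r) (f x, g x, h x)) \<in> N \<rightarrow>\<^sub>M Omega"
    by (rule measurable_compose[OF _ measurable_graft]) measurable
  then show ?thesis by simp
qed

lemma nn_integral_Omega:
  assumes [measurable]: "f \<in> borel_measurable Omega"
  shows "(\<integral>\<^sup>+\<omega>. f \<omega> \<partial>Omega) = (\<integral>\<^sup>+x. \<integral>\<^sup>+l. \<integral>\<^sup>+r. f (graft x l r) \<partial>Omega \<partial>Omega \<partial>mark_law)"
proof -
  interpret O: prob_space Omega by (rule prob_space_Omega)
  interpret OO: pair_prob_space Omega Omega ..
  have "(\<integral>\<^sup>+\<omega>. f \<omega> \<partial>Omega) = (\<integral>\<^sup>+y. f (case y of (x, l, r) \<Rightarrow> graft x l r) \<partial>(mark_law \<Otimes>\<^sub>M (Omega \<Otimes>\<^sub>M Omega)))"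
    by (subst Omega_decomp[symmetric], subst nn_integral_distr) (auto simp: split_beta')
  also have "\<dots> = (\<integral>\<^sup>+x. \<integral>\<^sup>+y. f (graft x (fst y) (snd y)) \<partial>(Omega \<Otimes>\<^sub>M Omega) \<partial>mark_law)"
    by (subst OO.nn_integral_fst[symmetric]) (auto simp: split_beta')
  also have "\<dots> = (\<integral>\<^sup>+x. \<integral>\<^sup>+l. \<integral>\<^sup>+r. f (graft x l r) \<partial>Omega \<partial>Omega \<partial>mark_law)"
    by (intro nn_integral_cong, subst O.nn_integral_fst[symmetric]) auto
  finally show ?thesis .
qed

lemma integral_Omega:
  fixes f :: "(bool list \<Rightarrow> real \<times> real) \<Rightarrow> real"
  assumes f: "integrable Omega f"
  shows "(\<integral>\<omega>. f \<omega> \<partial>Omega) = (\<integral>x. \<integral>l. \<integral>r. f (graft x l r) \<partial>Omega \<partial>Omega \<partial>mark_law)"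
proof -
  interpret O: prob_space Omega by (rule prob_space_Omega)
  interpret OO: pair_prob_space Omega Omega ..
  interpret r: prob_space mark_law by (rule prob_space_mark_law)
  interpret rOO: pair_prob_space mark_law "Omega \<Otimes>\<^sub>M Omega" ..
  have fm [measurable]: "f \<in> borel_measurable Omega" using f by auto
  have "integrable (distr (mark_law \<Otimes>\<^sub>M (Omega \<Otimes>\<^sub>M Omega)) Omega (\<lambda>(x, l, r). graft x l r)) f"
    unfolding Omega_decomp by fact
  then have i: "integrable (mark_law \<Otimes>\<^sub>M (Omega \<Otimes>\<^sub>M Omega)) (\<lambda>y. f (case y of (x, l, r) \<Rightarrow> graft x l r))"
    by (subst (asm) integrable_distr_eq) auto
  have "(\<integral>\<omega>. f \<omega> \<partial>Omega) = (\<integral>y. f (case y of (x, l, r) \<Rightarrow> graft x l r) \<partial>(mark_law \<Otimes>\<^sub>M (Omega \<Otimes>\<^sub>M Omega)))"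
    by (subst Omega_decomp[symmetric], subst integral_distr) (auto simp: split_beta')
  also have "\<dots> = (\<integral>x. \<integral>y. f (case (x, y) of (x, l, r) \<Rightarrow> graft x l r) \<partial>(Omega \<Otimes>\<^sub>M Omega) \<partial>mark_law)"
    by (rule rOO.integral_fst'[symmetric, OF i])
  also have "\<dots> = (\<integral>x. \<integral>l. \<integral>r. f (graft x l r) \<partial>Omega \<partial>Omega \<partial>mark_law)"
  \<comment> \<open>Only almost every section is integrable, so the inner product integral may be
    iterated only for almost every root mark.\<close>
  proof (rule integral_cong_AE)
    show "AE x in mark_law. (\<integral>y. f (case (x, y) of (x, l, r) \<Rightarrow> graft x l r) \<partial>(Omega \<Otimes>\<^sub>M Omega))
        = (\<integral>l. \<integral>r. f (graft x l r) \<partial>Omega \<partial>Omega)"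
      using rOO.AE_integrable_fst'[OF i]
    proof eventually_elim
      case (elim x)
      from OO.integral_fst'[OF elim] show ?case by (simp add: split_beta')
    qed
  qed (measurable; simp add: split_beta')+
  finally show ?thesis .
qed

lemma AE_Omega_graftI:
  assumes [measurable]: "Measurable.pred Omega P"
    and "AE x in mark_law. AE l in Omega. AE r in Omega. P (graft x l r)"
  shows "AE \<omega> in Omega. P \<omega>"
proof -
  interpret O: prob_space Omega by (rule prob_space_Omega)
  interpret OO: pair_prob_space Omega Omega ..
  interpret r: prob_space mark_law by (rule prob_space_mark_law)
  interpret rOO: pair_prob_space mark_law "Omega \<Otimes>\<^sub>M Omega" ..
  have "AE x in mark_law. AE y in (Omega \<Otimes>\<^sub>M Omega). P (graft x (fst y) (snd y))"
    using assms(2)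
  proof eventually_elim
    case (elim x)
    have "AE l in Omega. AE r in Omega. P (graft x (fst (l, r)) (snd (l, r)))" using elim by simp
    then show ?case by (intro OO.AE_pair_measure) auto
  qed
  then have "AE x in mark_law. AE y in (Omega \<Otimes>\<^sub>M Omega). P (case (x, y) of (x, l, r) \<Rightarrow> graft x l r)"
    by (simp add: split_beta')
  moreover have "{y \<in> space (mark_law \<Otimes>\<^sub>M (Omega \<Otimes>\<^sub>M Omega)). P (case y of (x, l, r) \<Rightarrow> graft x l r)}
      \<in> sets (mark_law \<Otimes>\<^sub>M (Omega \<Otimes>\<^sub>M Omega))" by measurable
  ultimately have "AE y in mark_law \<Otimes>\<^sub>M (Omega \<Otimes>\<^sub>M Omega). P (case y of (x, l, r) \<Rightarrow> graft x l r)"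
    by (intro rOO.AE_pair_measure)
  then have "AE \<omega> in distr (mark_law \<Otimes>\<^sub>M (Omega \<Otimes>\<^sub>M Omega)) Omega (\<lambda>(x, l, r). graft x l r). P \<omega>"
        by (simp only: AE_distr_iff[OF measurable_graft assms(1)[unfolded pred_def]])
  then show ?thesis unfolding Omega_decomp .
qed

lemma nn_integral_mark_law:
  assumes [measurable]: "f \<in> borel_measurable (borel \<Otimes>\<^sub>M borel)"
  shows "(\<integral>\<^sup>+x. f x \<partial>mark_law) = (\<integral>\<^sup>+e. \<integral>\<^sup>+u. f (e, u) \<partial>unif \<partial>expo)"
proof -
  interpret u: prob_space unif by (rule prob_space_unif)
  show ?thesis unfolding mark_law_def
    by (subst u.nn_integral_fst[symmetric]) (auto simp: split_beta')
qed

lemma AE_mark_law_fst: "AE x in mark_law. P (fst x)" if "AE e in expo. P e" "Measurable.pred borel P"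
proof -
  interpret u: prob_space unif by (rule prob_space_unif)
  interpret e: prob_space expo by (rule prob_space_expo)
  interpret p: pair_prob_space expo unif ..
  note [measurable] = that(2)
  show ?thesis unfolding mark_law_def
  proof (rule p.AE_pair_measure)
    show "{x \<in> space (expo \<Otimes>\<^sub>M unif). P (fst x)} \<in> sets (expo \<Otimes>\<^sub>M unif)" by measurable
  qed (use that(1) in auto)
qed

lemma AE_mark_law_snd: "AE x in mark_law. P (snd x)" if "AE u in unif. P u" "Measurable.pred borel P"
proof -
  interpret u: prob_space unif by (rule prob_space_unif)
  interpret e: prob_space expo by (rule prob_space_expo)
  interpret p: pair_prob_space expo unif ..
  note [measurable] = that(2)
  show ?thesis unfolding mark_law_def
  proof (rule p.AE_pair_measure)
    show "{x \<in> space (expo \<Otimes>\<^sub>M unif). P (snd x)} \<in> sets (expo \<Otimes>\<^sub>M unif)" by measurable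
  qed (use that(1) in auto)
qed

lemma nn_integral_expo:
  assumes [measurable]: "f \<in> borel_measurable borel"
  shows "(\<integral>\<^sup>+e. f e \<partial>expo) = (\<integral>\<^sup>+e\<in>{0..}. ennreal (exp (- e)) * f e \<partial>lborel)"
proof -
  have "(\<integral>\<^sup>+e. f e \<partial>expo) = (\<integral>\<^sup>+e. ennreal (exponential_density 1 e) * f e \<partial>lborel)"
    unfolding expo_def by (subst nn_integral_density) (auto simp: exponential_density_def)
  also have "\<dots> = (\<integral>\<^sup>+e\<in>{0..}. ennreal (exp (- e)) * f e \<partial>lborel)"
    by (intro nn_integral_cong) (auto simp: exponential_density_def indicator_def)
  finally show ?thesis .
qed

lemma AE_expo_nonneg: "AE e in expo. 0 \<le> e"
  unfolding expo_def by (subst AE_density) (auto simp: exponential_density_def)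

section \<open>Box cells and the law of the first split\<close>

definition lam :: "nat \<Rightarrow> (nat \<Rightarrow> real) \<Rightarrow> (nat \<Rightarrow> real) \<Rightarrow> real" where
  "lam d a b = (\<Sum>j<d. b j - a j)"

definition vol :: "nat \<Rightarrow> (nat \<Rightarrow> real) \<Rightarrow> (nat \<Rightarrow> real) \<Rightarrow> real" where
  "vol d a b = (\<Prod>j<d. b j - a j)"

definition facet :: "nat \<Rightarrow> (nat \<Rightarrow> real) \<Rightarrow> (nat \<Rightarrow> real) \<Rightarrow> nat \<Rightarrow> real" where
  "facet d a b i = (\<Prod>j\<in>{..<d} - {i}. b j - a j)"

text \<open>Strict inequalities exclude degenerate boxes, so that \<open>lam\<close> is positive and
  can be divided by; \<open>R\<close> is the side of the window, 1 after rescaling.\<close>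

definition cell :: "nat \<Rightarrow> real \<Rightarrow> (nat \<Rightarrow> real) \<Rightarrow> (nat \<Rightarrow> real) \<Rightarrow> bool" where
  "cell d R a b \<longleftrightarrow> (\<forall>j<d. 0 \<le> a j \<and> a j < b j \<and> b j \<le> R)"

lemma measurable_split_hyp [measurable (raw)]:
  assumes [measurable]: "f \<in> N \<rightarrow>\<^sub>M corner" "g \<in> N \<rightarrow>\<^sub>M corner" "h \<in> borel_measurable N"
  shows "(\<lambda>x. split_hyp d (f x) (g x) (h x)) \<in> N \<rightarrow>\<^sub>M count_space UNIV \<Otimes>\<^sub>M borel"
  unfolding split_hyp_def Let_def by measurable

lemma split_hyp_eq:
  assumes c: "cell d R a b" and k: "k < d"
    and s: "(\<Sum>j<k. b j - a j) < u * lam d a b" "u * lam d a b \<le> (\<Sum>j<Suc k. b j - a j)"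
  shows "split_hyp d a b u = (k, a k + (u * lam d a b - (\<Sum>j<k. b j - a j)))"
proof -
  have "(LEAST n. u * lam d a b \<le> (\<Sum>j<Suc n. b j - a j)) = k"
  proof (rule Least_equality)
    fix n assume n: "u * lam d a b \<le> (\<Sum>j<Suc n. b j - a j)"
    show "k \<le> n"
    proof (rule ccontr)
      assume "\<not> k \<le> n"
      then have "{..<Suc n} \<subseteq> {..<k}" by auto
      then have "(\<Sum>j<Suc n. b j - a j) \<le> (\<Sum>j<k. b j - a j)"
        using c k by (intro sum_mono2) (auto simp: cell_def less_imp_le)
      with n s show False by simp
    qed
  qed fact
  then show ?thesis by (simp add: split_hyp_def lam_def Let_def)
qed

lemma lam_pos: "cell d R a b \<Longrightarrow> 0 < d \<Longrightarrow> 0 < lam d a b"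
  unfolding lam_def by (intro sum_pos) (auto simp: cell_def)

text \<open>The quantile transform does realise the normalised restriction of Lambda: u l is uniform
  on [0, l], this interval is cut into consecutive pieces of lengths \<open>b k - a k\<close>, and
  on each piece the position is affine in \<open>u\<close> with slope l, whence the factor
  1/l.\<close>

lemma nn_integral_split_hyp:
  assumes c: "cell d R a b" and d: "0 < d"
    and F [measurable]: "F \<in> borel_measurable (count_space UNIV \<Otimes>\<^sub>M borel)"
  shows "(\<integral>\<^sup>+u. F (split_hyp d a b u) \<partial>unif)
    = ennreal (1 / lam d a b) * (\<Sum>k<d. \<integral>\<^sup>+r\<in>{a k..b k}. F (k, r) \<partial>lborel)"
proof -
  define l where "l = lam d a b"
  define S where "S k = (\<Sum>j<k. b j - a j)" for k
  have l: "0 < l" using lam_pos[OF c d] by (simp add: l_def)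
  have S0: "S 0 = 0" and Sd: "S d = l" by (simp_all add: S_def l_def lam_def)
  have SSuc: "S (Suc k) = S k + (b k - a k)" for k by (simp add: S_def)
  have Smono: "S k \<le> S m" if "k \<le> m" "m \<le> d" for k m
    using that c unfolding S_def by (intro sum_mono2) (auto simp: cell_def less_imp_le)
  have ex: "\<exists>k<d. S k < s \<and> s \<le> S (Suc k)" if "0 < s" "s \<le> l" for s
  proof -
    define k where "k = (LEAST n. s \<le> S n)"
    have k: "s \<le> S k" "k \<le> d" using that Sd LeastI[of "\<lambda>n. s \<le> S n" d] Least_le[of "\<lambda>n. s \<le> S n" d]
      by (simp_all add: k_def)
    have "k \<noteq> 0" using k(1) that S0 by (cases k) auto
    then obtain m where m: "k = Suc m" by (cases k) auto
    have "\<not> s \<le> S m" using not_less_Least[of m "\<lambda>n. s \<le> S n"] m by (simp add: k_def)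
    with k m show ?thesis by (intro exI[of _ m]) auto
  qed
  \<comment> \<open>The share of the k-th piece. The pieces are half-open, so every \<open>u\<close>
    in (0, 1] belongs to exactly one of them; \<open>u = 0\<close>, which belongs to none, is a null
    set.\<close>
  define G where "G k u = indicator {S k<..S (Suc k)} (u * l) * F (k, a k + (u * l - S k))" for k u
  have pw: "indicator {0..1} u * F (split_hyp d a b u) = (\<Sum>k<d. G k u)" if "u \<noteq> 0" for u
  proof (cases "0 < u \<and> u \<le> 1")
    case True
    then obtain k where k: "k < d" "S k < u * l" "u * l \<le> S (Suc k)"
      using ex[of "u * l"] l by (auto simp: mult_le_cancel_right1)
    have "(\<Sum>m<d. G m u) = (\<Sum>m<d. if m = k then G k u else 0)"
    proof (intro sum.cong refl)
      fix m assume m: "m \<in> {..<d}"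
      show "G m u = (if m = k then G k u else 0)"
      proof (cases m k rule: linorder_cases)
        case less
        then have "S (Suc m) \<le> S k" using k by (intro Smono) auto
        then show ?thesis using less k by (auto simp: G_def)
      next
        case greater
        then have "S (Suc k) \<le> S m" using m by (intro Smono) auto
        then show ?thesis using greater k by (auto simp: G_def)
      qed auto
    qed
    also have "\<dots> = F (split_hyp d a b u)"
      using k split_hyp_eq[OF c k(1), of u] by (simp add: G_def S_def l_def)
    finally show ?thesis using True by simp
  next
    case False
    have "G k u = 0" if k: "k < d" for k
    proof -
      have "u * l \<notin> {S k<..S (Suc k)}"
      proof (cases "u < 0")
        case True
        then have "u * l < 0" using l by (simp add: mult_neg_pos)
        then show ?thesis using Smono[of 0 k] k S0 by auto
      next
        case uf: False
        then have "1 < u" using False \<open>u \<noteq> 0\<close> by auto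
        then have "l < u * l" using l by simp
        then show ?thesis using Smono[of "Suc k" d] k Sd by auto
      qed
      then show ?thesis by (simp add: G_def)
    qed
    moreover have "u \<notin> {0..1}" using False that by auto
    ultimately show ?thesis by simp
  qed
  have [measurable]: "G k \<in> borel_measurable borel" for k unfolding G_def by measurable
  have [measurable]: "(\<lambda>u. split_hyp d a b u) \<in> borel \<rightarrow>\<^sub>M count_space UNIV \<Otimes>\<^sub>M borel"
    by (intro measurable_split_hyp measurable_const) (auto simp: space_PiM)
  have "(\<integral>\<^sup>+u. F (split_hyp d a b u) \<partial>unif) = (\<integral>\<^sup>+u. indicator {0..1} u * F (split_hyp d a b u) \<partial>lborel)"
    unfolding unif_def by (subst nn_integral_uniform_measure) (auto simp: mult.commute divide_ennreal_def)
  also have "\<dots> = (\<integral>\<^sup>+u. (\<Sum>k<d. G k u) \<partial>lborel)"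
    by (rule nn_integral_cong_AE, rule AE_mp[OF AE_lborel_singleton[of 0]]) (simp add: pw)
  also have "\<dots> = (\<Sum>k<d. \<integral>\<^sup>+u. G k u \<partial>lborel)"
    by (rule nn_integral_sum) simp
  also have "\<dots> = (\<Sum>k<d. ennreal (1 / l) * (\<integral>\<^sup>+r\<in>{a k..b k}. F (k, r) \<partial>lborel))"
  proof (rule sum.cong[OF refl])
    fix k assume "k \<in> {..<d}"
    have "(\<integral>\<^sup>+r\<in>{a k..b k}. F (k, r) \<partial>lborel) = (\<integral>\<^sup>+r. indicator {a k<..b k} r * F (k, r) \<partial>lborel)"
      by (rule nn_integral_cong_AE, rule AE_mp[OF AE_lborel_singleton[of "a k"]])
        (auto simp: indicator_def)
    also have "\<dots> = ennreal \<bar>l\<bar> * (\<integral>\<^sup>+u. indicator {a k<..b k} ((a k - S k) + l * u) * F (k, (a k - S k) + l * u) \<partial>lborel)"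
      using l by (intro nn_integral_real_affine) auto
    also have "(\<lambda>u. indicator {a k<..b k} ((a k - S k) + l * u) * F (k, (a k - S k) + l * u)) = G k"
      by (auto simp: G_def fun_eq_iff SSuc indicator_def algebra_simps)
    finally have "ennreal (1 / l) * (\<integral>\<^sup>+r\<in>{a k..b k}. F (k, r) \<partial>lborel)
        = (ennreal (1 / l) * ennreal l) * (\<integral>\<^sup>+u. G k u \<partial>lborel)"
      using l by (simp add: mult.assoc)
    also have "ennreal (1 / l) * ennreal l = 1"
      using l by (simp flip: ennreal_mult)
    finally show "(\<integral>\<^sup>+u. G k u \<partial>lborel) = ennreal (1 / l) * (\<integral>\<^sup>+r\<in>{a k..b k}. F (k, r) \<partial>lborel)"
      by simp
  qed
  finally show ?thesis by (simp add: sum_distrib_left l_def)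
qed

subsection \<open>Pairs of points separated by a split\<close>

lemma measurable_corner_upd [measurable (raw)]:
  assumes [measurable]: "f \<in> N \<rightarrow>\<^sub>M corner" "k \<in> N \<rightarrow>\<^sub>M count_space UNIV" "r \<in> borel_measurable N"
  shows "(\<lambda>x. (f x)(k x := r x)) \<in> N \<rightarrow>\<^sub>M corner"
proof -
  have "(\<lambda>x j. if j = k x then r x else f x j) \<in> N \<rightarrow>\<^sub>M corner"
    by (rule measurable_abs_UNIV) measurable
  then show ?thesis by (simp add: fun_upd_def)
qed

lemma measure_Lambda:
  "measure (Lambda d) {H. fst H < d \<and> lo (fst H) \<le> snd H \<and> snd H \<le> hi (fst H)}
    = (\<Sum>i<d. max 0 (hi i - lo i))" (is "measure _ ?S = _")
proof -
  have S: "?S = (\<Union>i\<in>{..<d}. {i} \<times> {lo i..hi i})" by auto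
  have "?S \<in> sets (Lambda d)"
    unfolding S Lambda_def by (intro sets.finite_UN pair_measureI) auto
  then have "emeasure (Lambda d) ?S = (\<integral>\<^sup>+i. emeasure lborel (Pair i -` ?S) \<partial>count_space {..<d})"
    unfolding Lambda_def by (intro lborel.emeasure_pair_measure_alt)
  also have "\<dots> = (\<Sum>i<d. ennreal (max 0 (hi i - lo i)))"
    by (subst nn_integral_count_space_finite)
      (auto intro!: sum.cong simp: atLeastAtMost_def[symmetric] emeasure_lborel_Icc_eq max_def
        Collect_conj_eq atLeast_def[symmetric] atMost_def[symmetric] vimage_def)
  also have "\<dots> = ennreal (\<Sum>i<d. max 0 (hi i - lo i))"
    by (rule sum_ennreal) simp
  finally show ?thesis
    by (simp add: measure_def sum_nonneg)
qed

definition dist1 :: "nat \<Rightarrow> (nat \<Rightarrow> real) \<Rightarrow> (nat \<Rightarrow> real) \<Rightarrow> real" where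
  "dist1 d x y = (\<Sum>j<d. \<bar>x j - y j\<bar>)"

text \<open>A hyperplane orthogonal to axis i meets the segment iff its position lies between the
  two i-th coordinates; adding the lengths of these intervals gives the l1 distance.\<close>

lemma measure_hits_seg: "measure (Lambda d) (hits d (seg x y)) = dist1 d x y"
proof -
  have "hits d (seg x y) = {H. fst H < d \<and> min (x (fst H)) (y (fst H)) \<le> snd H \<and> snd H \<le> max (x (fst H)) (y (fst H))}"
  proof (intro set_eqI)
    fix H :: "nat \<times> real"
    obtain i r where H: "H = (i, r)" by (cases H)
    have "(\<exists>u. (1 - u) * x i + u * y i = r \<and> 0 \<le> u \<and> u \<le> 1) \<longleftrightarrow> r \<in> closed_segment (x i) (y i)"
      by (auto simp: in_segment)
    also have "\<dots> \<longleftrightarrow> min (x i) (y i) \<le> r \<and> r \<le> max (x i) (y i)"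
      by (auto simp: closed_segment_eq_real_ivl)
    finally show "H \<in> hits d (seg x y) \<longleftrightarrow>
        H \<in> {H. fst H < d \<and> min (x (fst H)) (y (fst H)) \<le> snd H \<and> snd H \<le> max (x (fst H)) (y (fst H))}"
      by (auto simp: H hits_def hyp_def seg_def)
  qed
  then show ?thesis
    by (simp add: measure_Lambda[of d "\<lambda>i. min (x i) (y i)" "\<lambda>i. max (x i) (y i)"] dist1_def)
      (intro sum.cong; auto)
qed

text \<open>A nonempty box is hit exactly by the positions in its side intervals, whose lengths add
  up to \<open>lam\<close>; a box with a reversed side is empty and hit by nothing.\<close>

lemma measure_hits_box:
  "measure (Lambda d) (hits d (box_d d a b)) = (if \<forall>j<d. a j \<le> b j then lam d a b else 0)"
proof (cases "\<forall>j<d. a j \<le> b j")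
  case True
  have "hits d (box_d d a b) = {H. fst H < d \<and> a (fst H) \<le> snd H \<and> snd H \<le> b (fst H)}"
  proof (intro set_eqI iffI)
    fix H assume H: "H \<in> {H. fst H < d \<and> a (fst H) \<le> snd H \<and> snd H \<le> b (fst H)}"
    have "(\<lambda>j\<in>{..<d}. if j = fst H then snd H else a j) \<in> hyp H \<inter> box_d d a b"
      using H True by (auto simp: hyp_def box_d_def)
    then show "H \<in> hits d (box_d d a b)" using H by (auto simp: hits_def)
  next
    fix H assume "H \<in> hits d (box_d d a b)"
    then obtain x where "fst H < d" "x (fst H) = snd H" "x \<in> box_d d a b"
      by (auto simp: hits_def hyp_def)
    then show "H \<in> {H. fst H < d \<and> a (fst H) \<le> snd H \<and> snd H \<le> b (fst H)}"
      by (force simp: box_d_def PiE_iff)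
  qed
  moreover have "(\<Sum>i<d. max 0 (b i - a i)) = lam d a b"
    unfolding lam_def using True by (intro sum.cong) auto
  ultimately show ?thesis using True measure_Lambda[of d a b] by simp
next
  case False
  then have "box_d d a b = {}" by (auto simp: box_d_def PiE_eq_empty_iff)
  then have "hits d (box_d d a b) = {}" by (simp add: hits_def)
  then show ?thesis using False by auto
qed

definition incell :: "nat \<Rightarrow> (nat \<Rightarrow> real) \<Rightarrow> (nat \<Rightarrow> real) \<Rightarrow> (nat \<Rightarrow> real) \<Rightarrow> bool" where
  "incell d a b x \<longleftrightarrow> (\<forall>j<d. a j \<le> x j \<and> x j \<le> b j)"

text \<open>Extended values, because the weight of interest, 1/L, is infinite for coinciding
  points.\<close>

definition both_in :: "nat \<Rightarrow> (real \<Rightarrow> ennreal) \<Rightarrow> (nat \<Rightarrow> real) \<Rightarrow> (nat \<Rightarrow> real) \<Rightarrow> (nat \<Rightarrow> real) \<Rightarrow> (nat \<Rightarrow> real) \<Rightarrow> ennreal" where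
  "both_in d h a b x y = (if incell d a b x \<and> incell d a b y then h (dist1 d x y) else 0)"

lemma measurable_both_in [measurable (raw)]:
  assumes [measurable]: "h \<in> borel_measurable borel"
    and [measurable]: "f \<in> N \<rightarrow>\<^sub>M corner" "g \<in> N \<rightarrow>\<^sub>M corner"
    and X [measurable]: "\<And>j. j < d \<Longrightarrow> (\<lambda>p. X p j) \<in> borel_measurable N"
    and Y [measurable]: "\<And>j. j < d \<Longrightarrow> (\<lambda>p. Y p j) \<in> borel_measurable N"
  shows "(\<lambda>p. both_in d h (f p) (g p) (X p) (Y p)) \<in> borel_measurable N"
proof -
  have [measurable]: "(\<lambda>p. dist1 d (X p) (Y p)) \<in> borel_measurable N"
    unfolding dist1_def by (rule borel_measurable_sum) simp
  have [measurable]: "Measurable.pred N (\<lambda>p. incell d (f p) (g p) (Z p))"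
    if [measurable]: "\<And>j. j < d \<Longrightarrow> (\<lambda>p. Z p j) \<in> borel_measurable N" for Z
  proof -
    have "Measurable.pred N (\<lambda>p. \<forall>j\<in>{..<d}. f p j \<le> Z p j \<and> Z p j \<le> g p j)"
    proof (rule pred_intros_finite)
      fix j assume "j \<in> {..<d}"
      then have [measurable]: "(\<lambda>p. Z p j) \<in> borel_measurable N" using that by simp
      show "Measurable.pred N (\<lambda>p. f p j \<le> Z p j \<and> Z p j \<le> g p j)" by measurable
    qed simp
    then show ?thesis by (simp add: incell_def)
  qed
  note [measurable] = this[OF X] this[OF Y]
  show ?thesis unfolding both_in_def by measurable
qed

lemma incell_left: "incell d a (b(k := r)) x \<longleftrightarrow> incell d a b x \<and> x k \<le> r" if "k < d" "r \<le> b k"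
proof -
  have "x j \<le> (b(k := r)) j \<longleftrightarrow> x j \<le> b j \<and> (j = k \<longrightarrow> x k \<le> r)" for j
    using that by (cases "j = k") auto
  then show ?thesis using that(1) unfolding incell_def by blast
qed

lemma incell_right: "incell d (a(k := r)) b x \<longleftrightarrow> incell d a b x \<and> r \<le> x k" if "k < d" "a k \<le> r"
proof -
  have "(a(k := r)) j \<le> x j \<longleftrightarrow> a j \<le> x j \<and> (j = k \<longrightarrow> r \<le> x k)" for j
    using that by (cases "j = k") auto
  then show ?thesis using that(1) unfolding incell_def by blast
qed

lemma dist1_le_lam: "incell d a b x \<Longrightarrow> incell d a b y \<Longrightarrow> dist1 d x y \<le> lam d a b"
  unfolding incell_def dist1_def lam_def by (intro sum_mono) (auto simp: abs_real_def; force)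

lemma dist1_nonneg: "0 \<le> dist1 d x y"
  unfolding dist1_def by (intro sum_nonneg) simp

text \<open>A split orthogonal to axis \<open>k\<close> leaves both points in a common child unless
  its position separates them; the other positions have total length
  \<open>(b k - a k) - \<bar>x k - y k\<bar>\<close>. Summed over \<open>k\<close> this is l - L,
  and the normalisation 1/l turns it into the survival probability 1 - L/l.\<close>

lemma same_side:
  assumes c: "cell d R a b" and d: "0 < d"
  shows "ennreal (1 / lam d a b) * (\<Sum>k<d. \<integral>\<^sup>+r\<in>{a k..b k}.
      (both_in d h a (b(k := r)) x y + both_in d h (a(k := r)) b x y) \<partial>lborel)
    = both_in d (\<lambda>L. ennreal (1 - L / lam d a b) * h L) a b x y"
proof -
  define l where "l = lam d a b"
  have l: "0 < l" using lam_pos[OF c d] by (simp add: l_def)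
  have *: "(\<integral>\<^sup>+r\<in>{a k..b k}. (both_in d h a (b(k := r)) x y + both_in d h (a(k := r)) b x y) \<partial>lborel)
      = ennreal ((b k - a k) - \<bar>x k - y k\<bar>) * both_in d h a b x y" if k: "k < d" for k
  proof (cases "incell d a b x \<and> incell d a b y")
    case True
    then have xy: "a k \<le> x k" "x k \<le> b k" "a k \<le> y k" "y k \<le> b k" using k by (auto simp: incell_def)
    have "(\<integral>\<^sup>+r\<in>{a k..b k}. (both_in d h a (b(k := r)) x y + both_in d h (a(k := r)) b x y) \<partial>lborel)
      = (\<integral>\<^sup>+r. h (dist1 d x y) * indicator {max (x k) (y k)..b k} r + h (dist1 d x y) * indicator {a k..min (x k) (y k)} r \<partial>lborel)"
      using True xy k
      by (intro nn_integral_cong) (auto simp: both_in_def incell_left incell_right indicator_def)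
    also have "\<dots> = h (dist1 d x y) * ennreal (b k - max (x k) (y k)) + h (dist1 d x y) * ennreal (min (x k) (y k) - a k)"
      using xy by (subst nn_integral_add) (auto simp: nn_integral_cmult)
    also have "\<dots> = h (dist1 d x y) * ennreal ((b k - max (x k) (y k)) + (min (x k) (y k) - a k))"
      using xy by (subst ennreal_plus) (auto simp: distrib_left)
    also have "(b k - max (x k) (y k)) + (min (x k) (y k) - a k) = (b k - a k) - \<bar>x k - y k\<bar>" by auto
    also have "h (dist1 d x y) * ennreal ((b k - a k) - \<bar>x k - y k\<bar>)
        = ennreal ((b k - a k) - \<bar>x k - y k\<bar>) * both_in d h a b x y"
      using True by (simp add: both_in_def mult.commute)
    finally show ?thesis .
  next
    case False
    then have z: "(both_in d h a (b(k := r)) x y + both_in d h (a(k := r)) b x y) * indicator {a k..b k} r = 0" for r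
      using k by (auto simp: both_in_def incell_left incell_right indicator_def)
    have "(\<integral>\<^sup>+r\<in>{a k..b k}. (both_in d h a (b(k := r)) x y + both_in d h (a(k := r)) b x y) \<partial>lborel) = 0"
      by (simp only: z) simp
    moreover have "both_in d h a b x y = 0" using False by (auto simp: both_in_def)
    ultimately show ?thesis by simp
  qed
  show ?thesis
  proof (cases "incell d a b x \<and> incell d a b y")
    case True
    have nn: "0 \<le> (b k - a k) - \<bar>x k - y k\<bar>" if "k < d" for k
      using True that by (auto simp: incell_def abs_real_def; force)
    have "(\<Sum>k<d. ennreal ((b k - a k) - \<bar>x k - y k\<bar>)) = ennreal (\<Sum>k<d. (b k - a k) - \<bar>x k - y k\<bar>)"
      using nn by (intro sum_ennreal) auto
    also have "(\<Sum>k<d. (b k - a k) - \<bar>x k - y k\<bar>) = l - dist1 d x y"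
      by (simp add: l_def lam_def dist1_def sum_subtractf)
    finally have sum: "(\<Sum>k<d. ennreal ((b k - a k) - \<bar>x k - y k\<bar>)) = ennreal (l - dist1 d x y)" .
    have "ennreal (1 / l) * (\<Sum>k<d. \<integral>\<^sup>+r\<in>{a k..b k}.
      (both_in d h a (b(k := r)) x y + both_in d h (a(k := r)) b x y) \<partial>lborel)
      = ennreal (1 / l) * ((\<Sum>k<d. ennreal ((b k - a k) - \<bar>x k - y k\<bar>)) * both_in d h a b x y)"
      by (simp add: * sum_distrib_right)
    also have "\<dots> = (ennreal (1 / l) * ennreal (l - dist1 d x y)) * h (dist1 d x y)"
      using True by (simp add: sum both_in_def mult.assoc)
    also have "ennreal (1 / l) * ennreal (l - dist1 d x y) = ennreal (1 - dist1 d x y / l)"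
      using l dist1_le_lam[of d a b x y] True
      by (subst ennreal_mult[symmetric]) (auto simp: l_def field_simps)
    also have "ennreal (1 - dist1 d x y / l) * h (dist1 d x y)
        = both_in d (\<lambda>L. ennreal (1 - L / l) * h L) a b x y"
      using True by (simp add: both_in_def)
    finally show ?thesis unfolding l_def .
  next
    case False
    then have "both_in d h a b x y = 0" "both_in d (\<lambda>L. ennreal (1 - L / lam d a b) * h L) a b x y = 0"
      by (auto simp: both_in_def)
    then show ?thesis by (simp add: *)
  qed
qed

text \<open>A point of \<open>chords d i\<close> encodes two points on a common hyperplane orthogonal to the \<open>i\<close>-th axis:
  the position of the hyperplane and the remaining coordinates of either point.\<close>

definition others :: "nat \<Rightarrow> nat \<Rightarrow> (nat \<Rightarrow> real) measure" where
  "others d i = PiM ({..<d} - {i}) (\<lambda>_. lborel)"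

definition chords :: "nat \<Rightarrow> nat \<Rightarrow> (real \<times> (nat \<Rightarrow> real) \<times> (nat \<Rightarrow> real)) measure" where
  "chords d i = lborel \<Otimes>\<^sub>M (others d i \<Otimes>\<^sub>M others d i)"

abbreviation chord_in :: "nat \<Rightarrow> (real \<Rightarrow> ennreal) \<Rightarrow> (nat \<Rightarrow> real) \<Rightarrow> (nat \<Rightarrow> real) \<Rightarrow> nat \<Rightarrow>
    real \<times> (nat \<Rightarrow> real) \<times> (nat \<Rightarrow> real) \<Rightarrow> ennreal" where
  "chord_in d h a b i p \<equiv> both_in d h a b (hyp_emb (i, fst p) (fst (snd p))) (hyp_emb (i, fst p) (snd (snd p)))"

text \<open>The triple integral of the variance formula, over the cell instead of W and with a
  general weight \<open>h\<close> in place of 1/L: the sum over \<open>i\<close> and the position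
  stored in \<open>chords d i\<close> together make up Lambda.\<close>

definition pair_int :: "nat \<Rightarrow> (real \<Rightarrow> ennreal) \<Rightarrow> (nat \<Rightarrow> real) \<Rightarrow> (nat \<Rightarrow> real) \<Rightarrow> ennreal" where
  "pair_int d h a b = (\<Sum>i<d. \<integral>\<^sup>+p. chord_in d h a b i p \<partial>chords d i)"

lemma sigma_finite_others: "sigma_finite_measure (others d i)"
  unfolding others_def by (intro product_sigma_finite.sigma_finite)
    (auto simp: product_sigma_finite_def lborel.sigma_finite_measure_axioms)

lemma sigma_finite_chords: "sigma_finite_measure (chords d i)"
  unfolding chords_def by (intro sigma_finite_pair_measure lborel.sigma_finite_measure_axioms sigma_finite_others)

lemma measurable_hyp_emb_component [measurable (raw)]:
  assumes "j < d" and [measurable]: "f \<in> borel_measurable N" "g \<in> N \<rightarrow>\<^sub>M others d i"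
  shows "(\<lambda>p. hyp_emb (i, f p) (g p) j) \<in> borel_measurable N"
proof (cases "j = i")
  case True then show ?thesis by (simp add: hyp_emb_def)
next
  case False
  with \<open>j < d\<close> have "j \<in> {..<d} - {i}" by simp
  then have "(\<lambda>y. y j) \<in> borel_measurable (others d i)"
    unfolding others_def by (simp add: measurable_component_singleton)
  then have "(\<lambda>p. g p j) \<in> borel_measurable N" by measurable
  with False show ?thesis by (simp add: hyp_emb_def)
qed

lemma measurable_pair_int_integrand:
  assumes [measurable]: "h \<in> borel_measurable borel"
    and [measurable]: "f \<in> N \<rightarrow>\<^sub>M corner" "g \<in> N \<rightarrow>\<^sub>M corner" "P \<in> N \<rightarrow>\<^sub>M chords d i"
  shows "(\<lambda>p. both_in d h (f p) (g p) (hyp_emb (i, fst (P p)) (fst (snd (P p))))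
     (hyp_emb (i, fst (P p)) (snd (snd (P p))))) \<in> borel_measurable N"
proof -
  have [measurable]: "fst \<in> borel_measurable (chords d i)" "(\<lambda>p. fst (snd p)) \<in> chords d i \<rightarrow>\<^sub>M others d i"
      "(\<lambda>p. snd (snd p)) \<in> chords d i \<rightarrow>\<^sub>M others d i"
    unfolding chords_def by measurable
  show ?thesis
    by (intro measurable_both_in measurable_hyp_emb_component) measurable
qed

lemma measurable_pair_int [measurable (raw)]:
  assumes [measurable]: "h \<in> borel_measurable borel"
    and [measurable]: "f \<in> N \<rightarrow>\<^sub>M corner" "g \<in> N \<rightarrow>\<^sub>M corner"
  shows "(\<lambda>x. pair_int d h (f x) (g x)) \<in> borel_measurable N"
proof -
  have "(\<lambda>x. \<integral>\<^sup>+p. both_in d h (f x) (g x) (hyp_emb (i, fst p) (fst (snd p)))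
     (hyp_emb (i, fst p) (snd (snd p))) \<partial>chords d i) \<in> borel_measurable N" for i
  proof -
    interpret c: sigma_finite_measure "chords d i" by (rule sigma_finite_chords)
    show ?thesis
      by (intro c.borel_measurable_nn_integral) (simp add: split_beta', intro measurable_pair_int_integrand; measurable)
  qed
  then show ?thesis unfolding pair_int_def by measurable
qed

lemma const_corner [measurable, simp]: "a \<in> space corner"
  by (simp add: space_PiM)

text \<open>Tonelli moves the expectation over the split inside the pair integral, where
  \<open>same_side\<close> evaluates it pair by pair.\<close>

lemma pair_int_split:
  assumes c: "cell d R a b" and d: "0 < d" and h [measurable]: "h \<in> borel_measurable borel"
  shows "(\<integral>\<^sup>+u. (case split_hyp d a b u of (k, r) \<Rightarrow>
        pair_int d h a (b(k := r)) + pair_int d h (a(k := r)) b) \<partial>unif)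
    = pair_int d (\<lambda>L. ennreal (1 - L / lam d a b) * h L) a b"
proof -
  define w where "w i k p r = both_in d h a (b(k := r)) (hyp_emb (i, fst p) (fst (snd p))) (hyp_emb (i, fst p) (snd (snd p)))
      + both_in d h (a(k := r)) b (hyp_emb (i, fst p) (fst (snd p))) (hyp_emb (i, fst p) (snd (snd p)))"
    for i k :: nat and p :: "real \<times> (nat \<Rightarrow> real) \<times> (nat \<Rightarrow> real)" and r :: real
  have w: "(\<lambda>z. w i k (fst z) (snd z)) \<in> borel_measurable (chords d i \<Otimes>\<^sub>M lborel)" for i k
    unfolding w_def by (intro borel_measurable_add measurable_pair_int_integrand; measurable)
  have m: "(\<lambda>p. chord_in d h a' b' i p)
      \<in> borel_measurable (chords d i)" for a' b' i
    by (intro measurable_pair_int_integrand; measurable)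
  have "(\<integral>\<^sup>+u. (case split_hyp d a b u of (k, r) \<Rightarrow>
        pair_int d h a (b(k := r)) + pair_int d h (a(k := r)) b) \<partial>unif)
    = ennreal (1 / lam d a b) * (\<Sum>k<d. \<integral>\<^sup>+r\<in>{a k..b k}. (\<Sum>i<d. \<integral>\<^sup>+p. w i k p r \<partial>chords d i) \<partial>lborel)"
    by (subst nn_integral_split_hyp[OF c d, of "\<lambda>(k, r). pair_int d h a (b(k := r)) + pair_int d h (a(k := r)) b"])
      (measurable, simp add: pair_int_def w_def nn_integral_add m flip: sum.distrib)
  also have "\<dots> = (\<Sum>i<d. ennreal (1 / lam d a b) * (\<Sum>k<d. \<integral>\<^sup>+p. (\<integral>\<^sup>+r\<in>{a k..b k}. w i k p r \<partial>lborel) \<partial>chords d i))"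
  proof -
    have "(\<integral>\<^sup>+r\<in>{a k..b k}. (\<Sum>i<d. \<integral>\<^sup>+p. w i k p r \<partial>chords d i) \<partial>lborel)
        = (\<Sum>i<d. \<integral>\<^sup>+p. (\<integral>\<^sup>+r\<in>{a k..b k}. w i k p r \<partial>lborel) \<partial>chords d i)" for k
    proof -
      have "(\<integral>\<^sup>+r\<in>{a k..b k}. (\<Sum>i<d. \<integral>\<^sup>+p. w i k p r \<partial>chords d i) \<partial>lborel)
        = (\<Sum>i<d. \<integral>\<^sup>+r. (\<integral>\<^sup>+p. w i k p r * indicator {a k..b k} r \<partial>chords d i) \<partial>lborel)"
      proof (subst nn_integral_sum[symmetric])
        fix i
        interpret c: sigma_finite_measure "chords d i" by (rule sigma_finite_chords)
        have [measurable]: "(\<lambda>z. w i k (snd z) (fst z)) \<in> borel_measurable (lborel \<Otimes>\<^sub>M chords d i)"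
          using measurable_compose[OF measurable_pair_swap' w] by (simp add: split_beta')
        show "(\<lambda>r. \<integral>\<^sup>+p. w i k p r * indicator {a k..b k} r \<partial>chords d i) \<in> borel_measurable lborel"
          by (rule c.borel_measurable_nn_integral) (simp add: split_beta')
      next
        have "(\<lambda>p. w i k p r) \<in> borel_measurable (chords d i)" for i r
          unfolding w_def by (intro borel_measurable_add m)
        then show "(\<integral>\<^sup>+r\<in>{a k..b k}. (\<Sum>i<d. \<integral>\<^sup>+p. w i k p r \<partial>chords d i) \<partial>lborel)
          = (\<integral>\<^sup>+r. (\<Sum>i<d. \<integral>\<^sup>+p. w i k p r * indicator {a k..b k} r \<partial>chords d i) \<partial>lborel)"
          by (simp add: nn_integral_multc sum_distrib_right)
      qed
      also have "\<dots> = (\<Sum>i<d. \<integral>\<^sup>+p. (\<integral>\<^sup>+r\<in>{a k..b k}. w i k p r \<partial>lborel) \<partial>chords d i)"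
      proof (rule sum.cong[OF refl])
        fix i
        interpret c: sigma_finite_measure "chords d i" by (rule sigma_finite_chords)
        interpret p: pair_sigma_finite "chords d i" lborel ..
        note [measurable] = w[of i k]
        show "(\<integral>\<^sup>+r. (\<integral>\<^sup>+p. w i k p r * indicator {a k..b k} r \<partial>chords d i) \<partial>lborel)
            = (\<integral>\<^sup>+p. (\<integral>\<^sup>+r\<in>{a k..b k}. w i k p r \<partial>lborel) \<partial>chords d i)"
          by (rule p.Fubini') (simp add: split_beta')
      qed
      finally show ?thesis .
    qed
    then show ?thesis
      by (simp add: sum_distrib_left) (rule sum.swap)
  qed
  also have "\<dots> = pair_int d (\<lambda>L. ennreal (1 - L / lam d a b) * h L) a b"
    unfolding pair_int_def
  proof (rule sum.cong[OF refl])
    fix i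
    interpret c: sigma_finite_measure "chords d i" by (rule sigma_finite_chords)
    note [measurable] = w
    have [measurable]: "(\<lambda>p. \<integral>\<^sup>+r\<in>{a k..b k}. w i k p r \<partial>lborel) \<in> borel_measurable (chords d i)" for k
      by (rule lborel.borel_measurable_nn_integral) (simp add: split_beta')
    have "ennreal (1 / lam d a b) * (\<Sum>k<d. \<integral>\<^sup>+p. (\<integral>\<^sup>+r\<in>{a k..b k}. w i k p r \<partial>lborel) \<partial>chords d i)
       = (\<integral>\<^sup>+p. ennreal (1 / lam d a b) * (\<Sum>k<d. \<integral>\<^sup>+r\<in>{a k..b k}. w i k p r \<partial>lborel) \<partial>chords d i)"
      by (subst nn_integral_sum[symmetric]) (auto simp: nn_integral_cmult)
    also have "\<dots> = (\<integral>\<^sup>+ p. chord_in d (\<lambda>L. ennreal (1 - L / lam d a b) * h L) a b i p \<partial>chords d i)"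
      unfolding w_def by (simp add: same_side[OF c d])
    finally show "ennreal (1 / lam d a b) * (\<Sum>k<d. \<integral>\<^sup>+p. (\<integral>\<^sup>+r\<in>{a k..b k}. w i k p r \<partial>lborel) \<partial>chords d i)
      = (\<integral>\<^sup>+ p. chord_in d (\<lambda>L. ennreal (1 - L / lam d a b) * h L) a b i p \<partial>chords d i)" .
  qed
  finally show ?thesis .
qed

text \<open>Two points of a cell satisfy 0 <= L <= \<open>lam d a b\<close>, so weights have to be
  compared on this range only; the kernel inequalities are proved on just such a range.\<close>

lemma pair_int_mono:
  assumes "\<And>L. 0 \<le> L \<Longrightarrow> L \<le> lam d a b \<Longrightarrow> h L \<le> g L"
  shows "pair_int d h a b \<le> pair_int d g a b"
  unfolding pair_int_def
  by (intro sum_mono nn_integral_mono) (auto simp: both_in_def intro!: assms dist1_le_lam dist1_nonneg)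

lemma pair_int_add:
  assumes [measurable]: "h \<in> borel_measurable borel" "g \<in> borel_measurable borel"
  shows "pair_int d (\<lambda>L. h L + g L) a b = pair_int d h a b + pair_int d g a b"
proof -
  have m: "(\<lambda>p. chord_in d h' a b i p)
      \<in> borel_measurable (chords d i)" if [measurable]: "h' \<in> borel_measurable borel" for h' i
    by (intro measurable_pair_int_integrand; measurable)
  have *: "both_in d (\<lambda>L. h L + g L) a b x y = both_in d h a b x y + both_in d g a b x y" for x y
    by (simp add: both_in_def)
  show ?thesis
    by (simp add: pair_int_def * nn_integral_add m sum.distrib)
qed

lemma emeasure_others_box:
  assumes "i < d" and ab: "\<And>j. j < d \<Longrightarrow> a j \<le> b j"
  shows "(\<integral>\<^sup>+x. indicator {x. \<forall>j\<in>{..<d} - {i}. a j \<le> x j \<and> x j \<le> b j} x \<partial>others d i) = ennreal (facet d a b i)"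
proof -
  interpret product_sigma_finite "\<lambda>_::nat. lborel :: real measure" ..
  have "(\<integral>\<^sup>+x. indicator {x. \<forall>j\<in>{..<d} - {i}. a j \<le> x j \<and> x j \<le> b j} x \<partial>others d i)
      = (\<integral>\<^sup>+x. (\<Prod>j\<in>{..<d} - {i}. indicator {a j..b j} (x j)) \<partial>others d i)"
    by (intro nn_integral_cong) (auto simp: indicator_def)
  also have "\<dots> = (\<Prod>j\<in>{..<d} - {i}. ennreal (b j - a j))"
    unfolding others_def by (subst product_nn_integral_prod) (auto simp: ab intro!: prod.cong)
  also have "\<dots> = ennreal (facet d a b i)"
    unfolding facet_def using ab by (intro prod_ennreal) auto
  finally show ?thesis .
qed

lemma facet_nonneg: "cell d R a b \<Longrightarrow> 0 \<le> facet d a b i"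
  unfolding facet_def by (intro prod_nonneg) (auto simp: cell_def less_imp_le)

lemma pair_int_const:
  assumes c: "cell d R a b" and "0 \<le> k"
  shows "pair_int d (\<lambda>_. ennreal k) a b = ennreal (k * (\<Sum>i<d. (b i - a i) * (facet d a b i)\<^sup>2))"
proof -
  have ab: "a j \<le> b j" if "j < d" for j using c that by (auto simp: cell_def less_imp_le)
  have "(\<integral>\<^sup>+p. chord_in d (\<lambda>_. ennreal k) a b i p \<partial>chords d i) = ennreal (k * ((b i - a i) * (facet d a b i)\<^sup>2))"
    if i: "i < d" for i
  proof -
    interpret o: sigma_finite_measure "others d i" by (rule sigma_finite_others)
    interpret oo: pair_sigma_finite "others d i" "others d i" ..
    interpret loo: pair_sigma_finite lborel "others d i \<Otimes>\<^sub>M others d i" ..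
    define S where "S = {x. \<forall>j\<in>{..<d} - {i}. a j \<le> x j \<and> x j \<le> b j}"
    have S: "S \<inter> space (others d i) \<in> sets (others d i)"
    proof -
      have "S \<inter> space (others d i) = {x\<in>space (others d i). \<forall>j\<in>{..<d} - {i}. a j \<le> x j \<and> x j \<le> b j}"
        by (auto simp: S_def)
      also have "\<dots> \<in> sets (others d i)" unfolding others_def by measurable
      finally show ?thesis .
    qed
    have [measurable]: "(indicator S :: _ \<Rightarrow> ennreal) \<in> borel_measurable (others d i)"
      by (rule borel_measurable_indicator'[where f = "\<lambda>x. x", simplified])
        (use S in \<open>simp add: Int_def conj_commute\<close>)
    have "incell d a b (hyp_emb (i, s) x) \<longleftrightarrow> a i \<le> s \<and> s \<le> b i \<and> x \<in> S" for s x
      using i by (auto simp: incell_def hyp_emb_def S_def)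
    then have "(\<integral>\<^sup>+p. chord_in d (\<lambda>_. ennreal k) a b i p \<partial>chords d i)
     = (\<integral>\<^sup>+p. (indicator {a i..b i} (fst p) * ennreal k) * (indicator S (fst (snd p)) * indicator S (snd (snd p))) \<partial>chords d i)"
      by (intro nn_integral_cong) (auto simp: both_in_def indicator_def)
    also have "\<dots> = (\<integral>\<^sup>+s. (\<integral>\<^sup>+y. (indicator {a i..b i} s * ennreal k) * (indicator S (fst y) * indicator S (snd y)) \<partial>(others d i \<Otimes>\<^sub>M others d i)) \<partial>lborel)"
      unfolding chords_def by (subst oo.nn_integral_fst[symmetric]) auto
    also have "\<dots> = (\<integral>\<^sup>+s. indicator {a i..b i} s * ennreal k \<partial>lborel) * (\<integral>\<^sup>+y. (indicator S (fst y) * indicator S (snd y)) \<partial>(others d i \<Otimes>\<^sub>M others d i))"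
      by (simp add: nn_integral_cmult nn_integral_multc)
    also have "(\<integral>\<^sup>+y. (indicator S (fst y) * indicator S (snd y)) \<partial>(others d i \<Otimes>\<^sub>M others d i))
        = ennreal (facet d a b i) * ennreal (facet d a b i)"
      using emeasure_others_box[OF i, of a b] ab
      by (subst o.nn_integral_fst[symmetric]) (auto simp: nn_integral_cmult nn_integral_multc S_def[symmetric])
    also have "(\<integral>\<^sup>+s. indicator {a i..b i} s * ennreal k \<partial>lborel) = ennreal (b i - a i) * ennreal k"
      using ab[OF i] by (subst nn_integral_multc) auto
    also have "ennreal (b i - a i) * ennreal k * (ennreal (facet d a b i) * ennreal (facet d a b i))
        = ennreal (k * ((b i - a i) * (facet d a b i)\<^sup>2))"
      using ab[OF i] facet_nonneg[OF c] \<open>0 \<le> k\<close>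
      by (simp flip: ennreal_mult) (simp add: power2_eq_square algebra_simps)
    finally show ?thesis .
  qed
  then show ?thesis
    unfolding pair_int_def using ab \<open>0 \<le> k\<close>
    by (simp add: sum_distrib_left) (intro sum_ennreal mult_nonneg_nonneg; auto)
qed

text \<open>The square of a facet area is the measure of the pairs of points on that facet, so its
  mean is a pair integral with constant weight 1/l. This brings the cost of the first split into the
  same form as the contributions of the children.\<close>

lemma nn_integral_facet_sq:
  assumes c: "cell d R a b" and d: "0 < d"
  shows "(\<integral>\<^sup>+u. ennreal ((facet d a b (fst (split_hyp d a b u)))\<^sup>2) \<partial>unif)
    = pair_int d (\<lambda>_. ennreal (1 / lam d a b)) a b"
proof -
  have "(\<integral>\<^sup>+u. ennreal ((facet d a b (fst (split_hyp d a b u)))\<^sup>2) \<partial>unif)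
      = ennreal (1 / lam d a b) * (\<Sum>k<d. \<integral>\<^sup>+r\<in>{a k..b k}. ennreal ((facet d a b k)\<^sup>2) \<partial>lborel)"
    by (subst nn_integral_split_hyp[OF c d, of "\<lambda>H. ennreal ((facet d a b (fst H))\<^sup>2)"]) auto
  also have "\<dots> = ennreal (1 / lam d a b) * (\<Sum>k<d. ennreal ((b k - a k) * (facet d a b k)\<^sup>2))"
    using c by (intro arg_cong2[of _ _ _ _ "(*)"] sum.cong refl)
      (auto simp: nn_integral_cmult cell_def ennreal_mult' less_imp_le intro: mult.commute)
  also have "\<dots> = ennreal (1 / lam d a b * (\<Sum>k<d. (b k - a k) * (facet d a b k)\<^sup>2))"
    using c lam_pos[OF c d]
    by (subst sum_ennreal, force simp: cell_def less_imp_le, subst ennreal_mult[symmetric])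
      (auto simp: cell_def less_imp_le intro!: sum_nonneg)
  also have "\<dots> = pair_int d (\<lambda>_. ennreal (1 / lam d a b)) a b"
    using lam_pos[OF c d] by (intro pair_int_const[OF c, symmetric]) simp
  finally show ?thesis .
qed

lemma vol_facet: "i < d \<Longrightarrow> vol d a b = (b i - a i) * facet d a b i"
  unfolding vol_def facet_def by (subst prod.remove[of _ i]) auto

lemma nn_integral_facet:
  assumes c: "cell d R a b" and d: "0 < d"
  shows "(\<integral>\<^sup>+u. ennreal (facet d a b (fst (split_hyp d a b u))) \<partial>unif)
    = ennreal (real d * vol d a b / lam d a b)"
proof -
  have vp: "0 \<le> vol d a b" using c unfolding vol_def by (intro prod_nonneg) (auto simp: cell_def less_imp_le)
  have "(\<integral>\<^sup>+u. ennreal (facet d a b (fst (split_hyp d a b u))) \<partial>unif)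
      = ennreal (1 / lam d a b) * (\<Sum>k<d. \<integral>\<^sup>+r\<in>{a k..b k}. ennreal (facet d a b k) \<partial>lborel)"
    by (subst nn_integral_split_hyp[OF c d, of "\<lambda>H. ennreal (facet d a b (fst H))"]) auto
  also have "\<dots> = ennreal (1 / lam d a b) * (\<Sum>k<d. ennreal (vol d a b))"
    using c by (intro arg_cong2[of _ _ _ _ "(*)"] sum.cong refl)
      (auto simp: nn_integral_cmult cell_def ennreal_mult' less_imp_le mult.commute vol_facet facet_nonneg[OF c])
  also have "(\<Sum>k<d. ennreal (vol d a b)) = ennreal (real d * vol d a b)"
    using vp by (simp add: ennreal_mult ennreal_of_nat_eq_real_of_nat)
  also have "ennreal (1 / lam d a b) * ennreal (real d * vol d a b) = ennreal (real d * vol d a b / lam d a b)"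
    using lam_pos[OF c d] vp by (simp flip: ennreal_mult)
  finally show ?thesis .
qed

subsection \<open>The singular kernel and the variance formula\<close>

lemma inverse_ennreal_antimono:
  assumes "0 \<le> x" "x \<le> y" shows "inverse (ennreal y) \<le> inverse (ennreal x)"
proof (cases "x = 0")
  case False
  then show ?thesis using assms by (simp add: inverse_ennreal le_imp_inverse_le ennreal_leI)
qed simp

text \<open>As \<open>\<Lambda>([c]) \<le> D\<close> for all cells, \<open>(1 - L / D) ^ n\<close> bounds the probability that two points with
  \<open>\<Lambda>([xy]) = L\<close> share a cell of generation \<open>n\<close>. The inverse is taken in the extended reals, so that
  \<open>kern D n 0 = \<infinity>\<close>.\<close>

definition kern :: "real \<Rightarrow> nat \<Rightarrow> real \<Rightarrow> ennreal" where
  "kern D n L = ennreal ((1 - L / D) ^ n) * inverse (ennreal L)"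

lemma measurable_kern [measurable]: "kern D n \<in> borel_measurable borel"
  unfolding kern_def by measurable

lemma kern_0: "kern D 0 L = inverse (ennreal L)"
  by (simp add: kern_def)

text \<open>The fixed point equation that makes 1/L the variance kernel: the cost 1/l of the split
  and the surviving share of 1/L restore 1/L. For \<open>L = 0\<close> both sides are
  infinite.\<close>

lemma kern_split:
  assumes "0 < l" "0 \<le> L" "L \<le> l"
  shows "ennreal (1 / l) + ennreal (1 - L / l) * kern D 0 L = kern D 0 L"
proof (cases "L = 0")
  case False
  then have "ennreal (1 / l) + ennreal (1 - L / l) * inverse (ennreal L) = ennreal (1 / l + (1 - L / l) * inverse L)"
    using assms by (simp add: inverse_ennreal ennreal_mult)
  also have "1 / l + (1 - L / l) * inverse L = inverse L"
    using assms False by (simp add: field_simps)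
  finally show ?thesis using False assms by (simp add: kern_0 inverse_ennreal)
qed (simp add: kern_0)

text \<open>As \<open>l \<le> D\<close>, the survival probability 1 - L/l is at most 1 - L/D, so
  surviving one more generation is paid for by one more power.\<close>

lemma kern_Suc_ge:
  assumes "0 < l" "l \<le> D" "0 \<le> L" "L \<le> l"
  shows "ennreal (1 - L / l) * kern D n L \<le> kern D (Suc n) L"
proof -
  have "L / D \<le> L / l" using assms by (intro divide_left_mono) auto
  then have "ennreal (1 - L / l) * ennreal ((1 - L / D) ^ n) \<le> ennreal (1 - L / D) * ennreal ((1 - L / D) ^ n)"
    by (intro mult_right_mono ennreal_leI) auto
  also have "\<dots> = ennreal ((1 - L / D) ^ Suc n)"
    using assms by (subst ennreal_mult[symmetric]) auto
  finally show ?thesis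
    unfolding kern_def mult.assoc[symmetric] by (rule mult_right_mono) simp
qed

lemma pair_int_kern_split:
  assumes c: "cell d R a b" and d: "0 < d"
  shows "pair_int d (\<lambda>_. ennreal (1 / lam d a b)) a b + pair_int d (\<lambda>L. ennreal (1 - L / lam d a b) * kern D 0 L) a b
    = pair_int d (kern D 0) a b"
proof -
  have l: "0 < lam d a b" by (rule lam_pos[OF c d])
  have "pair_int d (\<lambda>L. ennreal (1 / lam d a b) + ennreal (1 - L / lam d a b) * kern D 0 L) a b
    = pair_int d (kern D 0) a b"
    by (intro antisym pair_int_mono) (simp_all add: kern_split[OF l])
  then show ?thesis by (subst (asm) pair_int_add) auto
qed

lemma pair_int_kern_Suc:
  assumes c: "cell d R a b" and d: "0 < d" and D: "lam d a b \<le> D"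
  shows "pair_int d (\<lambda>L. ennreal (1 - L / lam d a b) * kern D n L) a b \<le> pair_int d (kern D (Suc n)) a b"
  using lam_pos[OF c d] D by (intro pair_int_mono kern_Suc_ge)

text \<open>The integral of t^(-1/2) over [0, 1] is 2; the shift by \<open>y\<close> moves [0, 1]
  into [-1, 1], where each half contributes 2.\<close>

lemma nn_integral_inverse_sqrt:
  assumes "0 \<le> y" "y \<le> 1"
  shows "(\<integral>\<^sup>+t\<in>{0..1}. inverse (ennreal (sqrt \<bar>t - y\<bar>)) \<partial>lborel) \<le> 4"
proof -
  define f where "f t = inverse (ennreal (sqrt \<bar>t\<bar>))" for t :: real
  have [measurable]: "f \<in> borel_measurable borel" unfolding f_def by measurable
  have f: "f t = ennreal (t powr (- 1 / 2))" if "0 < t" for t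
  proof -
    have "inverse (sqrt t) = t powr (- (1 / 2))"
      using that by (simp add: powr_minus powr_half_sqrt)
    then show ?thesis using that by (simp add: f_def inverse_ennreal)
  qed
  have hi: "((\<lambda>t::real. t powr (- 1 / 2)) has_integral 1 powr (- 1 / 2 + 1) / (- 1 / 2 + 1)) {0..1}"
    by (rule has_integral_powr_from_0) auto
  have "(\<integral>\<^sup>+t\<in>{0..1}. f t \<partial>lborel) = (\<integral>\<^sup>+t. ennreal (t powr (- 1 / 2)) * indicator {0..1} t \<partial>lborel)"
    by (rule nn_integral_cong_AE, rule AE_mp[OF AE_lborel_singleton[of 0]])
      (auto simp: indicator_def f)
  also have "\<dots> = ennreal (1 powr (- 1 / 2 + 1) / (- 1 / 2 + 1))"
    by (rule nn_integral_has_integral_lebesgue'[OF _ hi]) simp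
  also have "\<dots> = 2" by simp
  finally have f01: "(\<integral>\<^sup>+t\<in>{0..1}. f t \<partial>lborel) = 2" .
  have "(\<integral>\<^sup>+t\<in>{- 1..0}. f t \<partial>lborel) = (\<integral>\<^sup>+t. f (- t) * indicator {- 1..0} (- t) \<partial>lborel)"
    by (subst nn_integral_real_affine[where c = "- 1" and t = 0]) auto
  also have "\<dots> = (\<integral>\<^sup>+t\<in>{0..1}. f t \<partial>lborel)"
    by (intro nn_integral_cong) (auto simp: f_def indicator_def)
  finally have fm: "(\<integral>\<^sup>+t\<in>{- 1..0}. f t \<partial>lborel) = 2" using f01 by simp
  have "(\<integral>\<^sup>+t\<in>{0..1}. inverse (ennreal (sqrt \<bar>t - y\<bar>)) \<partial>lborel) \<le> (\<integral>\<^sup>+t. f (- y + 1 * t) * indicator {- 1..1} (- y + 1 * t) \<partial>lborel)"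
    using assms by (intro nn_integral_mono) (auto simp: f_def indicator_def)
  also have "\<dots> = (\<integral>\<^sup>+t. f t * indicator {- 1..1} t \<partial>lborel)"
    by (subst (2) nn_integral_real_affine[where c = 1 and t = "- y"]) auto
  also have "\<dots> \<le> (\<integral>\<^sup>+t. f t * indicator {- 1..0} t + f t * indicator {0..1} t \<partial>lborel)"
    by (intro nn_integral_mono) (auto simp: indicator_def)
  also have "\<dots> = 4" by (subst nn_integral_add) (auto simp: f01 fm)
  finally show ?thesis .
qed

definition ucube :: "nat \<Rightarrow> nat \<Rightarrow> (nat \<Rightarrow> real) set" where
  "ucube d i = {x. \<forall>j\<in>{..<d} - {i}. 0 \<le> x j \<and> x j \<le> 1}"

definition dist_others :: "nat \<Rightarrow> nat \<Rightarrow> (nat \<Rightarrow> real) \<Rightarrow> (nat \<Rightarrow> real) \<Rightarrow> real" where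
  "dist_others d i x y = (\<Sum>j\<in>{..<d} - {i}. \<bar>x j - y j\<bar>)"

lemma dist1_hyp_emb: "i < d \<Longrightarrow> dist1 d (hyp_emb (i, s) x) (hyp_emb (i, s) y) = dist_others d i x y"
  unfolding dist1_def dist_others_def
  by (subst sum.remove[of _ i]) (auto simp: hyp_emb_def intro!: sum.cong)

lemma dist_others_nonneg: "0 \<le> dist_others d i x y"
  unfolding dist_others_def by (intro sum_nonneg) simp

lemma measurable_others_component:
  assumes j: "j \<in> {..<d} - {i}" and [measurable]: "g \<in> N \<rightarrow>\<^sub>M others d i"
  shows "(\<lambda>p. g p j) \<in> borel_measurable N"
proof -
  have "(\<lambda>y. y j) \<in> borel_measurable (others d i)"
    using j unfolding others_def by (simp add: measurable_component_singleton)
  then show ?thesis by measurable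
qed

lemma measurable_dist_others [measurable (raw)]:
  assumes [measurable]: "f \<in> N \<rightarrow>\<^sub>M others d i" "g \<in> N \<rightarrow>\<^sub>M others d i"
  shows "(\<lambda>p. dist_others d i (f p) (g p)) \<in> borel_measurable N"
  unfolding dist_others_def
  by (intro borel_measurable_sum borel_measurable_abs borel_measurable_diff measurable_others_component) auto

lemma measurable_ucube [measurable (raw)]:
  assumes [measurable]: "f \<in> N \<rightarrow>\<^sub>M others d i"
  shows "(\<lambda>p. indicator (ucube d i) (f p) :: ennreal) \<in> borel_measurable N"
proof -
  have "Measurable.pred N (\<lambda>p. \<forall>j\<in>{..<d} - {i}. 0 \<le> f p j \<and> f p j \<le> 1)"
  proof (rule pred_intros_finite)
    fix j assume j: "j \<in> {..<d} - {i}"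
    have [measurable]: "(\<lambda>p. f p j) \<in> borel_measurable N"
      by (rule measurable_others_component[OF j]) measurable
    show "Measurable.pred N (\<lambda>p. 0 \<le> f p j \<and> f p j \<le> 1)" by measurable
  qed simp
  then show ?thesis
    by (intro borel_measurable_indicator') (simp add: ucube_def pred_def)
qed

definition inv_dist_int :: "nat \<Rightarrow> nat \<Rightarrow> (nat \<Rightarrow> real) \<Rightarrow> ennreal" where
  "inv_dist_int d i y = (\<integral>\<^sup>+x. indicator (ucube d i) x * inverse (ennreal (dist_others d i x y)) \<partial>others d i)"

text \<open>As \<open>d > 2\<close>, two coordinates \<open>j \<noteq> k\<close> are left on the facet, and
  \<open>\<parallel>x - y\<parallel>\<^sub>1 \<ge> (\<bar>x j - y j\<bar> \<bar>x k - y k\<bar>)\<^bsup>1/2\<^esup>\<close> reduces the singularity to integrable one-dimensional ones.\<close>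

lemma inv_dist_int_le:
  assumes d: "2 < d" and y: "y \<in> ucube d i"
  shows "inv_dist_int d i y \<le> 16"
proof -
  interpret product_sigma_finite "\<lambda>_::nat. lborel :: real measure" ..
  define I where "I = {..<d} - {i}"
  have "\<not> card I \<le> Suc 0" using d by (auto simp: I_def card_Diff_singleton_if)
  then obtain j k where jk: "j \<in> I" "k \<in> I" "j \<noteq> k"
    by (subst (asm) card_le_Suc0_iff_eq) (auto simp: I_def)
  define I' where "I' = I - {j} - {k}"
  have I: "I = insert j (insert k I')" "j \<notin> insert k I'" "k \<notin> I'" "finite I'"
    using jk by (auto simp: I'_def I_def)
  \<comment> \<open>The singularity is shared between the coordinates \<open>j\<close> and
    \<open>k\<close>; all others get the factor 1.\<close>
  define \<kappa> where "\<kappa> m t = (if m = j \<or> m = k then inverse (ennreal (sqrt \<bar>t - y m\<bar>)) else 1)" for m and t :: real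
  define g where "g m t = indicator {0..1} t * \<kappa> m t" for m and t :: real
  have [measurable]: "g m \<in> borel_measurable borel" for m unfolding g_def \<kappa>_def by measurable
  have le: "indicator (ucube d i) x * inverse (ennreal (dist_others d i x y)) \<le> (\<Prod>m\<in>I. g m (x m))" for x
  proof (cases "x \<in> ucube d i")
    case True
    define p q where "p = \<bar>x j - y j\<bar>" and "q = \<bar>x k - y k\<bar>"
    have pq: "0 \<le> p" "0 \<le> q" by (simp_all add: p_def q_def)
    have "sqrt p * sqrt q \<le> (p + q) / 2"
      using arith_geo_mean_sqrt[OF pq] by (simp add: real_sqrt_mult)
    also have "\<dots> \<le> p + q" using pq by simp
    also have "\<dots> \<le> dist_others d i x y"
      unfolding dist_others_def I_def[symmetric] using I
      by (simp add: p_def q_def sum_nonneg)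
    finally have "inverse (ennreal (dist_others d i x y)) \<le> inverse (ennreal (sqrt p * sqrt q))"
      using pq by (intro inverse_ennreal_antimono) auto
    also have "\<dots> = inverse (ennreal (sqrt p)) * inverse (ennreal (sqrt q))"
      using pq by (simp add: ennreal_mult ennreal_inverse_mult)
    also have "\<dots> = (\<Prod>m\<in>I. \<kappa> m (x m))"
    proof -
      have "(\<Prod>m\<in>I'. \<kappa> m (x m)) = 1"
        using I by (intro prod.neutral) (auto simp: \<kappa>_def)
      then show ?thesis using I by (simp add: \<kappa>_def p_def q_def)
    qed
    also have "\<dots> = (\<Prod>m\<in>I. g m (x m))"
      using True by (intro prod.cong) (auto simp: g_def ucube_def I_def)
    finally show ?thesis using True by simp
  qed simp
  have g4: "integral\<^sup>N lborel (g m) \<le> 4" if "m = j \<or> m = k" for m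
  proof -
    have "0 \<le> y m" "y m \<le> 1" using y that jk by (auto simp: ucube_def I_def)
    then show ?thesis
      using nn_integral_inverse_sqrt[of "y m"] that by (auto simp: g_def[abs_def] \<kappa>_def mult.commute)
  qed
  have g1: "integral\<^sup>N lborel (g m) = 1" if "m \<in> I'" for m
  proof -
    have "m \<noteq> j" "m \<noteq> k" using that I(2,3) by auto
    then show ?thesis by (simp add: g_def[abs_def] \<kappa>_def)
  qed
  have "inv_dist_int d i y \<le> (\<integral>\<^sup>+x. (\<Prod>m\<in>I. g m (x m)) \<partial>others d i)"
    unfolding inv_dist_int_def by (intro nn_integral_mono le)
  also have "\<dots> = (\<Prod>m\<in>I. integral\<^sup>N lborel (g m))"
    unfolding others_def I_def[symmetric] by (subst product_nn_integral_prod) (auto simp: I)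
  also have "\<dots> = integral\<^sup>N lborel (g j) * (integral\<^sup>N lborel (g k) * 1)"
    using I g1 by simp
  \<comment> \<open>At most 4 for each of the two singular coordinates, which is where the bound 16
    comes from.\<close>
  also have "\<dots> \<le> 4 * (4 * 1)" by (intro mult_mono g4) auto
  finally show ?thesis by simp
qed

text \<open>The distance of two points on a hyperplane does not involve its position, so this is the
  inner double integral of the variance formula for every hyperplane orthogonal to axis
  \<open>i\<close> that hits the unit cube.\<close>

definition facet_energy :: "nat \<Rightarrow> nat \<Rightarrow> ennreal" where
  "facet_energy d i = (\<integral>\<^sup>+y. indicator (ucube d i) y * inv_dist_int d i y \<partial>others d i)"

lemma nn_integral_ucube:
  assumes "i < d" shows "(\<integral>\<^sup>+y. indicator (ucube d i) y \<partial>others d i) = 1"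
  using emeasure_others_box[OF assms, of "\<lambda>_. 0" "\<lambda>_. 1"] by (simp add: ucube_def facet_def)

lemma measurable_inv_dist_int [measurable]: "inv_dist_int d i \<in> borel_measurable (others d i)"
proof -
  interpret o: sigma_finite_measure "others d i" by (rule sigma_finite_others)
  show ?thesis unfolding inv_dist_int_def by measurable
qed

lemma facet_energy_le:
  assumes "2 < d" "i < d" shows "facet_energy d i \<le> 16"
proof -
  have "facet_energy d i \<le> (\<integral>\<^sup>+y. 16 * indicator (ucube d i) y \<partial>others d i)"
    unfolding facet_energy_def
    by (intro nn_integral_mono) (auto simp: indicator_def inv_dist_int_le[OF assms(1)])
  also have "\<dots> = 16" using assms by (subst nn_integral_cmult) (auto simp: nn_integral_ucube)
  finally show ?thesis .
qed

text \<open>The position of the hyperplane separates from the two points and ranges over [0, 1],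
  contributing a factor 1.\<close>

lemma pair_int_kern0_unit:
  "pair_int d (kern D 0) (\<lambda>_. 0) (\<lambda>_. 1) = (\<Sum>i<d. facet_energy d i)"
  unfolding pair_int_def
proof (rule sum.cong[OF refl])
  fix i assume "i \<in> {..<d}" then have i: "i < d" by simp
  interpret o: sigma_finite_measure "others d i" by (rule sigma_finite_others)
  interpret oo: pair_sigma_finite "others d i" "others d i" ..
  interpret loo: pair_sigma_finite lborel "others d i \<Otimes>\<^sub>M others d i" ..
  have inc: "incell d (\<lambda>_. 0) (\<lambda>_. 1) (hyp_emb (i, s) x) \<longleftrightarrow> s \<in> {0..1} \<and> x \<in> ucube d i" for s x
    using i by (auto simp: incell_def hyp_emb_def ucube_def)
  have "(\<integral>\<^sup>+p. chord_in d (kern D 0) (\<lambda>_. 0) (\<lambda>_. 1) i p \<partial>chords d i)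
    = (\<integral>\<^sup>+p. indicator {0..1} (fst p) * (indicator (ucube d i) (snd (snd p)) *
        (indicator (ucube d i) (fst (snd p)) * inverse (ennreal (dist_others d i (fst (snd p)) (snd (snd p)))))) \<partial>chords d i)"
    by (intro nn_integral_cong) (auto simp: both_in_def inc dist1_hyp_emb[OF i] kern_0 indicator_def)
  also have "\<dots> = (\<integral>\<^sup>+s. (\<integral>\<^sup>+z. indicator {0..1} (s::real) * (indicator (ucube d i) (snd z) *
        (indicator (ucube d i) (fst z) * inverse (ennreal (dist_others d i (fst z) (snd z))))) \<partial>(others d i \<Otimes>\<^sub>M others d i)) \<partial>lborel)"
    unfolding chords_def by (subst oo.nn_integral_fst[symmetric]) auto
  also have "\<dots> = (\<integral>\<^sup>+s. indicator {0..1} s \<partial>(lborel :: real measure)) * (\<integral>\<^sup>+z. (indicator (ucube d i) (snd z) *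
        (indicator (ucube d i) (fst z) * inverse (ennreal (dist_others d i (fst z) (snd z))))) \<partial>(others d i \<Otimes>\<^sub>M others d i))"
    by (subst nn_integral_cmult) (measurable, subst nn_integral_multc, auto)
  also have "(\<integral>\<^sup>+z. (indicator (ucube d i) (snd z) *
        (indicator (ucube d i) (fst z) * inverse (ennreal (dist_others d i (fst z) (snd z))))) \<partial>(others d i \<Otimes>\<^sub>M others d i))
     = (\<integral>\<^sup>+y. \<integral>\<^sup>+x. (indicator (ucube d i) y *
        (indicator (ucube d i) x * inverse (ennreal (dist_others d i x y)))) \<partial>others d i \<partial>others d i)"
    by (subst oo.nn_integral_snd[symmetric]) (auto simp: split_beta')
  also have "\<dots> = facet_energy d i"
    unfolding facet_energy_def inv_dist_int_def by (intro nn_integral_cong, subst nn_integral_cmult) auto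
  finally show "(\<integral>\<^sup>+p. chord_in d (kern D 0) (\<lambda>_. 0) (\<lambda>_. 1) i p \<partial>chords d i)
     = facet_energy d i" by simp
qed

lemma facet_energy_sum_finite: "2 < d \<Longrightarrow> (\<Sum>i<d. facet_energy d i) < \<infinity>"
  by (auto intro!: le_less_trans[OF facet_energy_le])

lemma kern_le_kern0:
  assumes "0 \<le> L" "L \<le> D" shows "kern D n L \<le> kern D 0 L"
proof (cases "D = 0")
  case True then show ?thesis by (simp add: kern_def)
next
  case False
  then have "ennreal ((1 - L / D) ^ n) \<le> 1"
    using assms by (auto intro!: power_le_one simp: divide_le_eq_1)
  from mult_right_mono[OF this, of "inverse (ennreal L)"] show ?thesis by (simp add: kern_def)
qed

text \<open>Dominated convergence with majorant \<open>kern D 0\<close>. The factor (1 - L/D)^n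
  tends to 0 for every L in (0, D]. For L = 0 it does not, but there the majorant is infinite, so by
  the finiteness of its integral such pairs form a null set.\<close>

lemma pair_int_kern_tendsto_0:
  assumes fin: "pair_int d (kern D 0) a b < \<infinity>" and D: "lam d a b \<le> D"
  shows "(\<lambda>n. pair_int d (kern D n) a b) \<longlonglongrightarrow> 0"
proof -
  have "(\<lambda>n. \<Sum>i<d. \<integral>\<^sup>+p. chord_in d (kern D n) a b i p \<partial>chords d i) \<longlonglongrightarrow> (\<Sum>i<d. \<integral>\<^sup>+p. 0 \<partial>chords d i)"
  proof (rule tendsto_sum)
    fix i assume i: "i \<in> {..<d}"
    define u where "u n p = chord_in d (kern D n) a b i p" for n p
    have m: "u n \<in> borel_measurable (chords d i)" for n
      unfolding u_def by (intro measurable_pair_int_integrand; measurable)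
    have le: "u n p \<le> u 0 p" for n p
    proof -
      show ?thesis
        using kern_le_kern0[of _ D n] order_trans[OF dist1_le_lam D] dist1_nonneg unfolding u_def both_in_def by simp
    qed
    have "(\<integral>\<^sup>+p. u 0 p \<partial>chords d i) \<le> pair_int d (kern D 0) a b"
      unfolding pair_int_def u_def using i by (intro member_le_sum) auto
    with fin have fin': "(\<integral>\<^sup>+p. u 0 p \<partial>chords d i) < \<infinity>" by (rule le_less_trans[rotated])
    have "AE p in chords d i. u 0 p \<noteq> \<infinity>"
      by (rule nn_integral_PInf_AE[OF m]) (use fin' in auto)
    then have lim: "AE p in chords d i. (\<lambda>n. u n p) \<longlonglongrightarrow> 0"
    proof eventually_elim
      case (elim p)
      define x y where "x = hyp_emb (i, fst p) (fst (snd p))" and "y = hyp_emb (i, fst p) (snd (snd p))"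
      show ?case
      proof (cases "incell d a b x \<and> incell d a b y")
        case True
        define L where "L = dist1 d x y"
        have u: "u n p = kern D n L" for n using True by (simp add: u_def both_in_def x_def y_def L_def)
        have "L \<noteq> 0" using elim by (auto simp: u kern_0)
        then have L: "0 < L" "L \<le> D" using dist1_nonneg[of d x y] dist1_le_lam[of d a b x y] True D
          by (auto simp: L_def)
        have "(\<lambda>n. (1 - L / D) ^ n * inverse L) \<longlonglongrightarrow> 0 * inverse L"
          using L by (intro tendsto_mult LIMSEQ_power_zero tendsto_const) (auto simp: abs_real_def)
        then have "(\<lambda>n. ennreal ((1 - L / D) ^ n * inverse L)) \<longlonglongrightarrow> ennreal 0"
          by (intro tendsto_ennrealI) simp
        moreover have "kern D n L = ennreal ((1 - L / D) ^ n * inverse L)" for n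
          using L by (simp add: kern_def inverse_ennreal ennreal_mult)
        ultimately show ?thesis by (simp add: u)
      next
        case False
        then have "u n p = 0" for n by (auto simp: u_def both_in_def x_def y_def)
        then show ?thesis by simp
      qed
    qed
    have "(\<lambda>n. \<integral>\<^sup>+p. u n p \<partial>chords d i) \<longlonglongrightarrow> (\<integral>\<^sup>+p. 0 \<partial>chords d i)"
      by (rule nn_integral_dominated_convergence[OF m _ m _ fin' lim]) (auto simp: le)
    then show "(\<lambda>n. \<integral>\<^sup>+p. chord_in d (kern D n) a b i p \<partial>chords d i) \<longlonglongrightarrow> (\<integral>\<^sup>+p. 0 \<partial>chords d i)" by (simp add: u_def)
  qed
  then show ?thesis by (simp add: pair_int_def)
qed

section \<open>The variance formula in terms of facet energies\<close>

lemma measurable_hyp_emb: "i < d \<Longrightarrow> hyp_emb (i, s) \<in> others d i \<rightarrow>\<^sub>M PiM {..<d} (\<lambda>_. lborel)"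
proof (rule measurable_PiM_single')
  fix j assume "i < d" "j \<in> {..<d}"
  then show "(\<lambda>x. hyp_emb (i, s) x j) \<in> others d i \<rightarrow>\<^sub>M lborel"
    by (simp add: measurable_hyp_emb_component)
qed (auto simp: hyp_emb_def others_def space_PiM PiE_iff extensional_def)

lemma hits_unit:
  "hits d (box_d d (\<lambda>_. 0) (\<lambda>_. 1)) = {H. fst H < d \<and> 0 \<le> snd H \<and> snd H \<le> 1}"
proof (intro set_eqI iffI)
  fix H assume H: "H \<in> {H. fst H < d \<and> 0 \<le> snd H \<and> snd H \<le> (1::real)}"
  then have "(\<lambda>j\<in>{..<d}. snd H) \<in> hyp H \<inter> box_d d (\<lambda>_. 0) (\<lambda>_. 1)"
    by (auto simp: hyp_def box_d_def)
  then show "H \<in> hits d (box_d d (\<lambda>_. 0) (\<lambda>_. 1))" using H by (auto simp: hits_def)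
next
  fix H assume "H \<in> hits d (box_d d (\<lambda>_. 0) (\<lambda>_. 1))"
  then obtain x where "fst H < d" "x (fst H) = snd H" "x \<in> box_d d (\<lambda>_. 0) (\<lambda>_. 1)"
    by (auto simp: hits_def hyp_def)
  moreover from this have "x (fst H) \<in> {0..1}"
    using PiE_mem[of x "{..<d}" "\<lambda>_. {0..1}" "fst H"] unfolding box_d_def by simp
  ultimately show "H \<in> {H. fst H < d \<and> 0 \<le> snd H \<and> snd H \<le> 1}" by simp
qed

lemma integral_hyp_meas:
  fixes f :: "(nat \<Rightarrow> real) \<Rightarrow> real"
  assumes "i < d" "f \<in> borel_measurable (PiM {..<d} (\<lambda>_. lborel))"
  shows "(\<integral>x. f x \<partial>hyp_meas d (i, s)) = (\<integral>x. f (hyp_emb (i, s) x) \<partial>others d i)"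
  unfolding hyp_meas_def fst_conv others_def[symmetric]
  by (rule integral_distr[OF measurable_hyp_emb[OF assms(1)] assms(2)])

text \<open>\<open>var_formula\<close> is built from real integrals, which default to 0 without
  integrability, and from a division with 1/0 = 0, whereas the facet energies carry an infinite
  value on the diagonal. For \<open>d > 2\<close> the extended integrals are finite, so the diagonal
  is negligible and both readings agree.\<close>

lemma var_formula_unit:
  assumes d: "2 < d"
  shows "var_formula d (box_d d (\<lambda>_. 0) (\<lambda>_. 1)) = enn2real (\<Sum>i<d. facet_energy d i)"
proof -
  define W where "W = box_d d (\<lambda>_. 0) (\<lambda>_. 1)"
  define P where "P = PiM {..<d} (\<lambda>_. lborel :: real measure)"
  have W [measurable]: "W \<in> sets P" unfolding W_def P_def box_d_def by (intro sets_PiM_I_finite) auto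
  have [measurable]: "(\<lambda>x. dist1 d x y) \<in> borel_measurable P" for y
    unfolding dist1_def P_def by (intro borel_measurable_sum borel_measurable_abs borel_measurable_diff
      borel_measurable_const measurable_component_singleton[where M = "\<lambda>_. lborel", simplified]) auto
  define G where "G i s = (\<integral>y. indicator W y * (\<integral>x. indicator W x / dist1 d x y \<partial>hyp_meas d (i, s)) \<partial>hyp_meas d (i, s))" for i s
  have G: "G i s = enn2real (facet_energy d i)" if i: "i < d" and s: "0 \<le> s" "s \<le> 1" for i s
  proof -
    interpret o: sigma_finite_measure "others d i" by (rule sigma_finite_others)
    have ind: "indicator W (hyp_emb (i, s) x) = (indicator (ucube d i) x :: real)" if "x \<in> space (others d i)" for x
    proof -
      have "hyp_emb (i, s) x \<in> extensional {..<d}"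
        using that i by (auto simp: hyp_emb_def others_def space_PiM PiE_iff extensional_def)
      moreover have "(\<forall>j<d. hyp_emb (i, s) x j \<in> {0..1}) \<longleftrightarrow> x \<in> ucube d i"
        using i s by (auto simp: hyp_emb_def ucube_def)
      ultimately have "hyp_emb (i, s) x \<in> W \<longleftrightarrow> x \<in> ucube d i"
        by (auto simp: W_def box_d_def PiE_iff)
      then show ?thesis by (simp add: indicator_def)
    qed
    have uc: "(indicator (ucube d i) :: _ \<Rightarrow> real) \<in> borel_measurable (others d i)" (is "?f \<in> _") for i
    proof -
      have "(\<lambda>x. enn2real (indicator (ucube d i) x)) \<in> borel_measurable (others d i)" by measurable
      moreover have "(\<lambda>x. enn2real (indicator (ucube d i) x)) = ?f" by (auto simp: indicator_def)
      ultimately show ?thesis by simp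
    qed
    note [measurable] = uc
    have inner: "(\<integral>x. indicator W x / dist1 d x y \<partial>hyp_meas d (i, s)) = enn2real (inv_dist_int d i y')"
      if y: "y = hyp_emb (i, s) y'" and y': "y' \<in> space (others d i)" "y' \<in> ucube d i" for y y'
    proof -
      have [measurable]: "(\<lambda>x. dist_others d i x y') \<in> borel_measurable (others d i)"
        using y' by measurable
      have "(\<integral>x. indicator W x / dist1 d x y \<partial>hyp_meas d (i, s))
          = (\<integral>x. indicator (ucube d i) x / dist_others d i x y' \<partial>others d i)"
        by (subst integral_hyp_meas[OF i])
          (auto simp: y ind dist1_hyp_emb[OF i] P_def[symmetric] intro!: Bochner_Integration.integral_cong)
      also have "\<dots> = enn2real (\<integral>\<^sup>+x. ennreal (indicator (ucube d i) x / dist_others d i x y') \<partial>others d i)"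
        by (intro integral_eq_nn_integral) (auto simp: dist_others_nonneg)
      also have "(\<integral>\<^sup>+x. ennreal (indicator (ucube d i) x / dist_others d i x y') \<partial>others d i) = inv_dist_int d i y'"
        unfolding inv_dist_int_def
      proof (rule nn_integral_cong_AE)
        have "inv_dist_int d i y' \<noteq> \<infinity>" using inv_dist_int_le[OF d y'(2)] by (auto simp: top_unique)
        then have "AE x in others d i. indicator (ucube d i) x * inverse (ennreal (dist_others d i x y')) \<noteq> \<infinity>"
          unfolding inv_dist_int_def by (intro nn_integral_PInf_AE) auto
        then show "AE x in others d i. ennreal (indicator (ucube d i) x / dist_others d i x y')
            = indicator (ucube d i) x * inverse (ennreal (dist_others d i x y'))"
        proof eventually_elim
          case (elim x)
          show ?case
          proof (cases "x \<in> ucube d i")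
            case True
            with elim have "dist_others d i x y' \<noteq> 0" by auto
            then have "0 < dist_others d i x y'" using dist_others_nonneg[of d i x y'] by simp
            then show ?thesis using True by (simp add: inverse_ennreal inverse_eq_divide)
          qed simp
        qed
      qed
      finally show ?thesis .
    qed
    define \<phi> where "\<phi> y = indicator W y * (\<integral>x. indicator W x / dist1 d x y \<partial>hyp_meas d (i, s))" for y
    have \<phi>: "\<phi> (hyp_emb (i, s) y') = indicator (ucube d i) y' * enn2real (inv_dist_int d i y')"
      if "y' \<in> space (others d i)" for y'
      using inner[OF refl that] ind[OF that] by (cases "y' \<in> ucube d i") (auto simp: \<phi>_def)
    \<comment> \<open>Transporting the outer integral along \<open>hyp_emb\<close> asks for
      measurability on the whole space, not only on the hyperplane where \<open>inner\<close> gives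
      a formula.\<close>
    have \<phi>m: "\<phi> \<in> borel_measurable P"
    proof -
      have [measurable]: "hyp_emb (i, s) \<in> others d i \<rightarrow>\<^sub>M P" unfolding P_def by (rule measurable_hyp_emb[OF i])
      have eq: "(\<integral>x. indicator W x / dist1 d x y \<partial>hyp_meas d (i, s))
          = (\<integral>x. indicator W (hyp_emb (i, s) x) / dist1 d (hyp_emb (i, s) x) y \<partial>others d i)" for y
        by (subst integral_hyp_meas[OF i]) (auto simp: P_def[symmetric])
      have [measurable]: "(\<lambda>z. dist1 d (hyp_emb (i, s) (snd z)) (fst z)) \<in> borel_measurable (P \<Otimes>\<^sub>M others d i)"
      proof -
        have c: "(\<lambda>x. x j) \<in> borel_measurable P" if "j < d" for j
          using that unfolding P_def
          by (intro measurable_component_singleton[where M = "\<lambda>_. lborel", simplified]) simp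
        have "(\<lambda>z. hyp_emb (i, s) (snd z) j) \<in> borel_measurable (P \<Otimes>\<^sub>M others d i)" if "j < d" for j
          using c[OF that] by measurable
        moreover have "(\<lambda>z. (fst z) j) \<in> borel_measurable (P \<Otimes>\<^sub>M others d i)" if "j < d" for j
          using c[OF that] by measurable
        ultimately show ?thesis
          unfolding dist1_def by (intro borel_measurable_sum borel_measurable_abs borel_measurable_diff) auto
      qed
      show ?thesis unfolding \<phi>_def eq
        by (intro borel_measurable_times o.borel_measurable_lebesgue_integral) (auto simp: split_beta')
    qed
    have "G i s = (\<integral>y. \<phi> (hyp_emb (i, s) y) \<partial>others d i)"
      unfolding G_def \<phi>_def[symmetric] by (rule integral_hyp_meas[OF i \<phi>m[unfolded P_def]])
    also have "\<dots> = (\<integral>y. indicator (ucube d i) y * enn2real (inv_dist_int d i y) \<partial>others d i)"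
      by (intro Bochner_Integration.integral_cong) (auto simp: \<phi>)
    also have "\<dots> = enn2real (\<integral>\<^sup>+y. ennreal (indicator (ucube d i) y * enn2real (inv_dist_int d i y)) \<partial>others d i)"
      by (intro integral_eq_nn_integral) auto
    also have "(\<integral>\<^sup>+y. ennreal (indicator (ucube d i) y * enn2real (inv_dist_int d i y)) \<partial>others d i) = facet_energy d i"
      unfolding facet_energy_def
    proof (intro nn_integral_cong)
      fix y
      show "ennreal (indicator (ucube d i) y * enn2real (inv_dist_int d i y)) = indicator (ucube d i) y * inv_dist_int d i y"
      proof (cases "y \<in> ucube d i")
        case True
        then have "inv_dist_int d i y < top" using inv_dist_int_le[OF d True] by (simp add: le_less_trans)
        then show ?thesis using True by simp
      qed simp
    qed
    finally show ?thesis .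
  qed
  have [measurable]: "facet_energy d \<in> borel_measurable (count_space {..<d})" by simp
  have "var_formula d W = (\<integral>H. indicator (hits d W) H * G (fst H) (snd H) \<partial>Lambda d)"
    unfolding var_formula_def measure_hits_seg G_def by simp
  also have "\<dots> = (\<integral>H. indicator {0..1} (snd H) * enn2real (facet_energy d (fst H)) \<partial>Lambda d)"
    by (intro Bochner_Integration.integral_cong)
      (auto simp: W_def hits_unit indicator_def G Lambda_def space_pair_measure)
  also have "\<dots> = enn2real (\<integral>\<^sup>+H. ennreal (indicator {0..1} (snd H) * enn2real (facet_energy d (fst H))) \<partial>Lambda d)"
    unfolding Lambda_def by (intro integral_eq_nn_integral) auto
  also have "(\<integral>\<^sup>+H. ennreal (indicator {0..1} (snd H) * enn2real (facet_energy d (fst H))) \<partial>Lambda d)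
      = (\<integral>\<^sup>+i. \<integral>\<^sup>+s. indicator {0..1} (s::real) * facet_energy d i \<partial>lborel \<partial>count_space {..<d})"
  proof -
    have e: "ennreal (indicator {0..1} s * enn2real (facet_energy d i)) = indicator {0..1} s * facet_energy d i"
      if "i < d" for i and s :: real
      using facet_energy_le[OF d that] by (auto simp: indicator_def le_less_trans)
    show ?thesis unfolding Lambda_def
      by (subst lborel.nn_integral_fst[symmetric]) (auto intro!: nn_integral_cong simp: e)
  qed
  also have "\<dots> = (\<Sum>i<d. facet_energy d i)"
    by (subst nn_integral_count_space_finite) (auto simp: nn_integral_multc)
  finally show ?thesis by (simp add: W_def)
qed

subsection \<open>Recursions over the tree of cells\<close>

abbreviation moment1 :: "((bool list \<Rightarrow> real \<times> real) \<Rightarrow> real) \<Rightarrow> ennreal" where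
  "moment1 X \<equiv> \<integral>\<^sup>+\<omega>. ennreal \<bar>X \<omega>\<bar> \<partial>Omega"

abbreviation moment2 :: "((bool list \<Rightarrow> real \<times> real) \<Rightarrow> real) \<Rightarrow> ennreal" where
  "moment2 X \<equiv> \<integral>\<^sup>+\<omega>. ennreal ((X \<omega>)\<^sup>2) \<partial>Omega"

definition life :: "nat \<Rightarrow> (nat \<Rightarrow> real) \<Rightarrow> (nat \<Rightarrow> real) \<Rightarrow> real \<times> real \<Rightarrow> real" where
  "life d a b x = fst x / lam d a b"

text \<open>The new upper corner, which belongs to the child \<open>False\<close> below the split;
  \<open>lower\<close> is the new lower corner of the child \<open>True\<close> above it. Each child
  keeps the other corner of its parent.\<close>

definition upper :: "nat \<Rightarrow> (nat \<Rightarrow> real) \<Rightarrow> (nat \<Rightarrow> real) \<Rightarrow> real \<times> real \<Rightarrow> nat \<Rightarrow> real" where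
  "upper d a b x = b(fst (split_hyp d a b (snd x)) := snd (split_hyp d a b (snd x)))"

definition lower :: "nat \<Rightarrow> (nat \<Rightarrow> real) \<Rightarrow> (nat \<Rightarrow> real) \<Rightarrow> real \<times> real \<Rightarrow> nat \<Rightarrow> real" where
  "lower d a b x = a(fst (split_hyp d a b (snd x)) := snd (split_hyp d a b (snd x)))"

definition area :: "nat \<Rightarrow> (nat \<Rightarrow> real) \<Rightarrow> (nat \<Rightarrow> real) \<Rightarrow> real \<times> real \<Rightarrow> real" where
  "area d a b x = facet d a b (fst (split_hyp d a b (snd x)))"

text \<open>The flag \<open>z\<close> stands for an infinite time horizon: if it is set, every cell is split
  and \<open>t\<close> plays no role.\<close>

fun stree :: "nat \<Rightarrow> bool \<Rightarrow>
    ((nat \<Rightarrow> real) \<Rightarrow> (nat \<Rightarrow> real) \<Rightarrow> real \<Rightarrow> (bool list \<Rightarrow> real \<times> real) \<Rightarrow> real) \<Rightarrow>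
    ((nat \<Rightarrow> real) \<Rightarrow> (nat \<Rightarrow> real) \<Rightarrow> real \<Rightarrow> real \<times> real \<Rightarrow> real) \<Rightarrow>
    nat \<Rightarrow> (nat \<Rightarrow> real) \<Rightarrow> (nat \<Rightarrow> real) \<Rightarrow> real \<Rightarrow> (bool list \<Rightarrow> real \<times> real) \<Rightarrow> real" where
  "stree d z f g 0 a b t \<omega> = f a b t \<omega>"
| "stree d z f g (Suc n) a b t \<omega> = g a b t (\<omega> []) +
     (if z \<or> life d a b (\<omega> []) \<le> t
      then stree d z f g n a (upper d a b (\<omega> [])) (t - life d a b (\<omega> [])) (\<lambda>v. \<omega> (False # v))
         + stree d z f g n (lower d a b (\<omega> [])) b (t - life d a b (\<omega> [])) (\<lambda>v. \<omega> (True # v))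
      else 0)"

lemma stree_graft:
  "stree d z f g (Suc n) a b t (graft x l r) = g a b t x +
     (if z \<or> life d a b x \<le> t
      then stree d z f g n a (upper d a b x) (t - life d a b x) l
         + stree d z f g n (lower d a b x) b (t - life d a b x) r
      else 0)"
  by simp

lemma measurable_lam [measurable (raw)]:
  assumes [measurable]: "f \<in> N \<rightarrow>\<^sub>M corner" "g \<in> N \<rightarrow>\<^sub>M corner"
  shows "(\<lambda>x. lam d (f x) (g x)) \<in> borel_measurable N"
  unfolding lam_def by measurable

lemma measurable_vol [measurable (raw)]:
  assumes [measurable]: "f \<in> N \<rightarrow>\<^sub>M corner" "g \<in> N \<rightarrow>\<^sub>M corner"
  shows "(\<lambda>x. vol d (f x) (g x)) \<in> borel_measurable N"
  unfolding vol_def by measurable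

lemma measurable_facet [measurable (raw)]:
  assumes [measurable]: "f \<in> N \<rightarrow>\<^sub>M corner" "g \<in> N \<rightarrow>\<^sub>M corner" "k \<in> N \<rightarrow>\<^sub>M count_space UNIV"
  shows "(\<lambda>x. facet d (f x) (g x) (k x)) \<in> borel_measurable N"
proof -
  have "facet d a b i = (\<Prod>j<d. if j = i then 1 else b j - a j)" for a b i
    unfolding facet_def by (rule prod.mono_neutral_cong_left) auto
  then show ?thesis by simp
qed

lemma measurable_split_data [measurable (raw)]:
  assumes [measurable]: "f \<in> N \<rightarrow>\<^sub>M corner" "g \<in> N \<rightarrow>\<^sub>M corner" "k \<in> N \<rightarrow>\<^sub>M borel \<Otimes>\<^sub>M borel"
  shows "(\<lambda>x. life d (f x) (g x) (k x)) \<in> borel_measurable N"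
    and "(\<lambda>x. upper d (f x) (g x) (k x)) \<in> N \<rightarrow>\<^sub>M corner"
    and "(\<lambda>x. lower d (f x) (g x) (k x)) \<in> N \<rightarrow>\<^sub>M corner"
    and "(\<lambda>x. area d (f x) (g x) (k x)) \<in> borel_measurable N"
  unfolding life_def upper_def lower_def area_def by measurable

lemma measurable_Omega_component:
  assumes [measurable]: "f \<in> N \<rightarrow>\<^sub>M Omega"
  shows "(\<lambda>x. f x v) \<in> N \<rightarrow>\<^sub>M borel \<Otimes>\<^sub>M borel"
proof -
  have "(\<lambda>w. w v) \<in> Omega \<rightarrow>\<^sub>M borel \<Otimes>\<^sub>M borel"
    by (simp cong: measurable_cong_sets[OF sets_Omega refl])
  then show ?thesis by measurable
qed

lemma measurable_Omega_shift:
  assumes "f \<in> N \<rightarrow>\<^sub>M Omega"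
  shows "(\<lambda>x v. f x (c # v)) \<in> N \<rightarrow>\<^sub>M Omega"
proof -
  note [measurable] = measurable_Omega_component[OF assms]
  have "(\<lambda>x v. f x (c # v)) \<in> N \<rightarrow>\<^sub>M PiM UNIV (\<lambda>_. borel \<Otimes>\<^sub>M borel)"
    by (rule measurable_abs_UNIV) measurable
  then show ?thesis by (simp cong: measurable_cong_sets[OF refl sets_Omega])
qed

text \<open>Below the root the corners and the remaining time depend on the marks, so the induction
  needs joint measurability in all arguments; hence \<open>f\<close> and \<open>g\<close> are
  required to be measurable under arbitrary measurable substitutions.\<close>

lemma measurable_stree:
  assumes f: "\<And>fa fb ft fw. fa \<in> N \<rightarrow>\<^sub>M corner \<Longrightarrow> fb \<in> N \<rightarrow>\<^sub>M corner \<Longrightarrow> ft \<in> borel_measurable N \<Longrightarrow>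
      fw \<in> N \<rightarrow>\<^sub>M Omega \<Longrightarrow> (\<lambda>x. f (fa x) (fb x) (ft x) (fw x)) \<in> borel_measurable N"
    and g: "\<And>fa fb ft fx. fa \<in> N \<rightarrow>\<^sub>M corner \<Longrightarrow> fb \<in> N \<rightarrow>\<^sub>M corner \<Longrightarrow> ft \<in> borel_measurable N \<Longrightarrow>
      fx \<in> N \<rightarrow>\<^sub>M borel \<Otimes>\<^sub>M borel \<Longrightarrow> (\<lambda>x. g (fa x) (fb x) (ft x) (fx x)) \<in> borel_measurable N"
    and "fa \<in> N \<rightarrow>\<^sub>M corner" "fb \<in> N \<rightarrow>\<^sub>M corner" "ft \<in> borel_measurable N" "fw \<in> N \<rightarrow>\<^sub>M Omega"
  shows "(\<lambda>x. stree d z f g n (fa x) (fb x) (ft x) (fw x)) \<in> borel_measurable N"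
  using assms(3-)
proof (induction n arbitrary: fa fb ft fw)
  case 0 then show ?case by (simp add: f)
next
  case (Suc n)
  note [measurable] = Suc.prems measurable_Omega_component[OF Suc.prems(4)]
    measurable_Omega_shift[OF Suc.prems(4)]
  have [measurable]: "(\<lambda>x. g (fa x) (fb x) (ft x) (fw x [])) \<in> borel_measurable N"
    by (rule g) measurable
  have [measurable]: "(\<lambda>x. stree d z f g n (fa x) (upper d (fa x) (fb x) (fw x []))
      (ft x - life d (fa x) (fb x) (fw x [])) (\<lambda>v. fw x (False # v))) \<in> borel_measurable N"
    by (rule Suc.IH) measurable
  have [measurable]: "(\<lambda>x. stree d z f g n (lower d (fa x) (fb x) (fw x [])) (fb x)
      (ft x - life d (fa x) (fb x) (fw x [])) (\<lambda>v. fw x (True # v))) \<in> borel_measurable N"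
    by (rule Suc.IH) measurable
  show ?case unfolding stree.simps by measurable
qed

lemma AE_split_hyp:
  assumes c: "cell d R a b" and d: "0 < d"
  shows "AE u in unif. fst (split_hyp d a b u) < d \<and> a (fst (split_hyp d a b u)) < snd (split_hyp d a b u)
    \<and> snd (split_hyp d a b u) < b (fst (split_hyp d a b u))"
proof -
  \<comment> \<open>The indicator of the splits to be excluded; on each side interval these are the
    two end points only, so its mean under the law of the split is 0.\<close>
  define F where "F H = (if fst H < d \<and> a (fst H) < snd H \<and> snd H < b (fst H) then 0 else 1 :: ennreal)"
    for H :: "nat \<times> real"
  have F [measurable]: "F \<in> borel_measurable (count_space UNIV \<Otimes>\<^sub>M borel)" unfolding F_def by measurable
  have [measurable]: "(\<lambda>u. split_hyp d a b u) \<in> borel \<rightarrow>\<^sub>M count_space UNIV \<Otimes>\<^sub>M borel"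
    by (intro measurable_split_hyp measurable_const) auto
  have "(\<integral>\<^sup>+r\<in>{a k..b k}. F (k, r) \<partial>lborel) = 0" if "k < d" for k
  proof -
    have "(\<integral>\<^sup>+r\<in>{a k..b k}. F (k, r) \<partial>lborel) = (\<integral>\<^sup>+r. 0 \<partial>(lborel :: real measure))"
    proof (rule nn_integral_cong_AE)
      show "AE r in lborel. F (k, r) * indicator {a k..b k} r = 0"
        using AE_lborel_singleton[of "a k"] AE_lborel_singleton[of "b k"]
        by eventually_elim (use that in \<open>auto simp: F_def\<close>)
    qed
    then show ?thesis by simp
  qed
  then have "(\<integral>\<^sup>+u. F (split_hyp d a b u) \<partial>unif) = 0"
    by (simp add: nn_integral_split_hyp[OF c d])
  then have "AE u in unif. F (split_hyp d a b u) = 0"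
    by (subst (asm) nn_integral_0_iff_AE) auto
  then show ?thesis by eventually_elim (auto simp: F_def split: if_splits)
qed

lemma cell_children:
  assumes "cell d R a b" "fst H < d" "a (fst H) < snd H" "snd H < b (fst H)"
  shows "cell d R a (b(fst H := snd H))" "cell d R (a(fst H := snd H)) b"
  using assms unfolding cell_def by (auto intro: less_imp_le less_le_trans le_less_trans)

lemma AE_cell_children:
  assumes c: "cell d R a b" and d: "0 < d"
  shows "AE x in mark_law. 0 \<le> life d a b x \<and> fst (split_hyp d a b (snd x)) < d
    \<and> cell d R a (upper d a b x) \<and> cell d R (lower d a b x) b"
proof -
  have [measurable]: "(\<lambda>u. split_hyp d a b u) \<in> borel \<rightarrow>\<^sub>M count_space UNIV \<Otimes>\<^sub>M borel"
    by (intro measurable_split_hyp measurable_const) auto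
  have "AE x in mark_law. fst (split_hyp d a b (snd x)) < d \<and> a (fst (split_hyp d a b (snd x))) < snd (split_hyp d a b (snd x))
    \<and> snd (split_hyp d a b (snd x)) < b (fst (split_hyp d a b (snd x)))"
    by (rule AE_mark_law_snd[OF AE_split_hyp[OF c d]]) measurable
  moreover have "AE x in mark_law. 0 \<le> fst x"
    by (rule AE_mark_law_fst[OF AE_expo_nonneg]) measurable
  ultimately show ?thesis
    by eventually_elim (use lam_pos[OF c d] in \<open>auto simp: life_def upper_def lower_def cell_children[OF c]\<close>)
qed

lemma (in prob_space) integrable_of_square:
  fixes f :: "'a \<Rightarrow> real"
  assumes [measurable]: "f \<in> borel_measurable M" and "(\<integral>\<^sup>+x. ennreal ((f x)\<^sup>2) \<partial>M) < \<infinity>"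
  shows "integrable M (\<lambda>x. (f x)\<^sup>2)" "integrable M f"
proof -
  show "integrable M (\<lambda>x. (f x)\<^sup>2)" using assms(2) by (intro integrableI_bounded) auto
  then show "integrable M f" by (rule square_integrable_imp_integrable[rotated]) simp
qed

lemma (in prob_space) nn_integral_square_shift:
  fixes f :: "'a \<Rightarrow> real"
  assumes [measurable]: "f \<in> borel_measurable M" and fin: "(\<integral>\<^sup>+x. ennreal ((f x)\<^sup>2) \<partial>M) < \<infinity>"
    and mean: "(\<integral>x. f x \<partial>M) = 0"
  shows "(\<integral>\<^sup>+x. ennreal ((k + f x)\<^sup>2) \<partial>M) = ennreal (k\<^sup>2) + (\<integral>\<^sup>+x. ennreal ((f x)\<^sup>2) \<partial>M)"
proof -
  note i = integrable_of_square[OF assms(1,2)]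
  have e: "(k + f x)\<^sup>2 = k\<^sup>2 + 2 * k * f x + (f x)\<^sup>2" for x by (simp add: power2_sum)
  have i': "integrable M (\<lambda>x. (k + f x)\<^sup>2)" unfolding e using i by (intro Bochner_Integration.integrable_add) auto
  have "(\<integral>x. (k + f x)\<^sup>2 \<partial>M) = k\<^sup>2 + (\<integral>x. (f x)\<^sup>2 \<partial>M)"
    unfolding e using i mean by (simp add: prob_space)
  then show ?thesis
    using i i' by (simp add: nn_integral_eq_integral)
qed

text \<open>Given the root mark, the two subtrees are independent and, by \<open>IH\<close>, centred
  and square integrable. Hence the cross terms vanish, second moments add up, and only the node term
  \<open>g\<close> contributes to the mean. Finiteness and centring are carried together because
  each step uses both.\<close>

lemma stree_step:
  assumes c: "cell d R a b" and d: "0 < d" and t: "z \<or> 0 \<le> t"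
    and fm: "\<And>a b t. f a b t \<in> borel_measurable Omega"
    and meas: "\<And>n a b t. stree d z f g n a b t \<in> borel_measurable Omega"
    and IH: "\<And>a b t. cell d R a b \<Longrightarrow> z \<or> 0 \<le> t \<Longrightarrow>
      moment2 (stree d z f g n a b t) < \<infinity> \<and> (\<integral>\<omega>. stree d z f g n a b t \<omega> \<partial>Omega) = 0"
  shows "moment2 (stree d z f g (Suc n) a b t)
     = (\<integral>\<^sup>+x. ennreal ((g a b t x)\<^sup>2) + (if z \<or> life d a b x \<le> t
         then moment2 (stree d z f g n a (upper d a b x) (t - life d a b x))
            + moment2 (stree d z f g n (lower d a b x) b (t - life d a b x))
         else 0) \<partial>mark_law)" (is ?A)
    and "moment2 (stree d z f g (Suc n) a b t) < \<infinity> \<Longrightarrow>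
      g a b t \<in> borel_measurable mark_law \<Longrightarrow>
      (\<integral>\<omega>. stree d z f g (Suc n) a b t \<omega> \<partial>Omega) = (\<integral>x. g a b t x \<partial>mark_law)"
proof -
  interpret O: prob_space Omega by (rule prob_space_Omega)
  note [measurable] = meas
  have AE: "AE x in mark_law. z \<or> life d a b x \<le> t \<longrightarrow>
      (moment2 (stree d z f g n a (upper d a b x) (t - life d a b x)) < \<infinity> \<and>
       (\<integral>\<omega>. stree d z f g n a (upper d a b x) (t - life d a b x) \<omega> \<partial>Omega) = 0) \<and>
      (moment2 (stree d z f g n (lower d a b x) b (t - life d a b x)) < \<infinity> \<and>
       (\<integral>\<omega>. stree d z f g n (lower d a b x) b (t - life d a b x) \<omega> \<partial>Omega) = 0)"
    using AE_cell_children[OF c d] by eventually_elim (use IH in auto)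
  show ?A
    apply (subst nn_integral_Omega, measurable)
    apply (rule nn_integral_cong_AE)
    using AE
  proof eventually_elim
    case (elim x)
    show ?case
    proof (cases "z \<or> life d a b x \<le> t")
      case True
      define L where "L = stree d z f g n a (upper d a b x) (t - life d a b x)"
      define Rr where "Rr = stree d z f g n (lower d a b x) b (t - life d a b x)"
      have [measurable]: "L \<in> borel_measurable Omega" "Rr \<in> borel_measurable Omega"
        by (simp_all add: L_def Rr_def)
      have LR: "moment2 L < \<infinity>" "(\<integral>\<omega>. L \<omega> \<partial>Omega) = 0"
        "moment2 Rr < \<infinity>" "(\<integral>\<omega>. Rr \<omega> \<partial>Omega) = 0"
        using elim True by (simp_all add: L_def Rr_def)
      have "(\<integral>\<^sup>+l. \<integral>\<^sup>+r. ennreal ((stree d z f g (Suc n) a b t (graft x l r))\<^sup>2) \<partial>Omega \<partial>Omega)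
        = (\<integral>\<^sup>+l. \<integral>\<^sup>+r. ennreal (((g a b t x + L l) + Rr r)\<^sup>2) \<partial>Omega \<partial>Omega)"
        using True unfolding stree_graft by (simp add: L_def Rr_def add.assoc)
      \<comment> \<open>\<open>nn_integral_square_shift\<close> removes the centred right subtree
        with all the rest as its constant; the left subtree is removed below in the same
        way.\<close>
      also have "\<dots> = (\<integral>\<^sup>+l. ennreal ((g a b t x + L l)\<^sup>2) + (\<integral>\<^sup>+r. ennreal ((Rr r)\<^sup>2) \<partial>Omega) \<partial>Omega)"
        using LR by (intro nn_integral_cong O.nn_integral_square_shift) auto
      also have "\<dots> = (\<integral>\<^sup>+l. ennreal ((g a b t x + L l)\<^sup>2) \<partial>Omega) + (\<integral>\<^sup>+r. ennreal ((Rr r)\<^sup>2) \<partial>Omega)"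
        by (subst nn_integral_add) (auto simp: O.emeasure_space_1[simplified])
      also have "(\<integral>\<^sup>+l. ennreal ((g a b t x + L l)\<^sup>2) \<partial>Omega) = ennreal ((g a b t x)\<^sup>2) + (\<integral>\<^sup>+l. ennreal ((L l)\<^sup>2) \<partial>Omega)"
        using LR by (intro O.nn_integral_square_shift) auto
      finally show ?thesis using True by (simp add: L_def Rr_def add.assoc)
    next
      case False
      then show ?thesis unfolding stree_graft by (simp add: O.emeasure_space_1[simplified])
    qed
  qed
  assume fin: "moment2 (stree d z f g (Suc n) a b t) < \<infinity>"
    and gm: "g a b t \<in> borel_measurable mark_law"
  have int: "integrable Omega (stree d z f g (Suc n) a b t)"
    by (rule O.integrable_of_square(2)[OF _ fin]) measurable
  show "(\<integral>\<omega>. stree d z f g (Suc n) a b t \<omega> \<partial>Omega) = (\<integral>x. g a b t x \<partial>mark_law)"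
    unfolding integral_Omega[OF int]
  proof (rule integral_cong_AE)
    show "(\<lambda>x. \<integral>l. \<integral>r. stree d z f g (Suc n) a b t (graft x l r) \<partial>Omega \<partial>Omega) \<in> borel_measurable mark_law"
    proof -
      define F where "F = stree d z f g (Suc n) a b t"
      have [measurable]: "F \<in> borel_measurable Omega" unfolding F_def by (rule meas)
      show ?thesis unfolding F_def[symmetric] by measurable
    qed
    show "AE x in mark_law. (\<integral>l. \<integral>r. stree d z f g (Suc n) a b t (graft x l r) \<partial>Omega \<partial>Omega) = g a b t x"
      using AE
    proof eventually_elim
      case (elim x)
      show ?case
      proof (cases "z \<or> life d a b x \<le> t")
        case True
        define L where "L = stree d z f g n a (upper d a b x) (t - life d a b x)"
        define Rr where "Rr = stree d z f g n (lower d a b x) b (t - life d a b x)"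
        have [measurable]: "L \<in> borel_measurable Omega" "Rr \<in> borel_measurable Omega"
          by (simp_all add: L_def Rr_def)
        have LR: "(\<integral>\<omega>. L \<omega> \<partial>Omega) = 0" "(\<integral>\<omega>. Rr \<omega> \<partial>Omega) = 0"
          "moment2 L < \<infinity>" "moment2 Rr < \<infinity>"
          using elim True by (simp_all add: L_def Rr_def)
        have "integrable Omega L" "integrable Omega Rr"
          using LR by (auto intro: O.integrable_of_square(2))
        have "(\<integral>l. \<integral>r. stree d z f g (Suc n) a b t (graft x l r) \<partial>Omega \<partial>Omega)
          = (\<integral>l. \<integral>r. (g a b t x + L l) + Rr r \<partial>Omega \<partial>Omega)"
          using True unfolding stree_graft by (simp add: L_def Rr_def add.assoc)
        also have "\<dots> = g a b t x" using LR \<open>integrable Omega L\<close> \<open>integrable Omega Rr\<close> by (simp add: O.prob_space[simplified])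
        finally show ?thesis .
      next
        case False
        then show ?thesis unfolding stree_graft by (simp add: O.prob_space[simplified])
      qed
    qed
  qed (rule gm)
qed

subsection \<open>Moments of the compensated surface\<close>

text \<open>\<open>P\<close> is an antiderivative of the density times \<open>F\<close>. Beyond
  \<open>s\<close> the integrand is frozen at \<open>c\<close> and contributes c exp(-s); with
  \<open>z\<close> set nothing is frozen, and only the values of \<open>P\<close> at 0 and at
  infinity enter.\<close>

lemma nn_integral_expo_stopped:
  fixes F P :: "real \<Rightarrow> real"
  assumes s: "z \<or> 0 \<le> s" and [measurable]: "F \<in> borel_measurable borel"
    and F: "\<And>x. 0 \<le> x \<Longrightarrow> 0 \<le> F x" and c: "0 \<le> c"
    and P: "\<And>x. (P has_real_derivative exp (- x) * F x) (at x)" and T: "(P \<longlongrightarrow> 0) at_top"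
  shows "(\<integral>\<^sup>+e. ennreal (if z \<or> e \<le> s then F e else c) \<partial>expo)
    = ennreal (if z then - P 0 else P s - P 0 + c * exp (- s))"
proof (cases z)
  case True
  have "(\<integral>\<^sup>+e. ennreal (F e) \<partial>expo) = (\<integral>\<^sup>+e\<in>{0..}. ennreal (exp (- e) * F e) \<partial>lborel)"
    by (subst nn_integral_expo) (auto intro!: nn_integral_cong simp: ennreal_mult' indicator_def)
  also have "\<dots> = ennreal (0 - P 0)"
    by (rule nn_integral_FTC_atLeast) (auto intro!: P F T mult_nonneg_nonneg)
  finally show ?thesis using True by simp
next
  case False
  with s have s: "0 \<le> s" by simp
  have "(\<integral>\<^sup>+e. ennreal (if z \<or> e \<le> s then F e else c) \<partial>expo)
      = (\<integral>\<^sup>+e\<in>{0..}. ennreal (exp (- e) * (if e \<le> s then F e else c)) \<partial>lborel)"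
    using False by (subst nn_integral_expo) (auto intro!: nn_integral_cong simp: ennreal_mult' indicator_def)
  also have "\<dots> = (\<integral>\<^sup>+e. ennreal (exp (- e) * F e) * indicator {0..s} e + ennreal (c * exp (- e)) * indicator {s..} e \<partial>lborel)"
    by (rule nn_integral_cong_AE, rule AE_mp[OF AE_lborel_singleton[of s]])
      (use s in \<open>auto simp: indicator_def mult.commute\<close>)
  also have "\<dots> = (\<integral>\<^sup>+e\<in>{0..s}. ennreal (exp (- e) * F e) \<partial>lborel) + (\<integral>\<^sup>+e\<in>{s..}. ennreal (c * exp (- e)) \<partial>lborel)"
    by (rule nn_integral_add) auto
  also have "(\<integral>\<^sup>+e\<in>{0..s}. ennreal (exp (- e) * F e) \<partial>lborel) = ennreal (P s - P 0)"
    by (rule nn_integral_FTC_Icc) (auto intro!: P F s mult_nonneg_nonneg)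
  also have "(\<integral>\<^sup>+e\<in>{s..}. ennreal (c * exp (- e)) \<partial>lborel) = ennreal (0 - (- c * exp (- s)))"
  proof (rule nn_integral_FTC_atLeast)
    have "((\<lambda>x. - c * exp (- x)) \<longlongrightarrow> - c * 0) at_top"
      by (intro tendsto_mult tendsto_const filterlim_compose[OF exp_at_bot] filterlim_uminus_at_bot_at_top)
    then show "((\<lambda>x. - c * exp (- x)) \<longlongrightarrow> 0) at_top" by simp
  qed (auto intro!: derivative_eq_intros simp: c)
  also have "ennreal (P s - P 0) + ennreal (0 - (- c * exp (- s))) = ennreal (P s - P 0 + c * exp (- s))"
  proof (subst ennreal_plus)
    have "P 0 \<le> P s" by (rule DERIV_nonneg_imp_nondecreasing[OF s]) (use P F in fastforce)
    then show "0 \<le> P s - P 0" by simp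
  qed (use c in auto)
  finally show ?thesis using False by simp
qed

text \<open>All antiderivatives that are fed into \<open>nn_integral_expo_stopped\<close> have this
  form.\<close>

lemma exp_poly_tendsto_0: "((\<lambda>x::real. - (A * x\<^sup>2 + B * x + C) * exp (- x)) \<longlongrightarrow> 0) at_top"
proof -
  have 1: "((\<lambda>x::real. x ^ k * exp (- x)) \<longlongrightarrow> 0) at_top" for k
    using tendsto_power_div_exp_0[of k] by (simp only: exp_minus divide_inverse)
  have "((\<lambda>x::real. (- A) * (x ^ 2 * exp (- x)) + (- B) * (x ^ 1 * exp (- x)) + (- C) * (x ^ 0 * exp (- x)))
      \<longlongrightarrow> (- A) * 0 + (- B) * 0 + (- C) * 0) at_top"
    by (intro tendsto_add tendsto_mult tendsto_const 1)
  moreover have "(- A) * (x ^ 2 * exp (- x)) + (- B) * (x ^ 1 * exp (- x)) + (- C) * (x ^ 0 * exp (- x))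
      = - (A * x\<^sup>2 + B * x + C) * exp (- x)" for x
    unfolding power_one_right power_0 by algebra
  ultimately show ?thesis by (simp only: mult_zero_right add_0_right)
qed

text \<open>A cell of volume \<open>v\<close> creates facet area at rate \<open>d * v\<close>: each of the \<open>d\<close> directions contributes
  side length times facet area.\<close>

definition compens :: "nat \<Rightarrow> bool \<Rightarrow> (nat \<Rightarrow> real) \<Rightarrow> (nat \<Rightarrow> real) \<Rightarrow> real \<Rightarrow> real \<times> real \<Rightarrow> real" where
  "compens d z a b t x = (if z \<or> life d a b x \<le> t then area d a b x - real d * vol d a b * life d a b x
     else - real d * vol d a b * t)"

lemma measurable_compens [measurable (raw)]:
  assumes [measurable]: "f \<in> N \<rightarrow>\<^sub>M corner" "g \<in> N \<rightarrow>\<^sub>M corner" "h \<in> borel_measurable N" "k \<in> N \<rightarrow>\<^sub>M borel \<Otimes>\<^sub>M borel"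
  shows "(\<lambda>x. compens d z (f x) (g x) (h x) (k x)) \<in> borel_measurable N"
  unfolding compens_def by measurable

lemma measurable_area_snd [measurable]: "(\<lambda>u. area d a b (e, u)) \<in> borel_measurable borel"
  by measurable

lemma vol_nonneg: "cell d R a b \<Longrightarrow> 0 \<le> vol d a b"
  unfolding vol_def by (intro prod_nonneg) (auto simp: cell_def less_imp_le)

lemma nn_integral_area_sq:
  assumes c: "cell d R a b" and d: "0 < d"
  shows "(\<integral>\<^sup>+u. ennreal ((area d a b (e, u))\<^sup>2) \<partial>unif) = pair_int d (\<lambda>_. ennreal (1 / lam d a b)) a b"
    and "(\<integral>\<^sup>+u. ennreal ((area d a b (e, u))\<^sup>2) \<partial>unif) < \<infinity>"
    and "(\<integral>u. area d a b (e, u) \<partial>unif) = real d * vol d a b / lam d a b"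
    and "integrable unif (\<lambda>u. area d a b (e, u))"
    and "(\<integral>\<^sup>+u. ennreal (area d a b (e, u)) \<partial>unif) = ennreal (real d * vol d a b / lam d a b)"
proof -
  interpret u: prob_space unif by (rule prob_space_unif)
  show 1: "(\<integral>\<^sup>+u. ennreal ((area d a b (e, u))\<^sup>2) \<partial>unif) = pair_int d (\<lambda>_. ennreal (1 / lam d a b)) a b"
    unfolding area_def using nn_integral_facet_sq[OF c d] by simp
  also have "\<dots> < \<infinity>"
    using lam_pos[OF c d] by (subst pair_int_const[OF c]) auto
  finally show "(\<integral>\<^sup>+u. ennreal ((area d a b (e, u))\<^sup>2) \<partial>unif) < \<infinity>" .
  then show "integrable unif (\<lambda>u. area d a b (e, u))" by (intro u.integrable_of_square) auto
  show 2: "(\<integral>\<^sup>+u. ennreal (area d a b (e, u)) \<partial>unif) = ennreal (real d * vol d a b / lam d a b)"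
    unfolding area_def using nn_integral_facet[OF c d] by simp
  have "0 \<le> real d * vol d a b / lam d a b"
    using lam_pos[OF c d] vol_nonneg[OF c] by simp
  then show "(\<integral>u. area d a b (e, u) \<partial>unif) = real d * vol d a b / lam d a b"
    using 2 by (subst integral_eq_nn_integral) (auto simp: area_def facet_nonneg[OF c])
qed

lemma nn_integral_mark_law_snd:
  assumes [measurable]: "f \<in> borel_measurable borel"
  shows "(\<integral>\<^sup>+x. f (snd x) \<partial>mark_law) = (\<integral>\<^sup>+u. f u \<partial>unif)"
proof -
  interpret e: prob_space expo by (rule prob_space_expo)
  show ?thesis by (subst nn_integral_mark_law) (auto simp: e.emeasure_space_1[simplified])
qed

text \<open>Measured on the scale of the cell, its lifetime is a standard exponential e, and the
  node term is A - m e if e <= s and - m s otherwise, where the facet area A is independent of e and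
  has mean m. For a finite horizon the second moment is that of A times the probability 1 - exp(-s)
  of a split before \<open>s\<close>, and the mean vanishes because e truncated at \<open>s\<close>
  has mean 1 - exp(-s), too.\<close>

lemma nn_integral_compens_sq:
  assumes c: "cell d R a b" and d: "0 < d" and t: "z \<or> 0 \<le> t"
  shows "(\<integral>\<^sup>+x. ennreal ((compens d z a b t x)\<^sup>2) \<partial>mark_law) \<le> pair_int d (\<lambda>_. ennreal (1 / lam d a b)) a b"
    and "z \<Longrightarrow> (\<integral>\<^sup>+x. ennreal ((compens d z a b t x)\<^sup>2) \<partial>mark_law) = pair_int d (\<lambda>_. ennreal (1 / lam d a b)) a b"
    and "(\<integral>x. compens d z a b t x \<partial>mark_law) = 0"
proof -
  interpret u: prob_space unif by (rule prob_space_unif)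
  interpret e: prob_space expo by (rule prob_space_expo)
  interpret p: pair_prob_space expo unif ..
  interpret r: prob_space mark_law by (rule prob_space_mark_law)
  define l where "l = lam d a b"
  define m where "m = real d * vol d a b / l"
  define s where "s = l * t"
  have l: "0 < l" using lam_pos[OF c d] by (simp add: l_def)
  have m: "0 \<le> m" using l vol_nonneg[OF c] by (simp add: m_def)
  have s: "z \<or> 0 \<le> s" using t l by (auto simp: s_def)
  have compens: "compens d z a b t (e, u) = (if z \<or> e \<le> s then area d a b (0, u) - m * e else - m * s)" for e u
    using l by (auto simp: compens_def life_def m_def s_def area_def l_def[symmetric] field_simps)
  define A where "A u = area d a b (0, u)" for u
  have [measurable]: "A \<in> borel_measurable borel" unfolding A_def[abs_def] by measurable
  note As = nn_integral_area_sq[OF c d, of 0, folded A_def]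
  define \<beta> where "\<beta> = (\<integral>u. (A u - m)\<^sup>2 \<partial>unif)"
  have Am: "(\<integral>u. A u \<partial>unif) = m" using As(3) by (simp add: m_def l_def)
  have iA: "integrable unif (\<lambda>u. (A u)\<^sup>2)" by (rule u.integrable_of_square(1)) (use As in auto)
  have "integrable unif (\<lambda>u. (A u)\<^sup>2 - 2 * m * A u + m\<^sup>2)" using iA As(4) by auto
  then have iAm: "integrable unif (\<lambda>u. (A u - m)\<^sup>2)"
    by (simp add: power2_diff algebra_simps)
  then have \<beta>: "(\<integral>\<^sup>+u. ennreal ((A u - m)\<^sup>2) \<partial>unif) = ennreal \<beta>"
    unfolding \<beta>_def by (rule nn_integral_eq_integral) simp
  have \<beta>0: "0 \<le> \<beta>" unfolding \<beta>_def by simp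
  have shift: "(\<integral>\<^sup>+u. ennreal ((k + (A u - m))\<^sup>2) \<partial>unif) = ennreal (k\<^sup>2 + \<beta>)" for k
    using As(4) Am by (subst u.nn_integral_square_shift) (auto simp: \<beta> \<beta>0 u.prob_space[simplified])
  have q: "pair_int d (\<lambda>_. ennreal (1 / lam d a b)) a b = ennreal (m\<^sup>2 + \<beta>)"
    using shift[of m] As(1) by simp
  \<comment> \<open>Given that the split happens in time, after the lifetime \<open>e\<close>, the
    term has mean m (1 - e) and the variance \<beta> of the facet area.\<close>
  have inner: "(\<integral>\<^sup>+u. ennreal ((compens d z a b t (e, u))\<^sup>2) \<partial>unif)
      = ennreal (if z \<or> e \<le> s then m\<^sup>2 * (1 - e)\<^sup>2 + \<beta> else m\<^sup>2 * s\<^sup>2)" for e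
  proof (cases "z \<or> e \<le> s")
    case True
    have "(\<integral>\<^sup>+u. ennreal ((compens d z a b t (e, u))\<^sup>2) \<partial>unif)
        = (\<integral>\<^sup>+u. ennreal ((m * (1 - e) + (A u - m))\<^sup>2) \<partial>unif)"
      using True by (simp add: compens A_def[symmetric] algebra_simps)
    then show ?thesis
      using True shift[of "m * (1 - e)"] by (simp add: power_mult_distrib)
  next
    case False
    then show ?thesis unfolding compens by (simp add: power_mult_distrib u.emeasure_space_1[simplified])
  qed
  define P where "P x = - (m\<^sup>2 * x\<^sup>2 + 0 * x + (m\<^sup>2 + \<beta>)) * exp (- x)" for x
  have "(\<integral>\<^sup>+x. ennreal ((compens d z a b t x)\<^sup>2) \<partial>mark_law) = (\<integral>\<^sup>+e. ennreal (if z \<or> e \<le> s then m\<^sup>2 * (1 - e)\<^sup>2 + \<beta> else m\<^sup>2 * s\<^sup>2) \<partial>expo)"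
    by (subst nn_integral_mark_law) (measurable, simp add: inner)
  also have "\<dots> = ennreal (if z then - P 0 else P s - P 0 + (m\<^sup>2 * s\<^sup>2) * exp (- s))"
  proof (rule nn_integral_expo_stopped[OF s])
    show "(P has_real_derivative exp (- x) * (m\<^sup>2 * (1 - x)\<^sup>2 + \<beta>)) (at x)" for x
      unfolding P_def by (auto intro!: derivative_eq_intros simp: algebra_simps power2_eq_square)
    show "(P \<longlongrightarrow> 0) at_top" unfolding P_def by (rule exp_poly_tendsto_0)
  qed (auto simp: \<beta>0)
  also have "(if z then - P 0 else P s - P 0 + (m\<^sup>2 * s\<^sup>2) * exp (- s)) = (if z then m\<^sup>2 + \<beta> else (m\<^sup>2 + \<beta>) * (1 - exp (- s)))"
    by (simp add: P_def algebra_simps)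
  finally have sq: "(\<integral>\<^sup>+x. ennreal ((compens d z a b t x)\<^sup>2) \<partial>mark_law) = ennreal (if z then m\<^sup>2 + \<beta> else (m\<^sup>2 + \<beta>) * (1 - exp (- s)))" .
  show "z \<Longrightarrow> (\<integral>\<^sup>+x. ennreal ((compens d z a b t x)\<^sup>2) \<partial>mark_law) = pair_int d (\<lambda>_. ennreal (1 / lam d a b)) a b"
    unfolding sq q by simp
  have "(m\<^sup>2 + \<beta>) * (1 - exp (- s)) \<le> (m\<^sup>2 + \<beta>) * 1" using \<beta>0 by (intro mult_left_mono) auto
  then show le: "(\<integral>\<^sup>+x. ennreal ((compens d z a b t x)\<^sup>2) \<partial>mark_law) \<le> pair_int d (\<lambda>_. ennreal (1 / lam d a b)) a b"
    unfolding sq q by (simp add: ennreal_leI)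
  have "(\<integral>\<^sup>+x. ennreal ((compens d z a b t x)\<^sup>2) \<partial>mark_law) < \<infinity>" using le unfolding q by (simp add: le_less_trans)
  then have ic: "integrable mark_law (compens d z a b t)"
    by (intro r.integrable_of_square) auto
  have "(\<integral>x. compens d z a b t x \<partial>mark_law) = (\<integral>e. \<integral>u. compens d z a b t (e, u) \<partial>unif \<partial>expo)"
    using p.integral_fst'[of "compens d z a b t"] ic by (simp add: mark_law_def)
  also have "\<dots> = (\<integral>e. m * (if z \<or> e \<le> s then 1 else 0) - m * (if z \<or> e \<le> s then e else s) \<partial>expo)"
  proof (rule Bochner_Integration.integral_cong[OF refl])
    fix e
    show "(\<integral>u. compens d z a b t (e, u) \<partial>unif) = m * (if z \<or> e \<le> s then 1 else 0) - m * (if z \<or> e \<le> s then e else s)"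
      unfolding compens using As(4) Am
      by (cases "z \<or> e \<le> s") (auto simp: A_def[symmetric] u.prob_space[simplified] simp del: de_Morgan_disj)
  qed
  also have "\<dots> = 0"
  proof -
    define w where "w = (if z then 1 else 1 - exp (- s))"
    have w: "0 \<le> w" using s by (auto simp: w_def)
    define P1 where "P1 x = - (0 * x\<^sup>2 + 0 * x + 1) * exp (- x)" for x :: real
    have "(\<integral>\<^sup>+e. ennreal (if z \<or> e \<le> s then 1 else 0) \<partial>expo) = ennreal (if z then - P1 0 else P1 s - P1 0 + 0 * exp (- s))"
    proof (rule nn_integral_expo_stopped[OF s])
      show "(P1 has_real_derivative exp (- x) * 1) (at x)" for x
        unfolding P1_def by (auto intro!: derivative_eq_intros)
      show "(P1 \<longlongrightarrow> 0) at_top" unfolding P1_def by (rule exp_poly_tendsto_0)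
    qed auto
    also have "\<dots> = ennreal w" by (simp add: P1_def w_def)
    finally have e1: "(\<integral>\<^sup>+e. ennreal (if z \<or> e \<le> s then 1 else 0) \<partial>expo) = ennreal w" .
    define P2 where "P2 x = - (0 * x\<^sup>2 + 1 * x + 1) * exp (- x)" for x :: real
    \<comment> \<open>\<open>max 0\<close> makes the integrand nonnegative everywhere, so that its
      real integral can be read off from the extended one; lifetimes are nonnegative almost
      surely.\<close>
    have "(\<integral>\<^sup>+e. ennreal (if z \<or> e \<le> s then max 0 e else max 0 s) \<partial>expo) = (\<integral>\<^sup>+e. ennreal (if z \<or> e \<le> s then e else max 0 s) \<partial>expo)"
      by (intro nn_integral_cong) (auto simp: max_def ennreal_neg)
    also have "\<dots> = ennreal (if z then - P2 0 else P2 s - P2 0 + max 0 s * exp (- s))"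
    proof (rule nn_integral_expo_stopped[OF s])
      show "(P2 has_real_derivative exp (- x) * x) (at x)" for x
        unfolding P2_def by (auto intro!: derivative_eq_intros simp: algebra_simps)
      show "(P2 \<longlongrightarrow> 0) at_top" unfolding P2_def by (rule exp_poly_tendsto_0)
    qed auto
    also have "\<dots> = ennreal w" using s by (auto simp: P2_def w_def algebra_simps max_def)
    finally have e2: "(\<integral>\<^sup>+e. ennreal (if z \<or> e \<le> s then max 0 e else max 0 s) \<partial>expo) = ennreal w" .
    have i1: "integrable expo (\<lambda>e. if z \<or> e \<le> s then 1 else 0 :: real)"
      by (rule integrableI_nonneg) (auto simp: e1)
    have i2: "integrable expo (\<lambda>e. if z \<or> e \<le> s then max 0 e else max 0 s)"
      by (rule integrableI_nonneg) (auto simp: e2)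
    have "(\<integral>e. m * (if z \<or> e \<le> s then 1 else 0) - m * (if z \<or> e \<le> s then e else s) \<partial>expo)
      = (\<integral>e. m * (if z \<or> e \<le> s then 1 else 0) - m * (if z \<or> e \<le> s then max 0 e else max 0 s) \<partial>expo)"
    proof (rule integral_cong_AE)
      show "AE e in expo. m * (if z \<or> e \<le> s then 1 else 0) - m * (if z \<or> e \<le> s then e else s)
        = m * (if z \<or> e \<le> s then 1 else 0) - m * (if z \<or> e \<le> s then max 0 e else max 0 s)"
        using AE_expo_nonneg by eventually_elim (use s in auto)
    qed auto
    also have "\<dots> = m * (\<integral>e. (if z \<or> e \<le> s then 1 else 0) \<partial>expo) - m * (\<integral>e. (if z \<or> e \<le> s then max 0 e else max 0 s) \<partial>expo)"
      by (subst Bochner_Integration.integral_diff) (use i1 i2 in auto)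
    also have "(\<integral>e. (if z \<or> e \<le> s then 1 else 0 :: real) \<partial>expo) = w"
      by (subst integral_eq_nn_integral) (auto simp: e1 w)
    also have "(\<integral>e. (if z \<or> e \<le> s then max 0 e else max 0 s) \<partial>expo) = w"
      by (subst integral_eq_nn_integral) (auto simp: e2 w)
    finally show ?thesis by simp
  qed
  finally show "(\<integral>x. compens d z a b t x \<partial>mark_law) = 0" .
qed

text \<open>The facet area that cells of generation below \<open>n\<close> create by time
  \<open>t\<close>, minus its compensator: \<open>d\<close> times volume times the time lived,
  summed over these cells.\<close>

definition mart :: "nat \<Rightarrow> bool \<Rightarrow> nat \<Rightarrow> (nat \<Rightarrow> real) \<Rightarrow> (nat \<Rightarrow> real) \<Rightarrow> real \<Rightarrow> (bool list \<Rightarrow> real \<times> real) \<Rightarrow> real" where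
  "mart d z = stree d z (\<lambda>_ _ _ _. 0) (compens d z)"

text \<open>Descends \<open>n\<close> generations at no cost and collects the node terms of the next
  \<open>k\<close>; by \<open>mart_add\<close> this is the increment of \<open>mart\<close> from
  \<open>n\<close> to \<open>n + k\<close>.\<close>

definition incr :: "nat \<Rightarrow> bool \<Rightarrow> nat \<Rightarrow> nat \<Rightarrow> (nat \<Rightarrow> real) \<Rightarrow> (nat \<Rightarrow> real) \<Rightarrow> real \<Rightarrow> (bool list \<Rightarrow> real \<times> real) \<Rightarrow> real" where
  "incr d z k = stree d z (mart d z k) (\<lambda>_ _ _ _. 0)"

text \<open>The part of the total drift \<open>d * t * vol\<close> that is due to cells of generation at least \<open>n\<close>.\<close>

definition rest :: "nat \<Rightarrow> nat \<Rightarrow> (nat \<Rightarrow> real) \<Rightarrow> (nat \<Rightarrow> real) \<Rightarrow> real \<Rightarrow> (bool list \<Rightarrow> real \<times> real) \<Rightarrow> real" where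
  "rest d = stree d False (\<lambda>a b t _. real d * vol d a b * t) (\<lambda>_ _ _ _. 0)"

lemma measurable_mart [measurable (raw)]:
  assumes "fa \<in> N \<rightarrow>\<^sub>M corner" "fb \<in> N \<rightarrow>\<^sub>M corner" "ft \<in> borel_measurable N" "fw \<in> N \<rightarrow>\<^sub>M Omega"
  shows "(\<lambda>x. mart d z n (fa x) (fb x) (ft x) (fw x)) \<in> borel_measurable N"
  unfolding mart_def by (rule measurable_stree[OF _ _ assms]) measurable

lemma measurable_incr [measurable (raw)]:
  assumes "fa \<in> N \<rightarrow>\<^sub>M corner" "fb \<in> N \<rightarrow>\<^sub>M corner" "ft \<in> borel_measurable N" "fw \<in> N \<rightarrow>\<^sub>M Omega"
  shows "(\<lambda>x. incr d z k n (fa x) (fb x) (ft x) (fw x)) \<in> borel_measurable N"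
  unfolding incr_def by (rule measurable_stree[OF _ _ assms]) (auto intro: measurable_mart)

lemma measurable_rest [measurable (raw)]:
  assumes "fa \<in> N \<rightarrow>\<^sub>M corner" "fb \<in> N \<rightarrow>\<^sub>M corner" "ft \<in> borel_measurable N" "fw \<in> N \<rightarrow>\<^sub>M Omega"
  shows "(\<lambda>x. rest d n (fa x) (fb x) (ft x) (fw x)) \<in> borel_measurable N"
  unfolding rest_def
proof (rule measurable_stree[OF _ _ assms])
  fix fa fb :: "'a \<Rightarrow> nat \<Rightarrow> real" and ft :: "'a \<Rightarrow> real"
  assume [measurable]: "fa \<in> N \<rightarrow>\<^sub>M corner" "fb \<in> N \<rightarrow>\<^sub>M corner" "ft \<in> borel_measurable N"
  show "(\<lambda>x. real d * vol d (fa x) (fb x) * ft x) \<in> borel_measurable N" by measurable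
qed simp

lemma mart_add: "mart d z (n + k) a b t \<omega> = mart d z n a b t \<omega> + incr d z k n a b t \<omega>"
proof (induction n arbitrary: a b t \<omega>)
  case 0 then show ?case by (simp add: mart_def incr_def)
next
  case (Suc n)
  then show ?case by (simp add: mart_def incr_def)
qed

lemma pair_int_mono_cell:
  assumes "cell d 1 a b"
  shows "pair_int d h a b \<le> pair_int d h (\<lambda>_. 0) (\<lambda>_. 1)"
proof -
  have "incell d (\<lambda>_. 0) (\<lambda>_. 1) x" if "incell d a b x" for x
    using that assms unfolding incell_def cell_def by (meson order_trans)
  then show ?thesis
    unfolding pair_int_def by (intro sum_mono nn_integral_mono) (auto simp: both_in_def)
qed

lemma cell_lam_le: "cell d 1 a b \<Longrightarrow> lam d a b \<le> real d"
  unfolding lam_def cell_def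
  by (rule order_trans[OF sum_mono[where g = "\<lambda>_. 1"]]) force+

lemma pair_int_kern_finite:
  assumes "2 < d" "cell d 1 a b" shows "pair_int d (kern (real d) n) a b < \<infinity>"
proof -
  have "pair_int d (kern (real d) n) a b \<le> pair_int d (kern (real d) 0) a b"
    using cell_lam_le[OF assms(2)] by (intro pair_int_mono kern_le_kern0) auto
  also have "\<dots> \<le> pair_int d (kern (real d) 0) (\<lambda>_. 0) (\<lambda>_. 1)" by (rule pair_int_mono_cell[OF assms(2)])
  also have "\<dots> < \<infinity>" unfolding pair_int_kern0_unit by (rule facet_energy_sum_finite[OF assms(1)])
  finally show ?thesis .
qed

lemma nn_integral_children:
  assumes c: "cell d R a b" and d: "0 < d" and [measurable]: "h \<in> borel_measurable borel"
  shows "(\<integral>\<^sup>+x. (pair_int d h a (upper d a b x) + pair_int d h (lower d a b x) b) \<partial>mark_law)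
    = pair_int d (\<lambda>L. ennreal (1 - L / lam d a b) * h L) a b"
proof -
  have "(\<integral>\<^sup>+x. (pair_int d h a (upper d a b x) + pair_int d h (lower d a b x) b) \<partial>mark_law)
    = (\<integral>\<^sup>+x. (\<lambda>u. pair_int d h a (upper d a b (0, u)) + pair_int d h (lower d a b (0, u)) b) (snd x) \<partial>mark_law)"
    by (simp add: upper_def lower_def)
  also have "\<dots> = (\<integral>\<^sup>+u. (case split_hyp d a b u of (k, r) \<Rightarrow>
        pair_int d h a (b(k := r)) + pair_int d h (a(k := r)) b) \<partial>unif)"
    by (subst nn_integral_mark_law_snd) (measurable, simp add: upper_def lower_def split_beta')
  finally show ?thesis unfolding pair_int_split[OF c d assms(3)] .
qed

text \<open>The induction step shared by \<open>mart\<close> and \<open>incr\<close>: the budget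
  \<open>G\<close> of the root and the kernel of index \<open>k\<close> for the children, weighted
  by the survival probability, have to fit into the kernel of index \<open>m\<close>. For
  \<open>mart\<close> this is the fixed point equation with k = m = 0; for \<open>incr\<close> the
  root costs nothing and m = k + 1.\<close>

lemma stree_moments:
  assumes d: "2 < d" and c: "cell d 1 a b" and t: "z \<or> 0 \<le> t"
    and fm: "\<And>a b t. f a b t \<in> borel_measurable Omega"
    and meas: "\<And>n a b t. stree d z f g n a b t \<in> borel_measurable Omega"
    and gm: "g a b t \<in> borel_measurable mark_law"
    and g2: "(\<integral>\<^sup>+x. ennreal ((g a b t x)\<^sup>2) \<partial>mark_law) \<le> G" and g1: "(\<integral>x. g a b t x \<partial>mark_law) = 0"
    and IH: "\<And>a b t. cell d 1 a b \<Longrightarrow> z \<or> 0 \<le> t \<Longrightarrow>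
      moment2 (stree d z f g n a b t) \<le> pair_int d (kern (real d) k) a b \<and> (\<integral>\<omega>. stree d z f g n a b t \<omega> \<partial>Omega) = 0"
    and G: "G + pair_int d (\<lambda>L. ennreal (1 - L / lam d a b) * kern (real d) k L) a b \<le> pair_int d (kern (real d) m) a b"
  shows "moment2 (stree d z f g (Suc n) a b t) \<le> pair_int d (kern (real d) m) a b
    \<and> (\<integral>\<omega>. stree d z f g (Suc n) a b t \<omega> \<partial>Omega) = 0"
proof -
  have d0: "0 < d" using d by simp
  let ?K = "pair_int d (kern (real d) k)" and ?F = "stree d z f g"
  have "moment2 (?F n a b t) < \<infinity> \<and> (\<integral>\<omega>. ?F n a b t \<omega> \<partial>Omega) = 0"
    if "cell d 1 a b" "z \<or> 0 \<le> t" for a b t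
    using IH[OF that] pair_int_kern_finite[OF d that(1), of k] by (auto intro: le_less_trans)
  note step = stree_step[OF c d0 t fm meas this]
  have "moment2 (?F (Suc n) a b t)
     = (\<integral>\<^sup>+x. ennreal ((g a b t x)\<^sup>2) + (if z \<or> life d a b x \<le> t
         then moment2 (?F n a (upper d a b x) (t - life d a b x)) + moment2 (?F n (lower d a b x) b (t - life d a b x))
         else 0) \<partial>mark_law)"
    by (rule step(1)) auto
  also have "\<dots> \<le> (\<integral>\<^sup>+x. ennreal ((g a b t x)\<^sup>2) + (?K a (upper d a b x) + ?K (lower d a b x) b) \<partial>mark_law)"
    by (rule nn_integral_mono_AE, rule AE_mp[OF AE_cell_children[OF c d0]])
      (use IH in \<open>auto intro!: add_mono AE_I2\<close>)
  also have "\<dots> = (\<integral>\<^sup>+x. ennreal ((g a b t x)\<^sup>2) \<partial>mark_law) + (\<integral>\<^sup>+x. ?K a (upper d a b x) + ?K (lower d a b x) b \<partial>mark_law)"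
  proof (rule nn_integral_add)
    show "(\<lambda>x. ennreal ((g a b t x)\<^sup>2)) \<in> borel_measurable mark_law"
      by (rule measurable_compose[OF gm]) measurable
  qed measurable
  also have "\<dots> \<le> pair_int d (kern (real d) m) a b"
    unfolding nn_integral_children[OF c d0 measurable_kern]
    by (rule order_trans[OF add_right_mono[OF g2] G])
  finally have le: "moment2 (?F (Suc n) a b t) \<le> pair_int d (kern (real d) m) a b" .
  then have "moment2 (?F (Suc n) a b t) < \<infinity>"
    using pair_int_kern_finite[OF d c, of m] by (auto intro: le_less_trans)
  then have "(\<integral>\<omega>. ?F (Suc n) a b t \<omega> \<partial>Omega) = (\<integral>x. g a b t x \<partial>mark_law)"
    by (intro step(2) gm) auto
  with le g1 show ?thesis by simp
qed

text \<open>The bound reproduces itself under one more generation because 1/L is a fixed point, so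
  it is uniform in \<open>n\<close> and in the time.\<close>

lemma mart_moments:
  assumes d: "2 < d" and "cell d 1 a b" and "z \<or> 0 \<le> t"
  shows "moment2 (mart d z n a b t) \<le> pair_int d (kern (real d) 0) a b
    \<and> (\<integral>\<omega>. mart d z n a b t \<omega> \<partial>Omega) = 0"
  using assms(2-)
proof (induction n arbitrary: a b t)
  case 0 then show ?case by (simp add: mart_def)
next
  case (Suc n)
  note c = Suc.prems(1) and t = Suc.prems(2)
  have d0: "0 < d" using d by simp
  have m: "stree d z (\<lambda>_ _ _ _. 0) (compens d z) n a b t \<in> borel_measurable Omega" for n a b t
    unfolding mart_def[symmetric] by measurable
  have cm: "compens d z a b t \<in> borel_measurable mark_law" by measurable
  show ?case
    unfolding mart_def
    by (rule stree_moments[OF d c t _ m cm nn_integral_compens_sq(1,3)[OF c d0 t] Suc.IH[unfolded mart_def]])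
      (auto simp: pair_int_kern_split[OF c d0])
qed

text \<open>Starts from the bound for \<open>mart\<close> and picks up a factor 1 - L/d in each of
  the \<open>n\<close> generations passed on the way, which leaves a bound uniform in
  \<open>k\<close> and in the time.\<close>

lemma incr_moments:
  assumes d: "2 < d" and "cell d 1 a b" and "z \<or> 0 \<le> t"
  shows "moment2 (incr d z k n a b t) \<le> pair_int d (kern (real d) n) a b
    \<and> (\<integral>\<omega>. incr d z k n a b t \<omega> \<partial>Omega) = 0"
  using assms(2-)
proof (induction n arbitrary: a b t)
  case 0 then show ?case using mart_moments[OF d] by (simp add: incr_def)
next
  case (Suc n)
  note c = Suc.prems(1) and t = Suc.prems(2)
  have d0: "0 < d" using d by simp
  have m: "stree d z (mart d z k) (\<lambda>_ _ _ _. 0) n a b t \<in> borel_measurable Omega" for n a b t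
    unfolding incr_def[symmetric] by measurable
  show ?case
    unfolding incr_def
    by (rule stree_moments[OF d c t _ m, where G = 0 and k = n])
      (use pair_int_kern_Suc[OF c d0 cell_lam_le[OF c]] Suc.IH[unfolded incr_def] in auto)
qed

text \<open>The counterpart of \<open>mart_moments\<close>: with infinite horizon the root term is
  exact, so all that is lost is the energy of the pairs still together after \<open>n\<close>
  generations. The loss is added on the right, which avoids subtraction of extended reals.\<close>

lemma mart_second_moment_ge:
  assumes d: "2 < d" and "cell d 1 a b"
  shows "pair_int d (kern (real d) 0) a b
    \<le> moment2 (mart d True n a b t) + pair_int d (kern (real d) n) a b"
  using assms(2)
proof (induction n arbitrary: a b t)
  case 0 then show ?case by simp
next
  case (Suc n)
  note c = Suc.prems
  have d0: "0 < d" using d by simp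
  let ?K = "\<lambda>n. pair_int d (kern (real d) n)"
  let ?V = "\<lambda>a b t. \<integral>\<^sup>+\<omega>. ennreal ((mart d True n a b t \<omega>)\<^sup>2) \<partial>Omega"
  have IH: "?V a b t < \<infinity> \<and> (\<integral>\<omega>. mart d True n a b t \<omega> \<partial>Omega) = 0"
    if "cell d 1 a b" "True \<or> 0 \<le> t" for a b t
    using mart_moments[OF d that, of n] pair_int_kern_finite[OF d that(1), of 0] by (auto intro: le_less_trans)
  note step = stree_step[where d = d and f = "\<lambda>_ _ _ _. 0" and g = "compens d True" and z = True and n = n, folded mart_def,
      OF c d0 _ _ _ IH]
  interpret O: prob_space Omega by (rule prob_space_Omega)
  have "?K 0 a b = pair_int d (\<lambda>_. ennreal (1 / lam d a b)) a b
      + pair_int d (\<lambda>L. ennreal (1 - L / lam d a b) * kern (real d) 0 L) a b"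
    by (rule pair_int_kern_split[OF c d0, symmetric])
  also have "\<dots> = (\<integral>\<^sup>+x. ennreal ((compens d True a b t x)\<^sup>2) \<partial>mark_law)
      + (\<integral>\<^sup>+x. (?K 0 a (upper d a b x) + ?K 0 (lower d a b x) b) \<partial>mark_law)"
    unfolding nn_integral_children[OF c d0 measurable_kern] by (subst nn_integral_compens_sq(2)[OF c d0]) auto
  also have "\<dots> \<le> (\<integral>\<^sup>+x. ennreal ((compens d True a b t x)\<^sup>2) \<partial>mark_law)
      + (\<integral>\<^sup>+x. (?V a (upper d a b x) (t - life d a b x) + ?V (lower d a b x) b (t - life d a b x))
         + (?K n a (upper d a b x) + ?K n (lower d a b x) b) \<partial>mark_law)"
  proof (intro add_mono order_refl nn_integral_mono_AE)
    show "AE x in mark_law. ?K 0 a (upper d a b x) + ?K 0 (lower d a b x) b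
       \<le> (?V a (upper d a b x) (t - life d a b x) + ?V (lower d a b x) b (t - life d a b x))
         + (?K n a (upper d a b x) + ?K n (lower d a b x) b)"
      using AE_cell_children[OF c d0]
    proof eventually_elim
      case (elim x)
      then show ?case
        using add_mono[OF Suc.IH[of a "upper d a b x" "t - life d a b x"] Suc.IH[of "lower d a b x" b "t - life d a b x"]]
        by (simp add: ac_simps)
    qed
  qed
  also have "\<dots> = (\<integral>\<^sup>+x. ennreal ((compens d True a b t x)\<^sup>2)
        + (?V a (upper d a b x) (t - life d a b x) + ?V (lower d a b x) b (t - life d a b x)) \<partial>mark_law)
      + (\<integral>\<^sup>+x. (?K n a (upper d a b x) + ?K n (lower d a b x) b) \<partial>mark_law)"
  proof -
    define C where "C x = ennreal ((compens d True a b t x)\<^sup>2)" for x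
    define V where "V x = ?V a (upper d a b x) (t - life d a b x) + ?V (lower d a b x) b (t - life d a b x)" for x
    define K where "K x = ?K n a (upper d a b x) + ?K n (lower d a b x) b" for x
    have "C \<in> borel_measurable mark_law" "V \<in> borel_measurable mark_law" "K \<in> borel_measurable mark_law"
      unfolding C_def[abs_def] V_def[abs_def] K_def[abs_def] by measurable
    then show ?thesis
      unfolding C_def[symmetric] V_def[symmetric] K_def[symmetric] by (simp add: nn_integral_add add.assoc)
  qed
  also have "(\<integral>\<^sup>+x. ennreal ((compens d True a b t x)\<^sup>2)
        + (?V a (upper d a b x) (t - life d a b x) + ?V (lower d a b x) b (t - life d a b x)) \<partial>mark_law)
      = moment2 (mart d True (Suc n) a b t)"
    by (subst step(1)) auto
  also have "(\<integral>\<^sup>+x. (?K n a (upper d a b x) + ?K n (lower d a b x) b) \<partial>mark_law) \<le> ?K (Suc n) a b"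
    unfolding nn_integral_children[OF c d0 measurable_kern]
    by (rule pair_int_kern_Suc[OF c d0 cell_lam_le[OF c]])
  finally show ?case by (simp add: add_left_mono)
qed

text \<open>The split divides one side, and both children share the facet across it. Conservation of
  volume makes the total drift of the living cells deterministic.\<close>

lemma vol_children:
  assumes "fst (split_hyp d a b (snd x)) < d"
  shows "vol d a (upper d a b x) + vol d (lower d a b x) b = vol d a b"
proof -
  define k r where "k = fst (split_hyp d a b (snd x))" and "r = snd (split_hyp d a b (snd x))"
  have k: "k < d" using assms by (simp add: k_def)
  have "facet d a (b(k := r)) k = facet d a b k" "facet d (a(k := r)) b k = facet d a b k"
    unfolding facet_def by (auto intro!: prod.cong)
  then show ?thesis
    unfolding upper_def lower_def k_def[symmetric] r_def[symmetric] vol_facet[OF k]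
    by (simp add: algebra_simps)
qed

text \<open>A cell in the unit cube is split at rate at most \<open>d\<close>, hence within the
  remaining time with probability at most 1 - exp(-d t). As the volumes of the children add up, each
  generation contributes one such factor.\<close>

lemma rest_bound:
  assumes d: "0 < d" and "cell d 1 a b" and "0 \<le> t"
  shows "moment1 (rest d n a b t) \<le> ennreal (real d * vol d a b * t * (1 - exp (- real d * t)) ^ n)"
  using assms(2-)
proof (induction n arbitrary: a b t)
  case 0
  interpret O: prob_space Omega by (rule prob_space_Omega)
  from 0 show ?case by (simp add: rest_def vol_nonneg O.emeasure_space_1[simplified])
next
  case (Suc n)
  note c = Suc.prems(1) and t = Suc.prems(2)
  interpret O: prob_space Omega by (rule prob_space_Omega)
  interpret u: prob_space unif by (rule prob_space_unif)
  define p where "p s = 1 - exp (- real d * s)" for s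
  define B where "B = real d * vol d a b * t * p t ^ n"
  have p: "0 \<le> p s" "s \<le> s' \<Longrightarrow> p s \<le> p s'" if "0 \<le> s" for s s'
    using that d by (auto simp: p_def)
  have B: "0 \<le> B" using vol_nonneg[OF c] t p by (simp add: B_def)
  have "moment1 (rest d (Suc n) a b t)
     = (\<integral>\<^sup>+x. \<integral>\<^sup>+l. \<integral>\<^sup>+r. ennreal \<bar>rest d (Suc n) a b t (graft x l r)\<bar> \<partial>Omega \<partial>Omega \<partial>mark_law)"
    by (rule nn_integral_Omega) measurable
  also have "\<dots> \<le> (\<integral>\<^sup>+x. ennreal (if fst x \<le> lam d a b * t then B else 0) \<partial>mark_law)"
  proof (rule nn_integral_mono_AE)
    show "AE x in mark_law. (\<integral>\<^sup>+l. \<integral>\<^sup>+r. ennreal \<bar>rest d (Suc n) a b t (graft x l r)\<bar> \<partial>Omega \<partial>Omega)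
        \<le> ennreal (if fst x \<le> lam d a b * t then B else 0)"
      using AE_cell_children[OF c d]
    proof eventually_elim
      case (elim x)
      have eq: "life d a b x \<le> t \<longleftrightarrow> fst x \<le> lam d a b * t"
        using lam_pos[OF c d] by (simp add: life_def field_simps)
      show ?case
      proof (cases "life d a b x \<le> t")
        case True
        define s where "s = t - life d a b x"
        have s: "0 \<le> s" "s \<le> t" using True elim by (auto simp: s_def)
        have "(\<integral>\<^sup>+l. \<integral>\<^sup>+r. ennreal \<bar>rest d (Suc n) a b t (graft x l r)\<bar> \<partial>Omega \<partial>Omega)
          \<le> (\<integral>\<^sup>+l. \<integral>\<^sup>+r. ennreal \<bar>rest d n a (upper d a b x) s l\<bar> + ennreal \<bar>rest d n (lower d a b x) b s r\<bar> \<partial>Omega \<partial>Omega)"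
          using True unfolding rest_def stree_graft
          by (intro nn_integral_mono) (simp flip: ennreal_plus add: s_def)
        also have "\<dots> = (\<integral>\<^sup>+l. ennreal \<bar>rest d n a (upper d a b x) s l\<bar> \<partial>Omega) + (\<integral>\<^sup>+r. ennreal \<bar>rest d n (lower d a b x) b s r\<bar> \<partial>Omega)"
          by (subst nn_integral_add; (measurable)?)
            (subst nn_integral_add; (measurable)?; simp add: O.emeasure_space_1[simplified])
        also have "\<dots> \<le> ennreal (real d * vol d a (upper d a b x) * s * p s ^ n) + ennreal (real d * vol d (lower d a b x) b * s * p s ^ n)"
          unfolding p_def using elim s by (intro add_mono Suc.IH) auto
        also have "\<dots> = ennreal (real d * (vol d a (upper d a b x) + vol d (lower d a b x) b) * s * p s ^ n)"
          using elim s p by (subst ennreal_plus[symmetric]) (auto intro!: vol_nonneg mult_nonneg_nonneg simp: algebra_simps)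
        also have "\<dots> = ennreal (real d * vol d a b * s * p s ^ n)"
          using elim by (simp add: vol_children)
        also have "\<dots> \<le> ennreal B"
          unfolding B_def using s t p vol_nonneg[OF c] by (intro ennreal_leI mult_mono power_mono) auto
        finally show ?thesis using True eq by simp
      next
        case False
        then show ?thesis unfolding rest_def stree_graft by simp
      qed
    qed
  qed
  also have "\<dots> = (\<integral>\<^sup>+e. ennreal (if False \<or> e \<le> lam d a b * t then B else 0) \<partial>expo)"
    by (subst nn_integral_mark_law) (auto simp: u.emeasure_space_1[simplified])
  also have "\<dots> = ennreal (B * (1 - exp (- (lam d a b * t))))"
  proof (subst nn_integral_expo_stopped[where P = "\<lambda>x. - (0 * x\<^sup>2 + 0 * x + B) * exp (- x)"])
    show "False \<or> 0 \<le> lam d a b * t" using lam_pos[OF c d] t by simp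
    show "((\<lambda>x. - (0 * x\<^sup>2 + 0 * x + B) * exp (- x)) \<longlongrightarrow> 0) at_top" by (rule exp_poly_tendsto_0)
  qed (auto intro!: derivative_eq_intros simp: B algebra_simps)
  also have "\<dots> \<le> ennreal (B * p t)"
    using B cell_lam_le[OF c] t unfolding p_def by (intro ennreal_leI mult_left_mono) (auto intro: mult_right_mono)
  finally show ?case by (simp add: B_def p_def algebra_simps)
qed

subsection \<open>The surface area as a tree recursion\<close>

definition facet_meas :: "nat \<Rightarrow> (nat \<Rightarrow> real) \<Rightarrow> (nat \<Rightarrow> real) \<Rightarrow> nat \<times> real \<Rightarrow> real" where
  "facet_meas d a b H = measure (hyp_meas d H) (box_d d a b)"

lemma emeasure_others_PiE:
  "emeasure (others d i) (PiE ({..<d} - {i}) (\<lambda>j. {a j..b j})) = ennreal (\<Prod>j\<in>{..<d} - {i}. max 0 (b j - a j))"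
proof -
  interpret product_sigma_finite "\<lambda>_::nat. lborel :: real measure" ..
  have "emeasure (others d i) (PiE ({..<d} - {i}) (\<lambda>j. {a j..b j})) = (\<Prod>j\<in>{..<d} - {i}. ennreal (max 0 (b j - a j)))"
    unfolding others_def
    by (subst emeasure_PiM) (auto intro!: prod.cong simp: emeasure_lborel_Icc_eq max_def)
  also have "\<dots> = ennreal (\<Prod>j\<in>{..<d} - {i}. max 0 (b j - a j))" by (rule prod_ennreal) simp
  finally show ?thesis .
qed

text \<open>For a direction \<open>i \<ge> d\<close> (reached only for marks outside \<open>[0, 1]\<close>) the embedding leaves the
  extensional functions on \<open>{..<d}\<close>, unless the position happens to be \<open>undefined\<close>.\<close>

lemma facet_meas_eq:
  "facet_meas d a b (i, r) = (if (if i < d then a i \<le> r \<and> r \<le> b i else r = undefined)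
     then \<Prod>j\<in>{..<d} - {i}. max 0 (b j - a j) else 0)"
proof -
  let ?P = "PiM {..<d} (\<lambda>_. lborel :: real measure)"
  have box: "box_d d a b \<in> sets ?P" unfolding box_d_def by (intro sets_PiM_I_finite) auto
  have pr: "0 \<le> (\<Prod>j\<in>{..<d} - {i}. max 0 (b j - a j))" by (intro prod_nonneg) auto
  have sp: "space (others d i) = PiE ({..<d} - {i}) (\<lambda>_. UNIV)" by (simp add: others_def space_PiM)
  show ?thesis
  proof (cases "i < d")
    case True
    have "emeasure (hyp_meas d (i, r)) (box_d d a b) = emeasure (others d i) (hyp_emb (i, r) -` box_d d a b \<inter> space (others d i))"
      unfolding hyp_meas_def fst_conv others_def[symmetric]
      by (rule emeasure_distr[OF measurable_hyp_emb[OF True] box])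
    also have "hyp_emb (i, r) -` box_d d a b \<inter> space (others d i)
        = (if a i \<le> r \<and> r \<le> b i then PiE ({..<d} - {i}) (\<lambda>j. {a j..b j}) else {})"
    proof -
      have "hyp_emb (i, r) x \<in> box_d d a b \<longleftrightarrow> (a i \<le> r \<and> r \<le> b i) \<and> x \<in> PiE ({..<d} - {i}) (\<lambda>j. {a j..b j})"
        if x: "x \<in> space (others d i)" for x
      proof -
        have "hyp_emb (i, r) x \<in> extensional {..<d}"
          using x True unfolding sp by (auto simp: hyp_emb_def PiE_iff extensional_def)
        moreover have "(\<forall>j\<in>{..<d}. hyp_emb (i, r) x j \<in> {a j..b j}) \<longleftrightarrow>
            (a i \<le> r \<and> r \<le> b i) \<and> (\<forall>j\<in>{..<d} - {i}. x j \<in> {a j..b j})"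
          using True by (auto simp: hyp_emb_def)
        moreover have "x \<in> extensional ({..<d} - {i})" using x unfolding sp by (simp add: PiE_iff)
        ultimately show ?thesis unfolding box_d_def PiE_iff by blast
      qed
      moreover have "PiE ({..<d} - {i}) (\<lambda>j. {a j..b j}) \<subseteq> space (others d i)"
        unfolding sp by (intro PiE_mono) auto
      ultimately show ?thesis by auto
    qed
    finally show ?thesis
      using True pr by (auto simp: facet_meas_def measure_def emeasure_others_PiE)
  next
    case False
    then have I: "{..<d} - {i} = {..<d}" by auto
    show ?thesis
    proof (cases "r = undefined")
      case True
      have e: "hyp_emb (i, r) x = x" if "x \<in> space (others d i)" for x
        using that False True unfolding sp by (auto simp: hyp_emb_def PiE_iff extensional_def)
      have eq: "others d i = ?P" by (simp add: others_def I)
      have "hyp_emb (i, r) \<in> others d i \<rightarrow>\<^sub>M ?P"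
        by (subst measurable_cong[where g = "\<lambda>x. x"]) (auto simp: e eq)
      then have "emeasure (hyp_meas d (i, r)) (box_d d a b) = emeasure (others d i) (hyp_emb (i, r) -` box_d d a b \<inter> space (others d i))"
        unfolding hyp_meas_def fst_conv others_def[symmetric] by (rule emeasure_distr[OF _ box])
      also have "hyp_emb (i, r) -` box_d d a b \<inter> space (others d i) = PiE ({..<d} - {i}) (\<lambda>j. {a j..b j})"
      proof -
        have "hyp_emb (i, r) -` box_d d a b \<inter> space (others d i) = box_d d a b \<inter> space (others d i)"
          using e by auto
        also have "\<dots> = PiE ({..<d} - {i}) (\<lambda>j. {a j..b j})"
          unfolding sp I box_d_def by auto
        finally show ?thesis .
      qed
      finally show ?thesis
        using False True pr unfolding emeasure_others_PiE by (simp add: facet_meas_def measure_def)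
    next
      case r: False
      have "hyp_emb (i, r) -` box_d d a b \<inter> space (others d i) = {}"
      proof -
        have "hyp_emb (i, r) x \<notin> box_d d a b" for x
        proof
          assume "hyp_emb (i, r) x \<in> box_d d a b"
          then have "hyp_emb (i, r) x i = undefined"
            unfolding box_d_def by (rule PiE_arb) (use False in simp)
          with r show False by (simp add: hyp_emb_def)
        qed
        then show ?thesis by auto
      qed
      then have "emeasure (hyp_meas d (i, r)) (box_d d a b) = 0"
        unfolding hyp_meas_def fst_conv others_def[symmetric] distr_def
        by (simp add: emeasure_measure_of_conv)
      then show ?thesis using False r by (simp add: facet_meas_def measure_def)
    qed
  qed
qed

lemma measurable_facet_meas [measurable (raw)]:
  assumes [measurable]: "f \<in> N \<rightarrow>\<^sub>M corner" "g \<in> N \<rightarrow>\<^sub>M corner" "h \<in> N \<rightarrow>\<^sub>M count_space UNIV \<Otimes>\<^sub>M borel"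
  shows "(\<lambda>x. facet_meas d (f x) (g x) (h x)) \<in> borel_measurable N"
proof -
  have eq: "facet_meas d a b H = (if (if fst H < d then a (fst H) \<le> snd H \<and> snd H \<le> b (fst H) else snd H = undefined)
     then \<Prod>j<d. if j = fst H then 1 else max 0 (b j - a j) else 0)" for a b H
  proof -
    have "(\<Prod>j\<in>{..<d} - {fst H}. max 0 (b j - a j)) = (\<Prod>j<d. if j = fst H then 1 else max 0 (b j - a j))"
      by (rule prod.mono_neutral_cong_left) auto
    then show ?thesis using facet_meas_eq[of d a b "fst H" "snd H"] by simp
  qed
  show ?thesis unfolding eq by measurable
qed

lemma facet_meas_cell:
  assumes "cell d R a b" "i < d" "a i \<le> r" "r \<le> b i"
  shows "facet_meas d a b (i, r) = facet d a b i"
  using assms unfolding facet_meas_eq facet_def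
  by (auto intro!: prod.cong simp: cell_def less_imp_le)

text \<open>The literal rate from the definition of the process, defined for degenerate boxes as
  well; on cells it is \<open>lam\<close>.\<close>

definition hitl :: "nat \<Rightarrow> (nat \<Rightarrow> real) \<Rightarrow> (nat \<Rightarrow> real) \<Rightarrow> real" where
  "hitl d a b = measure (Lambda d) (hits d (box_d d a b))"

lemma hitl_cell: "cell d R a b \<Longrightarrow> hitl d a b = lam d a b"
  unfolding hitl_def measure_hits_box by (auto simp: cell_def less_imp_le)

lemma measurable_hitl [measurable (raw)]:
  assumes [measurable]: "f \<in> N \<rightarrow>\<^sub>M corner" "g \<in> N \<rightarrow>\<^sub>M corner"
  shows "(\<lambda>x. hitl d (f x) (g x)) \<in> borel_measurable N"
proof -
  have "Measurable.pred N (\<lambda>x. \<forall>j\<in>{..<d}. f x j \<le> g x j)"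
    by (rule pred_intros_finite) measurable
  then have [measurable]: "Measurable.pred N (\<lambda>x. \<forall>j<d. f x j \<le> g x j)" by simp
  show ?thesis unfolding hitl_def measure_hits_box by measurable
qed

text \<open>The summand of \<open>stit_surface\<close>, started from an arbitrary node, box and
  birth time, so that it can be unfolded from the top of the path.\<close>

definition contrib :: "nat \<Rightarrow> real \<Rightarrow> (bool list \<Rightarrow> real \<times> real) \<Rightarrow> bool list \<Rightarrow> (nat \<Rightarrow> real) \<Rightarrow> (nat \<Rightarrow> real) \<Rightarrow> real \<Rightarrow> bool list \<Rightarrow> real" where
  "contrib d t \<omega> pre a b \<tau> v = (case cellof d \<omega> pre a b \<tau> v of (a', b', \<tau>') \<Rightarrow>
     if \<tau>' + fst (\<omega> (pre @ v)) / hitl d a' b' \<le> t then facet_meas d a' b' (split_hyp d a' b' (snd (\<omega> (pre @ v)))) else 0)"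

lemma contrib_Nil:
  "contrib d t \<omega> pre a b \<tau> [] = (if \<tau> + fst (\<omega> pre) / hitl d a b \<le> t then facet_meas d a b (split_hyp d a b (snd (\<omega> pre))) else 0)"
  by (simp add: contrib_def)

lemma contrib_Cons:
  "contrib d t \<omega> pre a b \<tau> (c # v) = (if c then
     contrib d t \<omega> (pre @ [True]) (lower d a b (\<omega> pre)) b (\<tau> + fst (\<omega> pre) / hitl d a b) v
   else contrib d t \<omega> (pre @ [False]) a (upper d a b (\<omega> pre)) (\<tau> + fst (\<omega> pre) / hitl d a b) v)"
  by (cases c) (simp_all add: contrib_def Let_def hitl_def lower_def upper_def split_beta')

lemma contrib_nonneg: "0 \<le> contrib d t \<omega> pre a b \<tau> v"
  by (auto simp: contrib_def facet_meas_def split: prod.split)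

lemma stit_surface_contrib:
  "stit_surface d t a b \<omega> = infsum (contrib d t \<omega> [] a b 0) UNIV"
  unfolding stit_surface_def death_time_def facet_area_def contrib_def hitl_def facet_meas_def
  by (intro infsum_cong) (auto split: prod.split)

lemma measurable_cellof:
  assumes "fw \<in> N \<rightarrow>\<^sub>M Omega" "fa \<in> N \<rightarrow>\<^sub>M corner" "fb \<in> N \<rightarrow>\<^sub>M corner" "ft \<in> borel_measurable N"
  shows "(\<lambda>x. cellof d (fw x) pre (fa x) (fb x) (ft x) v) \<in> N \<rightarrow>\<^sub>M corner \<Otimes>\<^sub>M corner \<Otimes>\<^sub>M borel"
  using assms
proof (induction v arbitrary: pre fa fb ft)
  case Nil
  note [measurable] = Nil
  show ?case by simp
next
  case (Cons c v)
  note [measurable] = Cons.prems measurable_Omega_component[OF Cons.prems(1)]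
  show ?case
  proof (cases c)
    case True
    have "(\<lambda>x. cellof d (fw x) (pre @ [True]) (lower d (fa x) (fb x) (fw x pre)) (fb x)
       (ft x + fst (fw x pre) / hitl d (fa x) (fb x)) v) \<in> N \<rightarrow>\<^sub>M corner \<Otimes>\<^sub>M corner \<Otimes>\<^sub>M borel"
      by (rule Cons.IH) measurable
    then show ?thesis using True by (simp add: Let_def lower_def hitl_def)
  next
    case False
    have "(\<lambda>x. cellof d (fw x) (pre @ [False]) (fa x) (upper d (fa x) (fb x) (fw x pre))
       (ft x + fst (fw x pre) / hitl d (fa x) (fb x)) v) \<in> N \<rightarrow>\<^sub>M corner \<Otimes>\<^sub>M corner \<Otimes>\<^sub>M borel"
      by (rule Cons.IH) measurable
    then show ?thesis using False by (simp add: Let_def upper_def hitl_def)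
  qed
qed

lemma measurable_contrib [measurable]:
  "(\<lambda>\<omega>. contrib d t \<omega> pre a b \<tau> v) \<in> borel_measurable Omega"
proof -
  define F where "F \<omega> = cellof d \<omega> pre a b \<tau> v" for \<omega>
  have [measurable]: "F \<in> Omega \<rightarrow>\<^sub>M corner \<Otimes>\<^sub>M corner \<Otimes>\<^sub>M borel"
    unfolding F_def by (rule measurable_cellof) auto
  have [measurable]: "(\<lambda>\<omega>. \<omega> w) \<in> Omega \<rightarrow>\<^sub>M borel \<Otimes>\<^sub>M borel" for w
    by (rule measurable_Omega_component) simp
  show ?thesis unfolding contrib_def F_def[symmetric] split_beta' by measurable
qed

section \<open>The surface as a limit of sums over the first generations\<close>

definition psum :: "nat \<Rightarrow> real \<Rightarrow> (bool list \<Rightarrow> real \<times> real) \<Rightarrow> bool list \<Rightarrow> (nat \<Rightarrow> real) \<Rightarrow> (nat \<Rightarrow> real) \<Rightarrow> real \<Rightarrow> nat \<Rightarrow> real" where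
  "psum d t \<omega> pre a b \<tau> n = (\<Sum>v | length v < n. contrib d t \<omega> pre a b \<tau> v)"

lemma short_lists_Suc:
  "{v :: bool list. length v < Suc n} = insert [] (Cons False ` {v. length v < n} \<union> Cons True ` {v. length v < n})"
proof (intro set_eqI)
  fix v :: "bool list"
  show "v \<in> {v. length v < Suc n} \<longleftrightarrow> v \<in> insert [] (Cons False ` {v. length v < n} \<union> Cons True ` {v. length v < n})"
  proof (cases v)
    case (Cons c w) then show ?thesis by (cases c) auto
  qed simp
qed

lemma finite_short_lists: "finite {v :: bool list. length v < n}"
  by (induction n) (simp_all add: short_lists_Suc)

lemma psum_Suc:
  "psum d t \<omega> pre a b \<tau> (Suc n) = contrib d t \<omega> pre a b \<tau> []
     + psum d t \<omega> (pre @ [False]) a (upper d a b (\<omega> pre)) (\<tau> + fst (\<omega> pre) / hitl d a b) n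
     + psum d t \<omega> (pre @ [True]) (lower d a b (\<omega> pre)) b (\<tau> + fst (\<omega> pre) / hitl d a b) n"
proof -
  let ?S = "{v :: bool list. length v < n}"
  have "(\<Sum>v\<in>Cons False ` ?S \<union> Cons True ` ?S. contrib d t \<omega> pre a b \<tau> v)
     = (\<Sum>v\<in>Cons False ` ?S. contrib d t \<omega> pre a b \<tau> v) + (\<Sum>v\<in>Cons True ` ?S. contrib d t \<omega> pre a b \<tau> v)"
    by (rule sum.union_disjoint) (auto intro: finite_imageI finite_short_lists)
  moreover have "(\<Sum>v\<in>insert [] (Cons False ` ?S \<union> Cons True ` ?S). contrib d t \<omega> pre a b \<tau> v)
     = contrib d t \<omega> pre a b \<tau> [] + (\<Sum>v\<in>Cons False ` ?S \<union> Cons True ` ?S. contrib d t \<omega> pre a b \<tau> v)"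
    by (rule sum.insert) (auto intro: finite_imageI finite_short_lists)
  ultimately show ?thesis
    unfolding psum_def short_lists_Suc by (simp add: sum.reindex contrib_Cons)
qed

lemma psum_mono: "n \<le> m \<Longrightarrow> psum d t \<omega> pre a b \<tau> n \<le> psum d t \<omega> pre a b \<tau> m"
  unfolding psum_def by (intro sum_mono2 finite_short_lists contrib_nonneg) auto

lemma psum_nonneg: "0 \<le> psum d t \<omega> pre a b \<tau> n"
  unfolding psum_def by (intro sum_nonneg contrib_nonneg)

lemma measurable_psum [measurable]: "(\<lambda>\<omega>. psum d t \<omega> pre a b \<tau> n) \<in> borel_measurable Omega"
  unfolding psum_def by measurable

text \<open>For a nonnegative family \<open>infsum\<close> is the supremum of the finite sums or,
  without summability, 0; \<open>enn2real\<close> sends infinity to 0 as well. So the conventions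
  match and the identity holds for every \<omega>, which yields measurability.\<close>

lemma stit_surface_SUP:
  "stit_surface d t a b \<omega> = enn2real (SUP n. ennreal (psum d t \<omega> [] a b 0 n))"
proof -
  let ?f = "contrib d t \<omega> [] a b 0" and ?s = "\<lambda>n. psum d t \<omega> [] a b 0 n"
  \<comment> \<open>The sets of all nodes up to a given depth are cofinal among the finite sets of
    nodes.\<close>
  have sub: "F \<subseteq> {v. length v < Suc (Max (length ` F))}" if "finite F" for F :: "bool list set"
    using that by (auto simp: less_Suc_eq_le)
  show ?thesis
  proof (cases "(SUP n. ennreal (?s n)) = \<infinity>")
    case True
    have "\<not> ?f summable_on UNIV"
    proof
      assume s: "?f summable_on UNIV"
      have "?s n \<le> infsum ?f UNIV" for n
        unfolding psum_def by (rule finite_sum_le_infsum[OF s finite_short_lists]) (auto simp: contrib_nonneg)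
      then have "(SUP n. ennreal (?s n)) \<le> ennreal (infsum ?f UNIV)"
        by (intro SUP_least ennreal_leI)
      from le_less_trans[OF this ennreal_less_top] True show False by (metis infinity_ennreal_def less_irrefl)
    qed
    then show ?thesis unfolding True by (simp add: stit_surface_contrib infsum_not_exists)
  next
    case False
    then obtain C where C: "(SUP n. ennreal (?s n)) = ennreal C" "0 \<le> C"
      by (cases "SUP n. ennreal (?s n)") auto
    have sC: "?s n \<le> C" for n
      using SUP_upper[of n UNIV "\<lambda>n. ennreal (?s n)"] C by (simp add: ennreal_le_iff)
    have FC: "sum ?f F \<le> C" if "finite F" for F
    proof -
      have "sum ?f F \<le> ?s (Suc (Max (length ` F)))"
        unfolding psum_def by (intro sum_mono2 finite_short_lists contrib_nonneg sub[OF that])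
      with sC[of "Suc (Max (length ` F))"] show ?thesis by simp
    qed
    have summ: "?f summable_on UNIV"
      by (rule nonneg_bdd_above_summable_on) (auto simp: contrib_nonneg bdd_above_def intro!: exI[of _ C] FC)
    have "infsum ?f UNIV \<le> C" by (rule infsum_le_finite_sums[OF summ]) (simp add: FC)
    moreover have "C \<le> infsum ?f UNIV"
    proof -
      have "?s n \<le> infsum ?f UNIV" for n
        unfolding psum_def by (rule finite_sum_le_infsum[OF summ finite_short_lists]) (auto simp: contrib_nonneg)
      then have "(SUP n. ennreal (?s n)) \<le> ennreal (infsum ?f UNIV)"
        by (intro SUP_least ennreal_leI)
      then show ?thesis using C by (simp add: ennreal_le_iff infsum_nonneg contrib_nonneg)
    qed
    ultimately show ?thesis using C by (simp add: stit_surface_contrib)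
  qed
qed

lemma measurable_stit_surface [measurable]: "stit_surface d t a b \<in> borel_measurable Omega"
  unfolding stit_surface_SUP[abs_def] by measurable

text \<open>\<open>flaws = 0\<close> is the almost sure event that no cell of the first generations degenerates.\<close>

definition flaw :: "nat \<Rightarrow> real \<Rightarrow> (nat \<Rightarrow> real) \<Rightarrow> (nat \<Rightarrow> real) \<Rightarrow> real \<Rightarrow> real \<times> real \<Rightarrow> real" where
  "flaw d R a b t x = (if 0 \<le> fst x \<and> fst (split_hyp d a b (snd x)) < d
     \<and> a (fst (split_hyp d a b (snd x))) \<le> snd (split_hyp d a b (snd x))
     \<and> snd (split_hyp d a b (snd x)) \<le> b (fst (split_hyp d a b (snd x)))
     \<and> cell d R a (upper d a b x) \<and> cell d R (lower d a b x) b then 0 else 1)"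

definition flaws :: "nat \<Rightarrow> real \<Rightarrow> nat \<Rightarrow> (nat \<Rightarrow> real) \<Rightarrow> (nat \<Rightarrow> real) \<Rightarrow> real \<Rightarrow> (bool list \<Rightarrow> real \<times> real) \<Rightarrow> real" where
  "flaws d R = stree d True (\<lambda>_ _ _ _. 0) (flaw d R)"

lemma measurable_flaw [measurable (raw)]:
  assumes [measurable]: "f \<in> N \<rightarrow>\<^sub>M corner" "g \<in> N \<rightarrow>\<^sub>M corner" "h \<in> borel_measurable N" "k \<in> N \<rightarrow>\<^sub>M borel \<Otimes>\<^sub>M borel"
  shows "(\<lambda>x. flaw d R (f x) (g x) (h x) (k x)) \<in> borel_measurable N"
proof -
  have cellm: "Measurable.pred N (\<lambda>x. cell d R (f' x) (g' x))"
    if [measurable]: "f' \<in> N \<rightarrow>\<^sub>M corner" "g' \<in> N \<rightarrow>\<^sub>M corner" for f' g'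
  proof -
    have "Measurable.pred N (\<lambda>x. \<forall>j\<in>{..<d}. 0 \<le> f' x j \<and> f' x j < g' x j \<and> g' x j \<le> R)"
      by (rule pred_intros_finite) measurable
    then show ?thesis by (simp add: cell_def)
  qed
  have [measurable]: "Measurable.pred N (\<lambda>x. cell d R (f x) (upper d (f x) (g x) (k x)))"
    "Measurable.pred N (\<lambda>x. cell d R (lower d (f x) (g x) (k x)) (g x))"
    by (rule cellm; measurable)+
  show ?thesis unfolding flaw_def by measurable
qed

lemma measurable_flaws [measurable]: "flaws d R n a b t \<in> borel_measurable Omega"
  unfolding flaws_def by (rule measurable_stree[OF _ measurable_flaw]) auto

lemma flaws_nonneg: "0 \<le> flaws d R n a b t \<omega>"
  unfolding flaws_def
proof (induction n arbitrary: a b t \<omega>)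
  case (Suc n)
  have "0 \<le> flaw d R a b t (\<omega> [])" by (simp add: flaw_def)
  then show ?case unfolding stree.simps using Suc by (simp add: add_nonneg_nonneg)
qed simp

lemma AE_flaws:
  assumes "cell d R a b" "0 < d"
  shows "AE \<omega> in Omega. flaws d R n a b t \<omega> = 0"
  using assms
proof (induction n arbitrary: a b t)
  case 0 then show ?case by (simp add: flaws_def)
next
  case (Suc n)
  have [measurable]: "(\<lambda>u. split_hyp d a b u) \<in> borel \<rightarrow>\<^sub>M count_space UNIV \<Otimes>\<^sub>M borel"
    by (intro measurable_split_hyp measurable_const) auto
  have nonneg: "AE x in mark_law. 0 \<le> fst x"
    by (rule AE_mark_law_fst[OF AE_expo_nonneg]) measurable
  have inside: "AE x in mark_law. fst (split_hyp d a b (snd x)) < d \<and> a (fst (split_hyp d a b (snd x))) < snd (split_hyp d a b (snd x))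
    \<and> snd (split_hyp d a b (snd x)) < b (fst (split_hyp d a b (snd x)))"
    by (rule AE_mark_law_snd[OF AE_split_hyp[OF Suc.prems]]) measurable
  show ?case
  proof (rule AE_Omega_graftI)
    show "Measurable.pred Omega (\<lambda>\<omega>. flaws d R (Suc n) a b t \<omega> = 0)" by measurable
    show "AE x in mark_law. AE l in Omega. AE r in Omega. flaws d R (Suc n) a b t (graft x l r) = 0"
      using AE_cell_children[OF Suc.prems] nonneg inside
    proof eventually_elim
      case (elim x)
      have fl: "flaw d R a b t x = 0" using elim by (simp add: flaw_def)
      have L: "AE l in Omega. flaws d R n a (upper d a b x) (t - life d a b x) l = 0"
        and R: "AE r in Omega. flaws d R n (lower d a b x) b (t - life d a b x) r = 0"
        using elim Suc.prems by (auto intro: Suc.IH)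
      from L show ?case
      proof eventually_elim
        case (elim l)
        from R show ?case
          by eventually_elim (use elim fl in \<open>simp add: flaws_def\<close>)
      qed
    qed
  qed
qed

lemma flaws_SucD:
  assumes "flaws d R (Suc n) a b t \<omega> = 0"
  shows "0 \<le> fst (\<omega> [])" "fst (split_hyp d a b (snd (\<omega> []))) < d"
    "a (fst (split_hyp d a b (snd (\<omega> [])))) \<le> snd (split_hyp d a b (snd (\<omega> [])))"
    "snd (split_hyp d a b (snd (\<omega> []))) \<le> b (fst (split_hyp d a b (snd (\<omega> []))))"
    "cell d R a (upper d a b (\<omega> []))" "cell d R (lower d a b (\<omega> [])) b"
    "flaws d R n a (upper d a b (\<omega> [])) (t - life d a b (\<omega> [])) (\<lambda>v. \<omega> (False # v)) = 0"
    "flaws d R n (lower d a b (\<omega> [])) b (t - life d a b (\<omega> [])) (\<lambda>v. \<omega> (True # v)) = 0"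
proof -
  have "flaw d R a b t (\<omega> []) + (flaws d R n a (upper d a b (\<omega> [])) (t - life d a b (\<omega> [])) (\<lambda>v. \<omega> (False # v))
      + flaws d R n (lower d a b (\<omega> [])) b (t - life d a b (\<omega> [])) (\<lambda>v. \<omega> (True # v))) = 0"
    using assms by (simp add: flaws_def)
  moreover have "0 \<le> flaw d R a b t (\<omega> [])" by (simp add: flaw_def)
  ultimately have *: "flaw d R a b t (\<omega> []) = 0"
    "flaws d R n a (upper d a b (\<omega> [])) (t - life d a b (\<omega> [])) (\<lambda>v. \<omega> (False # v)) = 0"
    "flaws d R n (lower d a b (\<omega> [])) b (t - life d a b (\<omega> [])) (\<lambda>v. \<omega> (True # v)) = 0"
    using flaws_nonneg[of d R n a "upper d a b (\<omega> [])" "t - life d a b (\<omega> [])" "\<lambda>v. \<omega> (False # v)"]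
      flaws_nonneg[of d R n "lower d a b (\<omega> [])" b "t - life d a b (\<omega> [])" "\<lambda>v. \<omega> (True # v)"]
    by linarith+
  show "flaws d R n a (upper d a b (\<omega> [])) (t - life d a b (\<omega> [])) (\<lambda>v. \<omega> (False # v)) = 0"
    "flaws d R n (lower d a b (\<omega> [])) b (t - life d a b (\<omega> [])) (\<lambda>v. \<omega> (True # v)) = 0"
    by fact+
  show "0 \<le> fst (\<omega> [])" "fst (split_hyp d a b (snd (\<omega> []))) < d"
    "a (fst (split_hyp d a b (snd (\<omega> [])))) \<le> snd (split_hyp d a b (snd (\<omega> [])))"
    "snd (split_hyp d a b (snd (\<omega> []))) \<le> b (fst (split_hyp d a b (snd (\<omega> []))))"
    "cell d R a (upper d a b (\<omega> []))" "cell d R (lower d a b (\<omega> [])) b"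
    using *(1) by (auto simp: flaw_def split: if_splits)
qed

definition surf :: "nat \<Rightarrow> nat \<Rightarrow> (nat \<Rightarrow> real) \<Rightarrow> (nat \<Rightarrow> real) \<Rightarrow> real \<Rightarrow> (bool list \<Rightarrow> real \<times> real) \<Rightarrow> real" where
  "surf d = stree d False (\<lambda>_ _ _ _. 0) (\<lambda>a b t x. if life d a b x \<le> t then area d a b x else 0)"

lemma surf_neg:
  assumes "cell d R a b" "0 < d" "flaws d R n a b s \<omega> = 0" "t < 0"
  shows "surf d n a b t \<omega> = 0"
proof (cases n)
  case 0 then show ?thesis by (simp add: surf_def)
next
  case (Suc m)
  have "0 \<le> life d a b (\<omega> [])"
    using flaws_SucD(1)[of d R m a b s \<omega>] assms Suc lam_pos[OF assms(1,2)] by (simp add: life_def)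
  then have "\<not> life d a b (\<omega> []) \<le> t" using assms(4) by simp
  then show ?thesis by (simp add: surf_def Suc)
qed

text \<open>\<open>psum\<close> tests the absolute death time of every node, while
  \<open>surf\<close> counts the remaining time down and prunes at the first node that outlives it.
  Without flaws lifetimes are nonnegative, so the descendants of a pruned node die too late and
  contribute 0 (\<open>surf_neg\<close>).\<close>

lemma psum_eq_surf:
  assumes "cell d R a b" "0 < d" "flaws d R n a b s (\<lambda>v. \<omega> (pre @ v)) = 0"
  shows "psum d t \<omega> pre a b \<tau> n = surf d n a b (t - \<tau>) (\<lambda>v. \<omega> (pre @ v))"
  using assms
proof (induction n arbitrary: a b s pre \<tau>)
  case 0 then show ?case by (simp add: psum_def surf_def)
next
  case (Suc n)
  note c = Suc.prems(1) and d = Suc.prems(2)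
  note fl = flaws_SucD[OF Suc.prems(3), simplified]
  define \<tau>' where "\<tau>' = \<tau> + fst (\<omega> pre) / hitl d a b"
  have \<tau>': "t - \<tau>' = (t - \<tau>) - life d a b (\<omega> pre)"
    by (simp add: \<tau>'_def hitl_cell[OF c] life_def)
  define H where "H = split_hyp d a b (snd (\<omega> pre))"
  have "facet_meas d a b (fst H, snd H) = facet d a b (fst H)"
    using fl unfolding H_def by (intro facet_meas_cell[OF c]) auto
  then have Nil: "contrib d t \<omega> pre a b \<tau> [] = (if life d a b (\<omega> pre) \<le> t - \<tau> then area d a b (\<omega> pre) else 0)"
    using \<tau>' by (auto simp: contrib_Nil area_def H_def \<tau>'_def[symmetric])
  have L: "psum d t \<omega> (pre @ [False]) a (upper d a b (\<omega> pre)) \<tau>' n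
      = surf d n a (upper d a b (\<omega> pre)) (t - \<tau>') (\<lambda>v. \<omega> ((pre @ [False]) @ v))"
    by (rule Suc.IH[OF fl(5) d]) (use fl(7) in simp)
  have R: "psum d t \<omega> (pre @ [True]) (lower d a b (\<omega> pre)) b \<tau>' n
      = surf d n (lower d a b (\<omega> pre)) b (t - \<tau>') (\<lambda>v. \<omega> ((pre @ [True]) @ v))"
    by (rule Suc.IH[OF fl(6) d]) (use fl(8) in simp)
  show ?case
  proof (cases "life d a b (\<omega> pre) \<le> t - \<tau>")
    case True
    then show ?thesis
      unfolding psum_Suc \<tau>'_def[symmetric] L R Nil by (simp add: surf_def \<tau>')
  next
    case False
    then have "t - \<tau>' < 0" using \<tau>' by simp
    then have "surf d n a (upper d a b (\<omega> pre)) (t - \<tau>') (\<lambda>v. \<omega> ((pre @ [False]) @ v)) = 0"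
      "surf d n (lower d a b (\<omega> pre)) b (t - \<tau>') (\<lambda>v. \<omega> ((pre @ [True]) @ v)) = 0"
      using surf_neg[OF fl(5) d fl(7), of "t - \<tau>'"] surf_neg[OF fl(6) d fl(8), of "t - \<tau>'"] by simp_all
    then show ?thesis
      using False unfolding psum_Suc \<tau>'_def[symmetric] L R Nil by (simp add: surf_def)
  qed
qed

section \<open>Scaling to the unit cube and the martingale decomposition\<close>

lemma split_hyp_scale:
  assumes "0 < R"
  shows "split_hyp d (\<lambda>j. R * a j) (\<lambda>j. R * b j) u = (fst (split_hyp d a b u), R * snd (split_hyp d a b u))"
proof -
  have s: "(\<Sum>j\<in>A. R * b j - R * a j) = R * (\<Sum>j\<in>A. b j - a j)" for A
    by (simp add: sum_distrib_left algebra_simps)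
  have e: "u * (R * x) \<le> R * y \<longleftrightarrow> u * x \<le> y" for x y
  proof -
    have "u * (R * x) = R * (u * x)" by simp
    then show ?thesis using assms by (simp only: mult_le_cancel_left_pos)
  qed
  show ?thesis unfolding split_hyp_def Let_def s e by (simp add: algebra_simps)
qed

text \<open>Enlarging by \<open>R\<close> multiplies \<open>lam\<close> by R, hence divides
  lifetimes by R, and multiplies facet areas by R^(d-1), while the same marks select corresponding
  splits. The scaling therefore holds pathwise and not only in law.\<close>

lemma surf_scale:
  assumes "0 < R" "0 < d" "flaws d 1 n a b s \<omega> = 0"
  shows "surf d n (\<lambda>j. R * a j) (\<lambda>j. R * b j) t \<omega> = R ^ (d - 1) * surf d n a b (R * t) \<omega>"
  using assms(3)
proof (induction n arbitrary: a b s t \<omega>)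
  case 0 then show ?case by (simp add: surf_def)
next
  case (Suc n)
  note fl = flaws_SucD[OF Suc.prems]
  let ?a = "\<lambda>j. R * a j" and ?b = "\<lambda>j. R * b j" and ?x = "\<omega> []"
  have lam: "lam d ?a ?b = R * lam d a b"
    by (simp add: lam_def sum_distrib_left algebra_simps)
  have life: "life d ?a ?b ?x = life d a b ?x / R" by (simp add: life_def lam mult.commute)
  have le: "life d ?a ?b ?x \<le> t \<longleftrightarrow> life d a b ?x \<le> R * t"
    using assms(1) by (simp add: life field_simps)
  have t: "R * (t - life d ?a ?b ?x) = R * t - life d a b ?x"
    using assms(1) by (simp add: life algebra_simps)
  have up: "upper d ?a ?b ?x = (\<lambda>j. R * upper d a b ?x j)" "lower d ?a ?b ?x = (\<lambda>j. R * lower d a b ?x j)"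
    unfolding upper_def lower_def split_hyp_scale[OF assms(1)] by (auto simp: fun_eq_iff)
  have area: "area d ?a ?b ?x = R ^ (d - 1) * area d a b ?x"
  proof -
    have "(\<Prod>j\<in>{..<d} - {fst (split_hyp d a b (snd ?x))}. R * b j - R * a j)
      = (\<Prod>j\<in>{..<d} - {fst (split_hyp d a b (snd ?x))}. R * (b j - a j))" by (simp add: algebra_simps)
    also have "\<dots> = R ^ (d - 1) * (\<Prod>j\<in>{..<d} - {fst (split_hyp d a b (snd ?x))}. b j - a j)"
      using fl(2) by (simp add: prod.distrib)
    finally show ?thesis unfolding area_def facet_def split_hyp_scale[OF assms(1)] by simp
  qed
  show ?case
    using Suc.IH[OF fl(7), of "t - life d ?a ?b ?x"] Suc.IH[OF fl(8), of "t - life d ?a ?b ?x"]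
    unfolding t surf_def stree.simps by (simp add: le area up distrib_left)
qed

text \<open>The total drift is used up along the tree: by conservation of volume, what a cell does
  not consume while it lives passes to its children, and what reaches generation \<open>n\<close> is
  \<open>rest\<close>.\<close>

lemma surf_eq_mart:
  assumes "flaws d 1 n a b s \<omega> = 0"
  shows "surf d n a b t \<omega> = mart d False n a b t \<omega> + real d * vol d a b * t - rest d n a b t \<omega>"
  using assms
proof (induction n arbitrary: a b s t \<omega>)
  case 0 then show ?case by (simp add: surf_def mart_def rest_def)
next
  case (Suc n)
  note fl = flaws_SucD[OF Suc.prems]
  note v = vol_children[OF fl(2)]
  show ?case
    using Suc.IH[OF fl(7), of "t - life d a b (\<omega> [])"] Suc.IH[OF fl(8), of "t - life d a b (\<omega> [])"]
    unfolding surf_def mart_def rest_def stree.simps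
    by (simp add: compens_def v[symmetric] algebra_simps)
qed

subsection \<open>Convergence as the window grows\<close>

abbreviation unit_mart :: "nat \<Rightarrow> bool \<Rightarrow> nat \<Rightarrow> real \<Rightarrow> (bool list \<Rightarrow> real \<times> real) \<Rightarrow> real" where
  "unit_mart d z n \<equiv> mart d z n (\<lambda>_. 0) (\<lambda>_. 1)"

lemma cell_unit: "0 < R \<Longrightarrow> cell d R (\<lambda>_. 0) (\<lambda>_. R)"
  by (simp add: cell_def)

lemma vol_unit: "vol d (\<lambda>_. 0) (\<lambda>_. 1) = 1" and lam_unit: "lam d (\<lambda>_. 0) (\<lambda>_. 1) = real d"
  by (simp_all add: vol_def lam_def)

lemma (in prob_space) nn_integral_abs_le_sqrt:
  fixes f :: "'a \<Rightarrow> real"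
  assumes [measurable]: "f \<in> borel_measurable M" and le: "(\<integral>\<^sup>+x. ennreal ((f x)\<^sup>2) \<partial>M) \<le> ennreal c" and c: "0 \<le> c"
  shows "(\<integral>\<^sup>+x. ennreal \<bar>f x\<bar> \<partial>M) \<le> ennreal (sqrt c)"
proof -
  have fin: "(\<integral>\<^sup>+x. ennreal ((f x)\<^sup>2) \<partial>M) < \<infinity>" using le by (simp add: le_less_trans)
  note i = integrable_of_square[OF assms(1) fin]
  define m where "m = (\<integral>x. \<bar>f x\<bar> \<partial>M)"
  have "(\<integral>x. (f x)\<^sup>2 \<partial>M) \<le> c"
    using le c i(1) by (simp add: nn_integral_eq_integral)
  moreover have "0 \<le> (\<integral>x. (f x)\<^sup>2 \<partial>M) - 2 * m * m + m\<^sup>2"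
  proof -
    have "0 \<le> (\<integral>x. (\<bar>f x\<bar> - m)\<^sup>2 \<partial>M)" by simp
    also have "\<dots> = (\<integral>x. (f x)\<^sup>2 - 2 * m * \<bar>f x\<bar> + m\<^sup>2 \<partial>M)"
      by (simp add: power2_diff algebra_simps)
    also have "\<dots> = (\<integral>x. (f x)\<^sup>2 \<partial>M) - 2 * m * m + m\<^sup>2"
      using i by (simp add: prob_space m_def)
    finally show ?thesis .
  qed
  ultimately have "m\<^sup>2 \<le> c" by (simp add: power2_eq_square)
  then have "m \<le> sqrt c" by (rule real_le_rsqrt)
  moreover have "(\<integral>\<^sup>+x. ennreal \<bar>f x\<bar> \<partial>M) = ennreal m"
    unfolding m_def using i by (intro nn_integral_eq_integral) auto
  ultimately show ?thesis by (simp add: ennreal_leI)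
qed

text \<open>The bound for the squared L2 error of dropping the generations from \<open>n\<close> on;
  \<open>tail_energy d 0\<close> turns out to be the variance of the limit.\<close>

definition tail_energy :: "nat \<Rightarrow> nat \<Rightarrow> real" where
  "tail_energy d n = enn2real (pair_int d (kern (real d) n) (\<lambda>_. 0) (\<lambda>_. 1))"

lemma tail_energy:
  assumes "2 < d"
  shows "pair_int d (kern (real d) n) (\<lambda>_. 0) (\<lambda>_. 1) = ennreal (tail_energy d n)"
  unfolding tail_energy_def using pair_int_kern_finite[OF assms cell_unit[of 1], of n] by simp

lemma tail_energy_nonneg: "0 \<le> tail_energy d n"
  by (simp add: tail_energy_def)

lemma tail_energy_tendsto_0: "2 < d \<Longrightarrow> tail_energy d \<longlonglongrightarrow> 0"
  using pair_int_kern_tendsto_0[where D = "real d" and d = d and a = "\<lambda>_. 0" and b = "\<lambda>_. 1"]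
    pair_int_kern_finite[of d "\<lambda>_. 0" "\<lambda>_. 1" 0] cell_unit[of 1 d]
  by (simp add: lam_unit tail_energy tail_energy_nonneg ennreal_tendsto_0_iff)

lemma incr_sq_le:
  assumes "2 < d" "z \<or> 0 \<le> t"
  shows "moment2 (\<lambda>\<omega>. unit_mart d z (n + k) t \<omega> - unit_mart d z n t \<omega>) \<le> ennreal (tail_energy d n)"
  using incr_moments[OF assms(1) cell_unit[of 1] assms(2), of k n]
  by (simp add: mart_add tail_energy[OF assms(1)])

lemma incr_abs_le:
  assumes "2 < d" "z \<or> 0 \<le> t"
  shows "moment1 (\<lambda>\<omega>. unit_mart d z (n + k) t \<omega> - unit_mart d z n t \<omega>) \<le> ennreal (sqrt (tail_energy d n))"
proof -
  interpret O: prob_space Omega by (rule prob_space_Omega)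
  show ?thesis
    by (rule O.nn_integral_abs_le_sqrt[OF _ incr_sq_le[OF assms] tail_energy_nonneg]) measurable
qed

definition centered :: "nat \<Rightarrow> real \<Rightarrow> (bool list \<Rightarrow> real \<times> real) \<Rightarrow> real" where
  "centered d R \<omega> = R powr (- (real d - 1)) *
        (stit_surface d 1 (\<lambda>_. 0) (\<lambda>_. R) \<omega> - integral\<^sup>L Omega (stit_surface d 1 (\<lambda>_. 0) (\<lambda>_. R)))"

lemma measurable_centered [measurable]: "centered d R \<in> borel_measurable Omega"
  unfolding centered_def[abs_def] by measurable

lemma integrable_mart:
  assumes "2 < d" "z \<or> 0 \<le> t" shows "integrable Omega (unit_mart d z n t)"
proof -
  interpret O: prob_space Omega by (rule prob_space_Omega)
  have "moment2 (unit_mart d z n t) < \<infinity>"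
    using mart_moments[OF assms(1) cell_unit[of 1] assms(2), of n] tail_energy[OF assms(1), of 0]
    by (auto intro: le_less_trans)
  then show ?thesis by (intro O.integrable_of_square(2)) measurable
qed

text \<open>At fixed \<open>R\<close> the partial sums increase to the surface and the drift left to
  late generations decays geometrically, so the mean surface is exactly d R^d. The distance to the
  martingale then splits into the rescaled area still missing from the partial sum and the residual
  drift, each of mean at most d R q^n.\<close>

lemma centered_tendsto_mart:
  assumes d: "2 < d" and R: "0 < R"
  shows "(\<lambda>n. \<integral>\<^sup>+\<omega>. ennreal \<bar>centered d R \<omega> - unit_mart d False n R \<omega>\<bar> \<partial>Omega) \<longlonglongrightarrow> 0"
proof -
  interpret O: prob_space Omega by (rule prob_space_Omega)
  define c where "c = R ^ (d - 1)"
  have c: "0 < c" using R by (simp add: c_def)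
  have cR: "R powr (- (real d - 1)) = 1 / c"
  proof -
    have "c = R powr (real d - 1)"
      using powr_realpow[OF R, of "d - 1"] d by (simp add: c_def of_nat_diff)
    then show ?thesis by (simp only: powr_minus_divide)
  qed
  define p where "p n \<omega> = psum d 1 \<omega> [] (\<lambda>_. 0) (\<lambda>_. R) 0 n" for n \<omega>
  define S where "S \<omega> = (SUP n. ennreal (p n \<omega>))" for \<omega>
  define T where "T = stit_surface d 1 (\<lambda>_. 0) (\<lambda>_. R)"
  define M where "M n = unit_mart d False n R" for n
  define Q where "Q n = rest d n (\<lambda>_. 0) (\<lambda>_. 1) R" for n
  have [measurable]: "p n \<in> borel_measurable Omega" "T \<in> borel_measurable Omega"
    "M n \<in> borel_measurable Omega" "Q n \<in> borel_measurable Omega" for n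
    unfolding p_def[abs_def] T_def M_def Q_def by measurable
  have TS: "T \<omega> = enn2real (S \<omega>)" for \<omega>
    by (simp add: T_def S_def p_def stit_surface_SUP)
  have p0: "0 \<le> p n \<omega>" for n \<omega> by (simp add: p_def psum_nonneg)
  have fl: "AE \<omega> in Omega. flaws d R n (\<lambda>_. 0) (\<lambda>_. R) 0 \<omega> = 0 \<and> flaws d 1 n (\<lambda>_. 0) (\<lambda>_. 1) 0 \<omega> = 0" for n
    using AE_flaws[OF cell_unit[OF R], of d n 0] AE_flaws[OF cell_unit[of 1], of d n 0] d by auto
  have AEp: "AE \<omega> in Omega. p n \<omega> = c * (M n \<omega> + real d * R - Q n \<omega>)" for n
    using fl[of n]
  proof eventually_elim
    case (elim \<omega>)
    have "p n \<omega> = surf d n (\<lambda>_. 0) (\<lambda>_. R) 1 \<omega>"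
      using psum_eq_surf[OF cell_unit[OF R], of d n 0 \<omega> "[]" 1 0] elim d by (simp add: p_def)
    also have "\<dots> = c * surf d n (\<lambda>_. 0) (\<lambda>_. 1) R \<omega>"
      using surf_scale[OF R, of d n "\<lambda>_. 0" "\<lambda>_. 1" 0 \<omega> 1] elim d by (simp add: c_def)
    also have "surf d n (\<lambda>_. 0) (\<lambda>_. 1) R \<omega> = M n \<omega> + real d * R - Q n \<omega>"
      using elim by (subst surf_eq_mart) (auto simp: M_def Q_def vol_unit)
    finally show ?case .
  qed
  \<comment> \<open>Bounds the probability that a cell of the unit cube splits before time
    \<open>R\<close>; it is below 1 but tends to 1 as \<open>R\<close> grows.\<close>
  define q where "q = 1 - exp (- real d * R)"
  have q: "0 \<le> q" "q < 1" using d R by (simp_all add: q_def)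
  have Qle: "moment1 (Q n) \<le> ennreal (real d * R * q ^ n)" for n
    using rest_bound[OF _ cell_unit[of 1], of d R n] d R by (simp add: Q_def q_def vol_unit)
  have Qint: "integrable Omega (Q n)" for n
    by (rule integrableI_bounded) (use le_less_trans[OF Qle[of n]] in auto)
  have Mint: "integrable Omega (M n)" for n unfolding M_def using integrable_mart[OF d] R by simp
  have M0: "(\<integral>\<omega>. M n \<omega> \<partial>Omega) = 0" for n
    unfolding M_def using mart_moments[OF d cell_unit[of 1], of False R n] R by simp
  have pint: "integrable Omega (p n)" for n
  proof -
    have "integrable Omega (\<lambda>\<omega>. c * (M n \<omega> + real d * R - Q n \<omega>))" using Mint Qint by simp
    then show ?thesis using AEp[of n] by (subst integrable_cong_AE) auto
  qed
  define \<rho> where "\<rho> n = (\<integral>\<omega>. Q n \<omega> \<partial>Omega)" for n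
  have Ep: "(\<integral>\<omega>. p n \<omega> \<partial>Omega) = c * (real d * R - \<rho> n)" for n
  proof -
    have "(\<integral>\<omega>. p n \<omega> \<partial>Omega) = (\<integral>\<omega>. c * (M n \<omega> + real d * R - Q n \<omega>) \<partial>Omega)"
      using AEp[of n] by (intro integral_cong_AE) auto
    also have "\<dots> = c * (real d * R - \<rho> n)"
      using Mint Qint M0 by (simp add: \<rho>_def O.prob_space[simplified])
    finally show ?thesis .
  qed
  have \<rho>: "\<bar>\<rho> n\<bar> \<le> real d * R * q ^ n" for n
  proof -
    have "ennreal \<bar>\<rho> n\<bar> \<le> ennreal (\<integral>\<omega>. \<bar>Q n \<omega>\<bar> \<partial>Omega)"
      unfolding \<rho>_def by (intro ennreal_leI integral_abs_bound)
    also have "\<dots> = moment1 (Q n)"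
      using Qint[of n] by (intro nn_integral_eq_integral[symmetric]) auto
    finally have "ennreal \<bar>\<rho> n\<bar> \<le> ennreal (real d * R * q ^ n)" using Qle[of n] by (rule order_trans)
    then show ?thesis using q R by (simp add: ennreal_le_iff)
  qed
  have qlim: "(\<lambda>n. real d * R * q ^ n) \<longlonglongrightarrow> 0"
    using q by (intro tendsto_mult_right_zero LIMSEQ_power_zero) simp
  have \<rho>lim: "\<rho> \<longlonglongrightarrow> 0"
    by (rule Lim_null_comparison[OF _ qlim]) (simp add: \<rho>)
  have inc: "incseq (\<lambda>n \<omega>. ennreal (p n \<omega>))"
    by (auto simp: incseq_def le_fun_def p_def intro!: ennreal_leI psum_mono)
  \<comment> \<open>The limit of the means is identified twice, by monotone convergence and through
    \<open>Ep\<close> with vanishing residual drift; this gives the mean of the supremum.\<close>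
  have "(\<lambda>n. \<integral>\<^sup>+\<omega>. ennreal (p n \<omega>) \<partial>Omega) \<longlonglongrightarrow> (\<integral>\<^sup>+\<omega>. S \<omega> \<partial>Omega)"
    unfolding S_def
    by (subst nn_integral_monotone_convergence_SUP[OF inc])
      (auto intro!: LIMSEQ_SUP incseq_nn_integral inc)
  moreover have "(\<lambda>n. \<integral>\<^sup>+\<omega>. ennreal (p n \<omega>) \<partial>Omega) \<longlonglongrightarrow> ennreal (c * (real d * R - 0))"
  proof -
    have "(\<integral>\<^sup>+\<omega>. ennreal (p n \<omega>) \<partial>Omega) = ennreal (c * (real d * R - \<rho> n))" for n
      using pint by (subst nn_integral_eq_integral) (auto simp: Ep p0)
    then show ?thesis by (simp only:) (intro tendsto_ennrealI tendsto_mult tendsto_diff tendsto_const \<rho>lim)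
  qed
  ultimately have ES: "(\<integral>\<^sup>+\<omega>. S \<omega> \<partial>Omega) = ennreal (c * (real d * R))"
    by (metis LIMSEQ_unique diff_zero)
  have [measurable]: "S \<in> borel_measurable Omega" unfolding S_def[abs_def] by measurable
  \<comment> \<open>A finite mean excludes an infinite supremum almost surely, so the conventional
    value 0 that \<open>T\<close> would take there is harmless.\<close>
  have "AE \<omega> in Omega. S \<omega> \<noteq> \<infinity>" by (rule nn_integral_PInf_AE) (auto simp: ES)
  then have AET: "AE \<omega> in Omega. ennreal (T \<omega>) = S \<omega>"
    by eventually_elim (simp add: TS less_top)
  have T0: "0 \<le> T \<omega>" for \<omega> by (simp add: TS)
  have nT: "(\<integral>\<^sup>+\<omega>. ennreal (T \<omega>) \<partial>Omega) = ennreal (c * (real d * R))"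
    using AET ES by (subst nn_integral_cong_AE[of _ S]) auto
  have Tint: "integrable Omega T" by (rule integrableI_nonneg) (auto simp: T0 nT)
  have ET: "(\<integral>\<omega>. T \<omega> \<partial>Omega) = c * (real d * R)"
    using nT c R by (subst integral_eq_nn_integral) (auto simp: T0)
  have pT: "AE \<omega> in Omega. p n \<omega> \<le> T \<omega>" for n
    using AET
  proof eventually_elim
    case (elim \<omega>)
    have "ennreal (p n \<omega>) \<le> S \<omega>" unfolding S_def by (rule SUP_upper) simp
    then have "ennreal (p n \<omega>) \<le> ennreal (T \<omega>)" by (simp only: elim)
    then show ?case by (simp add: ennreal_le_iff[OF T0])
  qed
  have bound: "moment1 (\<lambda>\<omega>. centered d R \<omega> - M n \<omega>) \<le> ennreal (2 * (real d * R * q ^ n))" for n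
  proof -
    have "moment1 (\<lambda>\<omega>. centered d R \<omega> - M n \<omega>)
      \<le> (\<integral>\<^sup>+\<omega>. ennreal ((T \<omega> - p n \<omega>) / c) + ennreal \<bar>Q n \<omega>\<bar> \<partial>Omega)"
    proof (rule nn_integral_mono_AE)
      show "AE \<omega> in Omega. ennreal \<bar>centered d R \<omega> - M n \<omega>\<bar> \<le> ennreal ((T \<omega> - p n \<omega>) / c) + ennreal \<bar>Q n \<omega>\<bar>"
        using AEp[of n] pT[of n]
      proof eventually_elim
        case (elim \<omega>)
        have "centered d R \<omega> = (T \<omega> - c * (real d * R)) / c"
          unfolding centered_def cR T_def[symmetric] ET by simp
        then have "centered d R \<omega> - M n \<omega> = (T \<omega> - p n \<omega>) / c - Q n \<omega>"
          using elim(1) c by (simp add: field_simps)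
        moreover have nn: "0 \<le> (T \<omega> - p n \<omega>) / c" using elim(2) c by simp
        ultimately have "\<bar>centered d R \<omega> - M n \<omega>\<bar> \<le> (T \<omega> - p n \<omega>) / c + \<bar>Q n \<omega>\<bar>" by linarith
        then have "ennreal \<bar>centered d R \<omega> - M n \<omega>\<bar> \<le> ennreal ((T \<omega> - p n \<omega>) / c + \<bar>Q n \<omega>\<bar>)"
          by (rule ennreal_leI)
        then show ?case by (simp only: ennreal_plus[OF nn abs_ge_zero])
      qed
    qed
    also have "\<dots> = (\<integral>\<^sup>+\<omega>. ennreal ((T \<omega> - p n \<omega>) / c) \<partial>Omega) + moment1 (Q n)"
      by (rule nn_integral_add) measurable
    also have "(\<integral>\<^sup>+\<omega>. ennreal ((T \<omega> - p n \<omega>) / c) \<partial>Omega) = ennreal (\<integral>\<omega>. (T \<omega> - p n \<omega>) / c \<partial>Omega)"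
      by (rule nn_integral_eq_integral) (use Tint pint pT[of n] c in auto)
    also have "(\<integral>\<omega>. (T \<omega> - p n \<omega>) / c \<partial>Omega) = \<rho> n"
      using Tint pint c by (simp add: ET Ep field_simps)
    also have "ennreal (\<rho> n) + moment1 (Q n)
        \<le> ennreal (real d * R * q ^ n) + ennreal (real d * R * q ^ n)"
      using \<rho>[of n] by (intro add_mono Qle ennreal_leI) auto
    also have "\<dots> = ennreal (2 * (real d * R * q ^ n))"
      using q R by (subst ennreal_plus[symmetric]) auto
    finally show ?thesis .
  qed
  have "(\<lambda>n. ennreal (2 * (real d * R * q ^ n))) \<longlonglongrightarrow> ennreal 0"
    using tendsto_mult_left[OF qlim, of 2] by (intro tendsto_ennrealI) simp
  then have lim: "(\<lambda>n. ennreal (2 * (real d * R * q ^ n))) \<longlonglongrightarrow> 0" by simp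
  show ?thesis
  proof (rule tendsto_sandwich[OF _ _ tendsto_const lim])
    show "\<forall>\<^sub>F n in sequentially. moment1 (\<lambda>\<omega>. centered d R \<omega> - unit_mart d False n R \<omega>)
        \<le> ennreal (2 * (real d * R * q ^ n))"
      by (intro always_eventually allI bound[unfolded M_def])
  qed simp
qed

text \<open>Triangle inequality through \<open>mart\<close> at n + k, with \<open>k\<close> tending
  to infinity. The increment bound is uniform in time and so yields an error uniform in
  \<open>R\<close>, whereas the geometric rate for fixed \<open>R\<close> degenerates as
  \<open>R\<close> grows.\<close>

lemma centered_mart_le:
  assumes d: "2 < d" and R: "0 < R"
  shows "moment1 (\<lambda>\<omega>. centered d R \<omega> - unit_mart d False n R \<omega>) \<le> ennreal (sqrt (tail_energy d n))"
proof -
  let ?D = "\<lambda>n. \<integral>\<^sup>+\<omega>. ennreal \<bar>centered d R \<omega> - unit_mart d False n R \<omega>\<bar> \<partial>Omega"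
  have "?D n \<le> ?D (n + k) + ennreal (sqrt (tail_energy d n))" for k
  proof -
    have "?D n \<le> (\<integral>\<^sup>+\<omega>. ennreal \<bar>centered d R \<omega> - unit_mart d False (n + k) R \<omega>\<bar>
       + ennreal \<bar>unit_mart d False (n + k) R \<omega> - unit_mart d False n R \<omega>\<bar> \<partial>Omega)"
      by (intro nn_integral_mono) (simp flip: ennreal_plus)
    also have "\<dots> = ?D (n + k) + moment1 (\<lambda>\<omega>. unit_mart d False (n + k) R \<omega> - unit_mart d False n R \<omega>)"
      by (rule nn_integral_add) measurable
    also have "\<dots> \<le> ?D (n + k) + ennreal (sqrt (tail_energy d n))"
      using R by (intro add_mono order_refl incr_abs_le[OF d]) simp
    finally show ?thesis .
  qed
  moreover have "(\<lambda>k. ?D (n + k) + ennreal (sqrt (tail_energy d n))) \<longlonglongrightarrow> 0 + ennreal (sqrt (tail_energy d n))"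
    using LIMSEQ_ignore_initial_segment[OF centered_tendsto_mart[OF d R], of n]
    by (intro tendsto_add tendsto_const) (simp add: add.commute)
  ultimately show ?thesis by (intro LIMSEQ_le_const[where X = "\<lambda>k. ?D (n + k) + ennreal (sqrt (tail_energy d n))"]) auto
qed

section \<open>Infinite horizon and characteristic functions\<close>

lemma mart_True_time: "mart d True n a b t \<omega> = mart d True n a b t' \<omega>"
proof (induction n arbitrary: a b t t' \<omega>)
  case 0 then show ?case by (simp add: mart_def)
next
  case (Suc n)
  show ?case
    using Suc[of a _ "t - life d a b (\<omega> [])" _ "t' - life d a b (\<omega> [])"]
      Suc[of _ b "t - life d a b (\<omega> [])" _ "t' - life d a b (\<omega> [])"]
    unfolding mart_def stree.simps by (simp add: compens_def)
qed

text \<open>For given marks there are only finitely many cells of generation below \<open>n\<close>;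
  once all of them have died, the horizon is no longer felt. The time \<open>N\<close> depends on
  \<omega>.\<close>

lemma mart_eventually: "\<exists>N. \<forall>t\<ge>N. mart d False n a b t \<omega> = mart d True n a b t \<omega>"
proof (induction n arbitrary: a b \<omega>)
  case 0 then show ?case by (simp add: mart_def)
next
  case (Suc n)
  define l where "l = life d a b (\<omega> [])"
  obtain N1 where N1: "\<And>t. t \<ge> N1 \<Longrightarrow> mart d False n a (upper d a b (\<omega> [])) t (\<lambda>v. \<omega> (False # v))
      = mart d True n a (upper d a b (\<omega> [])) t (\<lambda>v. \<omega> (False # v))"
    using Suc.IH by blast
  obtain N2 where N2: "\<And>t. t \<ge> N2 \<Longrightarrow> mart d False n (lower d a b (\<omega> [])) b t (\<lambda>v. \<omega> (True # v))
      = mart d True n (lower d a b (\<omega> [])) b t (\<lambda>v. \<omega> (True # v))"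
    using Suc.IH by blast
  show ?case
  proof (intro exI allI impI)
    fix t assume t: "t \<ge> max l (max (N1 + l) (N2 + l))"
    then show "mart d False (Suc n) a b t \<omega> = mart d True (Suc n) a b t \<omega>"
      using N1[of "t - l"] N2[of "t - l"]
      by (simp add: mart_def compens_def l_def)
  qed
qed

text \<open>exp(i x) is Lipschitz with constant 1, so an L1 distance controls the difference of
  characteristic functions.\<close>

lemma norm_char_diff:
  assumes [measurable]: "f \<in> borel_measurable Omega" "g \<in> borel_measurable Omega"
    and c: "0 \<le> c" and le: "moment1 (\<lambda>\<omega>. f \<omega> - g \<omega>) \<le> ennreal c"
  shows "norm ((CLINT \<omega>|Omega. iexp (t * f \<omega>)) - (CLINT \<omega>|Omega. iexp (t * g \<omega>))) \<le> \<bar>t\<bar> * c"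
proof -
  interpret O: prob_space Omega by (rule prob_space_Omega)
  have i: "integrable Omega (\<lambda>\<omega>. iexp (t * h \<omega>))" if [measurable]: "h \<in> borel_measurable Omega" for h
    by (rule O.integrable_const_bound[of _ 1]) auto
  have fg: "integrable Omega (\<lambda>\<omega>. f \<omega> - g \<omega>)"
    by (rule integrableI_bounded) (use le_less_trans[OF le] in auto)
  have e: "norm (iexp x - iexp y) \<le> \<bar>x - y\<bar>" for x y
  proof -
    have "iexp x - iexp y = iexp y * (iexp (x - y) - 1)"
      by (simp add: algebra_simps flip: exp_add)
    then have "norm (iexp x - iexp y) = norm (iexp (x - y) - 1)" by (simp add: norm_mult)
    also have "\<dots> \<le> \<bar>x - y\<bar>" using iexp_approx1[of "x - y" 0] by simp
    finally show ?thesis .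
  qed
  have "norm ((CLINT \<omega>|Omega. iexp (t * f \<omega>)) - (CLINT \<omega>|Omega. iexp (t * g \<omega>)))
    = norm (CLINT \<omega>|Omega. iexp (t * f \<omega>) - iexp (t * g \<omega>))"
    using i by (subst Bochner_Integration.integral_diff) auto
  also have "\<dots> \<le> (\<integral>\<omega>. norm (iexp (t * f \<omega>) - iexp (t * g \<omega>)) \<partial>Omega)"
    by (rule integral_norm_bound)
  also have "\<dots> \<le> (\<integral>\<omega>. \<bar>t\<bar> * \<bar>f \<omega> - g \<omega>\<bar> \<partial>Omega)"
  proof (rule integral_mono)
    show "norm (iexp (t * f \<omega>) - iexp (t * g \<omega>)) \<le> \<bar>t\<bar> * \<bar>f \<omega> - g \<omega>\<bar>" for \<omega>
      using e[of "t * f \<omega>" "t * g \<omega>"] by (simp add: abs_mult flip: right_diff_distrib)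
  qed (use i fg in auto)
  also have "\<dots> = \<bar>t\<bar> * (\<integral>\<omega>. \<bar>f \<omega> - g \<omega>\<bar> \<partial>Omega)" by simp
  also have "\<dots> \<le> \<bar>t\<bar> * c"
  proof (rule mult_left_mono)
    have "ennreal (\<integral>\<omega>. \<bar>f \<omega> - g \<omega>\<bar> \<partial>Omega) = moment1 (\<lambda>\<omega>. f \<omega> - g \<omega>)"
      using fg by (intro nn_integral_eq_integral[symmetric]) auto
    with le have "ennreal (\<integral>\<omega>. \<bar>f \<omega> - g \<omega>\<bar> \<partial>Omega) \<le> ennreal c" by (simp only:)
    then show "(\<integral>\<omega>. \<bar>f \<omega> - g \<omega>\<bar> \<partial>Omega) \<le> c" using c by (simp add: ennreal_le_iff)
  qed simp
  finally show ?thesis .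
qed

text \<open>An argument with e/3: truncating either side at generation \<open>n\<close> costs
  little, uniformly in \<open>R\<close>, and the truncated characteristic functions converge by
  dominated convergence, since for each \<omega> the truncations are eventually constant.\<close>

lemma char_centered_tendsto:
  assumes d: "2 < d" and Rs: "filterlim Rs at_top sequentially"
    and Z [measurable]: "Z \<in> borel_measurable Omega"
    and ZM: "\<And>n. moment1 (\<lambda>\<omega>. Z \<omega> - unit_mart d True n 0 \<omega>) \<le> ennreal (sqrt (tail_energy d n))"
  shows "(\<lambda>j. CLINT \<omega>|Omega. iexp (t * centered d (Rs j) \<omega>)) \<longlonglongrightarrow> (CLINT \<omega>|Omega. iexp (t * Z \<omega>))"
proof (rule tendstoI)
  interpret O: prob_space Omega by (rule prob_space_Omega)
  fix e :: real assume e: "0 < e"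
  define \<phi> where "\<phi> h = (CLINT \<omega>|Omega. iexp (t * h \<omega>))" for h :: "_ \<Rightarrow> real"
  have "(\<lambda>n. \<bar>t\<bar> * sqrt (tail_energy d n)) \<longlonglongrightarrow> \<bar>t\<bar> * sqrt 0"
    by (intro tendsto_mult tendsto_const tendsto_real_sqrt tail_energy_tendsto_0 d)
  then have "eventually (\<lambda>n. \<bar>t\<bar> * sqrt (tail_energy d n) < e / 3) sequentially"
    using e by (intro order_tendstoD(2)[where a = "e / 3"]) auto
  then obtain n where n: "\<bar>t\<bar> * sqrt (tail_energy d n) < e / 3"
    using eventually_sequentially by auto
  have s: "0 \<le> sqrt (tail_energy d n)" by (simp add: tail_energy_nonneg)
  have "(\<lambda>j. \<phi> (unit_mart d False n (Rs j))) \<longlonglongrightarrow> \<phi> (unit_mart d True n 0)"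
    unfolding \<phi>_def
  proof (rule integral_dominated_convergence[where w = "\<lambda>_. 1"])
    show "AE \<omega> in Omega. (\<lambda>j. iexp (t * unit_mart d False n (Rs j) \<omega>)) \<longlonglongrightarrow> iexp (t * unit_mart d True n 0 \<omega>)"
    proof (rule AE_I2)
      fix \<omega>
      obtain N where N: "\<And>t. t \<ge> N \<Longrightarrow> unit_mart d False n t \<omega> = unit_mart d True n t \<omega>"
        using mart_eventually by blast
      have "eventually (\<lambda>j. Rs j \<ge> N) sequentially"
        using Rs by (simp add: filterlim_at_top)
      then have "eventually (\<lambda>j. iexp (t * unit_mart d False n (Rs j) \<omega>) = iexp (t * unit_mart d True n 0 \<omega>)) sequentially"
      proof eventually_elim
        case (elim j)
        then show ?case using N[OF elim] mart_True_time[of d n "\<lambda>_. 0" "\<lambda>_. 1" "Rs j" \<omega> 0] by simp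
      qed
      then show "(\<lambda>j. iexp (t * unit_mart d False n (Rs j) \<omega>)) \<longlonglongrightarrow> iexp (t * unit_mart d True n 0 \<omega>)"
        by (rule tendsto_eventually)
    qed
  qed auto
  then have "eventually (\<lambda>j. dist (\<phi> (unit_mart d False n (Rs j))) (\<phi> (unit_mart d True n 0)) < e / 3) sequentially"
    using e by (intro tendstoD) auto
  moreover have "eventually (\<lambda>j. 0 < Rs j) sequentially"
    using Rs by (simp add: filterlim_at_top_dense)
  ultimately have "eventually (\<lambda>j. dist (\<phi> (centered d (Rs j))) (\<phi> Z) < e) sequentially"
  proof eventually_elim
    case (elim j)
    have "norm (\<phi> (centered d (Rs j)) - \<phi> (unit_mart d False n (Rs j))) \<le> \<bar>t\<bar> * sqrt (tail_energy d n)"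
      unfolding \<phi>_def by (rule norm_char_diff[OF _ _ s centered_mart_le[OF d elim(2)]]) auto
    moreover have "norm (\<phi> Z - \<phi> (unit_mart d True n 0)) \<le> \<bar>t\<bar> * sqrt (tail_energy d n)"
      unfolding \<phi>_def by (rule norm_char_diff[OF _ _ s ZM]) auto
    moreover have "dist (\<phi> (centered d (Rs j))) (\<phi> Z) \<le> dist (\<phi> (centered d (Rs j))) (\<phi> (unit_mart d False n (Rs j)))
      + dist (\<phi> (unit_mart d False n (Rs j))) (\<phi> (unit_mart d True n 0)) + dist (\<phi> Z) (\<phi> (unit_mart d True n 0))"
      using dist_triangle[of "\<phi> (centered d (Rs j))" "\<phi> Z" "\<phi> (unit_mart d False n (Rs j))"]
        dist_triangle2[of "\<phi> (unit_mart d False n (Rs j))" "\<phi> Z" "\<phi> (unit_mart d True n 0)"] by linarith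
    ultimately show ?case using elim n by (simp add: dist_norm)
  qed
  then show "eventually (\<lambda>j. dist (CLINT \<omega>|Omega. iexp (t * centered d (Rs j) \<omega>)) (CLINT \<omega>|Omega. iexp (t * Z \<omega>)) < e) sequentially"
    by (simp add: \<phi>_def)
qed

subsection \<open>The limit law\<close>

text \<open>In the unit cube the drift rate is \<open>d\<close> and the lifetime e/d, so the drift
  of the root is just \<open>e\<close>. The split and the children are determined by
  \<open>u\<close>, and \<open>Suc n\<close> ensures that the root term is counted.\<close>

lemma unit_mart_root:
  "unit_mart d True (Suc n) 0 (graft (e, u) l r) + e = unit_mart d True (Suc n) 0 (graft (0, u) l r)" if "0 < d"
proof -
  define x y where "x = (e, u)" and "y = (0 :: real, u)"
  let ?a = "(\<lambda>_. 0) :: nat \<Rightarrow> real" and ?b = "(\<lambda>_. 1) :: nat \<Rightarrow> real"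
  have up: "upper d ?a ?b x = upper d ?a ?b y" "lower d ?a ?b x = lower d ?a ?b y" "area d ?a ?b x = area d ?a ?b y"
    by (simp_all add: upper_def lower_def area_def x_def y_def)
  have c: "compens d True ?a ?b 0 x + e = compens d True ?a ?b 0 y"
    using that unfolding compens_def up by (simp add: vol_unit lam_unit life_def x_def y_def)
  have "unit_mart d True (Suc n) 0 (graft x l r) + e = unit_mart d True (Suc n) 0 (graft y l r)"
    using c up mart_True_time[of d n ?a "upper d ?a ?b y" "0 - life d ?a ?b x" l "0 - life d ?a ?b y"]
      mart_True_time[of d n "lower d ?a ?b y" ?b "0 - life d ?a ?b x" r "0 - life d ?a ?b y"]
    unfolding mart_def stree_graft by simp
  then show ?thesis by (simp add: x_def y_def)
qed

text \<open>The lifetime of \<open>W\<close> enters the limit only through the summand \<open>- e\<close>, with \<open>e\<close> exponentially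
  distributed and independent of the rest; so the limit has no exponential moment of order \<open>- 2\<close>.\<close>

definition limit_rv :: "nat \<Rightarrow> (nat \<Rightarrow> nat) \<Rightarrow> (bool list \<Rightarrow> real \<times> real) \<Rightarrow> real" where
  "limit_rv d r \<omega> = lim (\<lambda>i. unit_mart d True (Suc (r i)) 0 \<omega> + fst (\<omega> [])) - fst (\<omega> [])"

lemma measurable_limit_rv [measurable]: "limit_rv d r \<in> borel_measurable Omega"
proof -
  have [measurable]: "(\<lambda>\<omega>. \<omega> []) \<in> Omega \<rightarrow>\<^sub>M borel \<Otimes>\<^sub>M borel"
    by (rule measurable_Omega_component) simp
  show ?thesis unfolding limit_rv_def[abs_def] by measurable
qed

text \<open>By \<open>unit_mart_root\<close> the sequence under \<open>lim\<close> does not change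
  with \<open>e\<close>. So the shift identity holds for all marks, even where the sequence diverges
  and \<open>lim\<close> is arbitrary; this is why \<open>limit_rv\<close> adds the root lifetime
  inside and subtracts it outside.\<close>

lemma limit_rv_graft:
  assumes "0 < d"
  shows "limit_rv d r (graft (e, u) l r') = limit_rv d r (graft (0, u) l r') - e"
  using unit_mart_root[OF assms, of _ e u l r'] by (simp add: limit_rv_def)

text \<open>The shift splits off the factor exp(2 e), whose mean under the density exp(-e) is the
  divergent integral of exp(e). The remaining factor \<open>C\<close> is nonzero because its
  integrand is positive everywhere.\<close>

lemma nn_integral_exp_limit_rv:
  assumes "0 < d"
  shows "(\<integral>\<^sup>+\<omega>. ennreal (exp (- 2 * limit_rv d r \<omega>)) \<partial>Omega) = \<infinity>"
proof -
  interpret O: prob_space Omega by (rule prob_space_Omega)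
  interpret u: prob_space unif by (rule prob_space_unif)
  define G where "G u l r' = ennreal (exp (- 2 * limit_rv d r (graft (0, u) l r')))" for u l r'
  define C where "C = (\<integral>\<^sup>+u. \<integral>\<^sup>+l. \<integral>\<^sup>+r'. G u l r' \<partial>Omega \<partial>Omega \<partial>unif)"
  have [measurable]: "(\<lambda>u. (0 :: real, u)) \<in> unif \<rightarrow>\<^sub>M mark_law"
  proof -
    have "(\<lambda>u. (0 :: real, u)) \<in> unif \<rightarrow>\<^sub>M borel \<Otimes>\<^sub>M borel" by measurable
    then show ?thesis by (simp cong: measurable_cong_sets[OF refl sets_mark_law])
  qed
  have Gm: "(\<lambda>r'. G u l r') \<in> borel_measurable Omega" "(\<lambda>l. \<integral>\<^sup>+r'. G u l r' \<partial>Omega) \<in> borel_measurable Omega"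
    "(\<lambda>u. \<integral>\<^sup>+l. \<integral>\<^sup>+r'. G u l r' \<partial>Omega \<partial>Omega) \<in> borel_measurable unif" for u l
    unfolding G_def by measurable
  have "C \<noteq> 0"
  proof
    assume "C = 0"
    then have "AE u in unif. AE l in Omega. AE r' in Omega. G u l r' = 0"
      unfolding C_def using Gm by (simp add: nn_integral_0_iff_AE)
    then have "AE u in unif. False" by (simp add: G_def)
    then show False by simp
  qed
  have "(\<integral>\<^sup>+\<omega>. ennreal (exp (- 2 * limit_rv d r \<omega>)) \<partial>Omega)
    = (\<integral>\<^sup>+x. \<integral>\<^sup>+l. \<integral>\<^sup>+r'. ennreal (exp (- 2 * limit_rv d r (graft x l r'))) \<partial>Omega \<partial>Omega \<partial>mark_law)"
    by (rule nn_integral_Omega) measurable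
  also have "\<dots> = (\<integral>\<^sup>+x. ennreal (exp (2 * fst x)) * (\<integral>\<^sup>+l. \<integral>\<^sup>+r'. G (snd x) l r' \<partial>Omega \<partial>Omega) \<partial>mark_law)"
  proof (intro nn_integral_cong)
    fix x
    have "ennreal (exp (- 2 * limit_rv d r (graft x l r'))) = ennreal (exp (2 * fst x)) * G (snd x) l r'" for l r'
      using limit_rv_graft[OF assms, of r "fst x" "snd x" l r']
      by (simp add: G_def algebra_simps flip: ennreal_mult exp_add)
    then show "(\<integral>\<^sup>+l. \<integral>\<^sup>+r'. ennreal (exp (- 2 * limit_rv d r (graft x l r'))) \<partial>Omega \<partial>Omega)
      = ennreal (exp (2 * fst x)) * (\<integral>\<^sup>+l. \<integral>\<^sup>+r'. G (snd x) l r' \<partial>Omega \<partial>Omega)"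
      using Gm by (simp add: nn_integral_cmult)
  qed
  also have "\<dots> = (\<integral>\<^sup>+e. \<integral>\<^sup>+u. ennreal (exp (2 * e)) * (\<integral>\<^sup>+l. \<integral>\<^sup>+r'. G u l r' \<partial>Omega \<partial>Omega) \<partial>unif \<partial>expo)"
  proof -
    define H where "H u = (\<integral>\<^sup>+l. \<integral>\<^sup>+r'. G u l r' \<partial>Omega \<partial>Omega)" for u
    have "H \<in> borel_measurable unif" unfolding H_def[abs_def] by (rule Gm(3))
    then have "H \<in> borel_measurable borel" by (simp cong: measurable_cong_sets)
    then have "(\<lambda>x::real \<times> real. H (snd x)) \<in> borel_measurable (borel \<Otimes>\<^sub>M borel)"
      by (rule measurable_compose[OF measurable_snd])
    then show ?thesis unfolding H_def[symmetric]
      by (subst nn_integral_mark_law) (auto intro!: borel_measurable_times)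
  qed
  also have "\<dots> = (\<integral>\<^sup>+e. ennreal (exp (2 * e)) * C \<partial>expo)"
    using Gm(3) by (simp add: nn_integral_cmult C_def)
  also have "\<dots> = (\<integral>\<^sup>+e. ennreal (exp (2 * e)) \<partial>expo) * C" by (rule nn_integral_multc) measurable
  also have "(\<integral>\<^sup>+e. ennreal (exp (2 * e)) \<partial>expo) = \<infinity>"
  proof -
    have "(\<integral>\<^sup>+e. indicator {0..} e \<partial>(lborel :: real measure)) \<le> (\<integral>\<^sup>+e\<in>{0..}. ennreal (exp (- e)) * ennreal (exp (2 * e)) \<partial>lborel)"
      by (intro nn_integral_mono) (auto simp: indicator_def simp flip: ennreal_mult exp_add)
    also have "\<dots> = (\<integral>\<^sup>+e. ennreal (exp (2 * e)) \<partial>expo)"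
      by (rule nn_integral_expo[symmetric]) measurable
    finally have "emeasure lborel {0::real..} \<le> (\<integral>\<^sup>+e. ennreal (exp (2 * e)) \<partial>expo)" by simp
    moreover have "emeasure lborel {0::real..} = \<infinity>"
    proof -
      have "ennreal (real n) \<le> emeasure lborel {0::real..}" for n
        using emeasure_mono[of "{0..real n}" "{0..}" lborel] by simp
      then have "of_nat n \<le> emeasure lborel {0::real..}" for n
        by (simp add: ennreal_of_nat_eq_real_of_nat)
      then show ?thesis by (metis ennreal_Ex_less_of_nat infinity_ennreal_def less_top leD)
    qed
    ultimately show ?thesis by (simp add: top_unique)
  qed
  also have "\<infinity> * C = \<infinity>" using \<open>C \<noteq> 0\<close> by (simp add: ennreal_top_mult)
  finally show ?thesis .
qed

text \<open>Completing the square: multiplication by exp(-2 x) moves the mean of a normal density by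
  -2 \<sigma>^2, up to a constant factor.\<close>

lemma nn_integral_exp_normal_density:
  assumes "0 < \<sigma>"
  shows "(\<integral>\<^sup>+x. ennreal (exp (- 2 * x)) \<partial>density lborel (normal_density \<mu> \<sigma>)) < \<infinity>"
proof -
  have e: "normal_density \<mu> \<sigma> x * exp (- 2 * x) = exp (2 * \<sigma>\<^sup>2 - 2 * \<mu>) * normal_density (\<mu> - 2 * \<sigma>\<^sup>2) \<sigma> x" for x
  proof -
    have "-(x - \<mu>)\<^sup>2 / (2 * \<sigma>\<^sup>2) + (- 2 * x) = (2 * \<sigma>\<^sup>2 - 2 * \<mu>) + -(x - (\<mu> - 2 * \<sigma>\<^sup>2))\<^sup>2 / (2 * \<sigma>\<^sup>2)"
      using assms by (simp add: divide_simps) (simp add: power2_eq_square algebra_simps)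
    then show ?thesis unfolding normal_density_def by (simp add: mult_ac flip: exp_add)
  qed
  interpret p: prob_space "density lborel (normal_density (\<mu> - 2 * \<sigma>\<^sup>2) \<sigma>)"
    by (rule prob_space_normal_density) (rule assms)
  have "(\<integral>\<^sup>+x. ennreal (exp (- 2 * x)) \<partial>density lborel (normal_density \<mu> \<sigma>))
    = (\<integral>\<^sup>+x. ennreal (normal_density \<mu> \<sigma> x * exp (- 2 * x)) \<partial>lborel)"
    by (subst nn_integral_density) (auto simp: ennreal_mult'' )
  also have "\<dots> = (\<integral>\<^sup>+x. ennreal (exp (2 * \<sigma>\<^sup>2 - 2 * \<mu>)) * ennreal (normal_density (\<mu> - 2 * \<sigma>\<^sup>2) \<sigma> x) \<partial>lborel)"
    unfolding e by (simp add: ennreal_mult')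
  also have "\<dots> = ennreal (exp (2 * \<sigma>\<^sup>2 - 2 * \<mu>)) * (\<integral>\<^sup>+x. ennreal (normal_density (\<mu> - 2 * \<sigma>\<^sup>2) \<sigma> x) \<partial>lborel)"
    by (rule nn_integral_cmult) measurable
  also have "(\<integral>\<^sup>+x. ennreal (normal_density (\<mu> - 2 * \<sigma>\<^sup>2) \<sigma> x) \<partial>lborel) = 1"
    using p.emeasure_space_1 by (simp add: emeasure_density)
  finally show ?thesis by simp
qed

text \<open>The truncations are Cauchy in L1, so along a subsequence they converge almost surely, as
  the pointwise formula for \<open>limit_rv\<close> demands; Fatou's lemma carries the L2 bounds
  over to the limit.\<close>

lemma limit_rv_exists:
  assumes d: "2 < d"
  obtains r where "\<And>n. moment2 (\<lambda>\<omega>. limit_rv d r \<omega> - unit_mart d True n 0 \<omega>) \<le> ennreal (tail_energy d n)"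
    "moment2 (limit_rv d r) \<le> ennreal (tail_energy d 0)"
proof -
  interpret O: prob_space Omega by (rule prob_space_Omega)
  define zm where "zm n = unit_mart d True n 0" for n
  have [measurable]: "zm n \<in> borel_measurable Omega" for n by (simp add: zm_def)
  have int: "integrable Omega (zm n)" for n unfolding zm_def by (rule integrable_mart[OF d]) simp
  have L1: "(\<integral>\<omega>. \<bar>zm i \<omega> - zm j \<omega>\<bar> \<partial>Omega) \<le> sqrt (tail_energy d j)" if "j \<le> i" for i j
  proof -
    have "ennreal (\<integral>\<omega>. \<bar>zm i \<omega> - zm j \<omega>\<bar> \<partial>Omega) = moment1 (\<lambda>\<omega>. zm i \<omega> - zm j \<omega>)"
      using int by (intro nn_integral_eq_integral[symmetric]) auto
    also have "\<dots> \<le> ennreal (sqrt (tail_energy d j))"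
      using incr_abs_le[OF d, of True 0 j "i - j"] that by (simp add: zm_def)
    finally show ?thesis by (simp add: ennreal_le_iff tail_energy_nonneg)
  qed
  have slim: "(\<lambda>n. sqrt (tail_energy d n)) \<longlonglongrightarrow> 0"
    using tendsto_real_sqrt[OF tail_energy_tendsto_0[OF d]] by simp
  have "\<exists>r. strict_mono r \<and> (AE \<omega> in Omega. Cauchy (\<lambda>i. zm (Suc (r i)) \<omega>))"
  proof (rule cauchy_L1_AE_cauchy_subseq[where M = Omega and s = "\<lambda>n. zm (Suc n)"])
    fix e :: real assume e: "0 < e"
    obtain N where N: "\<And>n. n \<ge> N \<Longrightarrow> sqrt (tail_energy d n) < e"
      using order_tendstoD(2)[OF slim e] unfolding eventually_sequentially by blast
    show "\<exists>N. \<forall>i\<ge>N. \<forall>j\<ge>N. (\<integral>\<omega>. norm (zm (Suc i) \<omega> - zm (Suc j) \<omega>) \<partial>Omega) < e"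
    proof (intro exI[of _ N] allI impI)
      fix i j assume ij: "N \<le> i" "N \<le> j"
      show "(\<integral>\<omega>. norm (zm (Suc i) \<omega> - zm (Suc j) \<omega>) \<partial>Omega) < e"
      proof (cases "j \<le> i")
        case True
        then show ?thesis using L1[of "Suc j" "Suc i"] N[of "Suc j"] ij by simp
      next
        case False
        then show ?thesis using L1[of "Suc i" "Suc j"] N[of "Suc i"] ij by (simp add: abs_minus_commute)
      qed
    qed
  qed (use int in blast)+
  then obtain r where r: "strict_mono r" and AEC: "AE \<omega> in Omega. Cauchy (\<lambda>i. zm (Suc (r i)) \<omega>)"
    by blast
  define Z where "Z = limit_rv d r"
  have [measurable]: "Z \<in> borel_measurable Omega" by (simp add: Z_def)
  have AEZ: "AE \<omega> in Omega. (\<lambda>i. zm (Suc (r i)) \<omega>) \<longlonglongrightarrow> Z \<omega>"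
    using AEC
  proof eventually_elim
    case (elim \<omega>)
    then obtain L where L: "(\<lambda>i. zm (Suc (r i)) \<omega>) \<longlonglongrightarrow> L"
      using Cauchy_convergent convergent_def by blast
    then have "(\<lambda>i. zm (Suc (r i)) \<omega> + fst (\<omega> [])) \<longlonglongrightarrow> L + fst (\<omega> [])" by (intro tendsto_intros)
    then have "Z \<omega> = L" by (simp add: Z_def limit_rv_def limI zm_def)
    with L show ?case by simp
  qed
  \<comment> \<open>Used with \<open>h\<close> the truncation at \<open>n\<close>, and with
    \<open>h = 0\<close> for the second moment itself.\<close>
  have fatou: "moment2 (\<lambda>\<omega>. Z \<omega> - h \<omega>) \<le> B"
    if [measurable]: "h \<in> borel_measurable Omega"
      and ev: "eventually (\<lambda>i. moment2 (\<lambda>\<omega>. zm (Suc (r i)) \<omega> - h \<omega>) \<le> B) sequentially" for h B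
  proof -
    have "moment2 (\<lambda>\<omega>. Z \<omega> - h \<omega>) = (\<integral>\<^sup>+\<omega>. liminf (\<lambda>i. ennreal ((zm (Suc (r i)) \<omega> - h \<omega>)\<^sup>2)) \<partial>Omega)"
    proof (rule nn_integral_cong_AE)
      show "AE \<omega> in Omega. ennreal ((Z \<omega> - h \<omega>)\<^sup>2) = liminf (\<lambda>i. ennreal ((zm (Suc (r i)) \<omega> - h \<omega>)\<^sup>2))"
        using AEZ
      proof eventually_elim
        case (elim \<omega>)
        have "(\<lambda>i. ennreal ((zm (Suc (r i)) \<omega> - h \<omega>)\<^sup>2)) \<longlonglongrightarrow> ennreal ((Z \<omega> - h \<omega>)\<^sup>2)"
          by (intro tendsto_ennrealI tendsto_power tendsto_diff tendsto_const elim)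
        then show ?case by (intro lim_imp_Liminf[symmetric]) auto
      qed
    qed
    also have "\<dots> \<le> liminf (\<lambda>i. \<integral>\<^sup>+\<omega>. ennreal ((zm (Suc (r i)) \<omega> - h \<omega>)\<^sup>2) \<partial>Omega)"
      by (rule nn_integral_liminf) measurable
    also have "\<dots> \<le> B"
    proof -
      have "liminf (\<lambda>i. \<integral>\<^sup>+\<omega>. ennreal ((zm (Suc (r i)) \<omega> - h \<omega>)\<^sup>2) \<partial>Omega) \<le> liminf (\<lambda>_::nat. B)"
        by (rule Liminf_mono[OF ev])
      then show ?thesis by (simp add: Liminf_const)
    qed
    finally show ?thesis .
  qed
  show ?thesis
  proof (rule that[of r])
    fix n
    have "eventually (\<lambda>i. moment2 (\<lambda>\<omega>. zm (Suc (r i)) \<omega> - zm n \<omega>) \<le> ennreal (tail_energy d n)) sequentially"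
      unfolding eventually_sequentially
    proof (intro exI[of _ n] allI impI)
      fix i assume "n \<le> i"
      then have "n \<le> Suc (r i)" using seq_suble[OF r, of i] by simp
      then show "moment2 (\<lambda>\<omega>. zm (Suc (r i)) \<omega> - zm n \<omega>) \<le> ennreal (tail_energy d n)"
        using incr_sq_le[OF d, of True 0 n "Suc (r i) - n"] by (simp add: zm_def)
    qed
    then show "moment2 (\<lambda>\<omega>. limit_rv d r \<omega> - unit_mart d True n 0 \<omega>) \<le> ennreal (tail_energy d n)"
      using fatou[of "zm n" "ennreal (tail_energy d n)"] by (simp add: Z_def zm_def)
  next
    have "moment2 (\<lambda>\<omega>. Z \<omega> - 0) \<le> ennreal (tail_energy d 0)"
      using mart_moments[OF d cell_unit[of 1], of True 0] tail_energy[OF d, of 0]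
      by (intro fatou) (auto simp: zm_def)
    then show "moment2 (limit_rv d r) \<le> ennreal (tail_energy d 0)" by (simp add: Z_def)
  qed
qed

text \<open>The difference of the two sides is the square of \<epsilon> x + (x - y), divided by
  \<epsilon>. The factor of \<open>x\<close> squared can be brought as close to 1 as desired, which
  an exact variance requires.\<close>

lemma square_le_weighted:
  fixes x y :: real
  assumes "0 < \<epsilon>"
  shows "y\<^sup>2 \<le> (1 + \<epsilon>) * x\<^sup>2 + (1 + 1 / \<epsilon>) * (x - y)\<^sup>2"
proof -
  have "0 \<le> (\<epsilon> * x + (x - y))\<^sup>2 / \<epsilon>" using assms by simp
  also have "\<dots> = (1 + \<epsilon>) * x\<^sup>2 + (1 + 1 / \<epsilon>) * (x - y)\<^sup>2 - y\<^sup>2"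
    using assms by (simp add: field_simps power2_eq_square)
  finally show ?thesis by simp
qed

text \<open>\<open>Z2\<close> is the upper bound. For the lower one,
  \<open>square_le_weighted\<close> compares the limit with its truncation and yields g 0 <= (1 +
  \<epsilon>) V + (1 + 1/\<epsilon>) g n + g n; here \<open>n\<close> goes to infinity before
  \<epsilon> goes to 0.\<close>

lemma second_moment_limit:
  assumes d: "2 < d" and [measurable]: "Z \<in> borel_measurable Omega"
    and ZM: "\<And>n. moment2 (\<lambda>\<omega>. Z \<omega> - unit_mart d True n 0 \<omega>) \<le> ennreal (tail_energy d n)"
    and Z2: "moment2 Z \<le> ennreal (tail_energy d 0)"
  shows "integrable Omega (\<lambda>\<omega>. (Z \<omega>)\<^sup>2)" "(\<integral>\<omega>. (Z \<omega>)\<^sup>2 \<partial>Omega) = tail_energy d 0" "(\<integral>\<omega>. Z \<omega> \<partial>Omega) = 0"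
proof -
  interpret O: prob_space Omega by (rule prob_space_Omega)
  define g where "g = tail_energy d"
  have g0: "0 \<le> g n" for n by (simp add: g_def tail_energy_nonneg)
  have glim: "g \<longlonglongrightarrow> 0" unfolding g_def by (rule tail_energy_tendsto_0[OF d])
  define zm where "zm n = unit_mart d True n 0" for n
  have [measurable]: "zm n \<in> borel_measurable Omega" for n by (simp add: zm_def)
  have fin: "moment2 Z < \<infinity>" using Z2 by (simp add: le_less_trans)
  note iZ = O.integrable_of_square[OF assms(2) fin]
  show "integrable Omega (\<lambda>\<omega>. (Z \<omega>)\<^sup>2)" by (rule iZ(1))
  have fzm: "moment2 (zm n) < \<infinity>" for n
    using mart_moments[OF d cell_unit[of 1], of True 0 n] tail_energy[OF d, of 0]
    by (auto simp: zm_def intro: le_less_trans)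
  have izm: "integrable Omega (\<lambda>\<omega>. (zm n \<omega>)\<^sup>2)" "integrable Omega (zm n)" for n
    by (rule O.integrable_of_square[OF _ fzm[of n]]; measurable)+
  have fd: "moment2 (\<lambda>\<omega>. Z \<omega> - zm n \<omega>) < \<infinity>" for n
    using ZM[of n] by (simp add: zm_def le_less_trans)
  have idiff: "integrable Omega (\<lambda>\<omega>. (Z \<omega> - zm n \<omega>)\<^sup>2)" for n
    by (rule O.integrable_of_square(1)[OF _ fd]) measurable
  have Ediff: "(\<integral>\<omega>. (Z \<omega> - zm n \<omega>)\<^sup>2 \<partial>Omega) \<le> g n" for n
    using ZM[of n] idiff[of n] by (simp add: nn_integral_eq_integral zm_def g_def ennreal_le_iff tail_energy_nonneg)
  define V where "V = (\<integral>\<omega>. (Z \<omega>)\<^sup>2 \<partial>Omega)"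
  have V0: "0 \<le> V" by (simp add: V_def)
  have Vle: "V \<le> g 0"
    using Z2 iZ by (simp add: nn_integral_eq_integral V_def g_def ennreal_le_iff tail_energy_nonneg)
  have ge: "g 0 \<le> (\<integral>\<omega>. (zm n \<omega>)\<^sup>2 \<partial>Omega) + g n" for n
  proof -
    have "ennreal (g 0) \<le> ennreal (\<integral>\<omega>. (zm n \<omega>)\<^sup>2 \<partial>Omega) + ennreal (g n)"
      using mart_second_moment_ge[OF d cell_unit[of 1], of n 0] izm(1)[of n]
      by (simp add: tail_energy[OF d] g_def zm_def nn_integral_eq_integral)
    then show ?thesis using g0 by (simp add: ennreal_le_iff flip: ennreal_plus)
  qed
  have eps: "g 0 \<le> (1 + \<epsilon>) * V" if \<epsilon>: "0 < \<epsilon>" for \<epsilon>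
  proof -
    have "g 0 \<le> (1 + \<epsilon>) * V + (1 + 1 / \<epsilon>) * g n + g n" for n
    proof -
      have "(\<integral>\<omega>. (zm n \<omega>)\<^sup>2 \<partial>Omega) \<le> (\<integral>\<omega>. (1 + \<epsilon>) * (Z \<omega>)\<^sup>2 + (1 + 1 / \<epsilon>) * (Z \<omega> - zm n \<omega>)\<^sup>2 \<partial>Omega)"
        using izm iZ idiff by (intro integral_mono square_le_weighted \<epsilon>) auto
      also have "\<dots> = (1 + \<epsilon>) * V + (1 + 1 / \<epsilon>) * (\<integral>\<omega>. (Z \<omega> - zm n \<omega>)\<^sup>2 \<partial>Omega)"
        using iZ idiff by (simp add: V_def)
      also have "\<dots> \<le> (1 + \<epsilon>) * V + (1 + 1 / \<epsilon>) * g n"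
        using \<epsilon> by (intro add_left_mono mult_left_mono Ediff) auto
      finally show ?thesis using ge[of n] by simp
    qed
    moreover have "(\<lambda>n. (1 + \<epsilon>) * V + (1 + 1 / \<epsilon>) * g n + g n) \<longlonglongrightarrow> (1 + \<epsilon>) * V + (1 + 1 / \<epsilon>) * 0 + 0"
      by (intro tendsto_intros glim)
    ultimately show ?thesis
      using LIMSEQ_le_const[of "\<lambda>n. (1 + \<epsilon>) * V + (1 + 1 / \<epsilon>) * g n + g n" "(1 + \<epsilon>) * V" "g 0"] by auto
  qed
  have "g 0 \<le> V"
  proof (rule field_le_epsilon)
    fix e :: real assume e: "0 < e"
    \<comment> \<open>This \<epsilon> keeps the error \<epsilon> V below \<open>e\<close> and is
      meaningful for \<open>V = 0\<close>, too.\<close>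
    have "g 0 \<le> (1 + e / (V + 1)) * V" using e V0 by (intro eps) simp
    also have "\<dots> = V + e * (V / (V + 1))" by (simp add: algebra_simps)
    also have "\<dots> \<le> V + e * 1" using e V0 by (intro add_left_mono mult_left_mono) auto
    finally show "g 0 \<le> V + e" by simp
  qed
  with Vle show "(\<integral>\<omega>. (Z \<omega>)\<^sup>2 \<partial>Omega) = tail_energy d 0" by (simp add: V_def g_def)
  have "\<bar>\<integral>\<omega>. Z \<omega> \<partial>Omega\<bar> \<le> sqrt (g n)" for n
  proof -
    have "(\<integral>\<omega>. zm n \<omega> \<partial>Omega) = 0"
      unfolding zm_def using mart_moments[OF d cell_unit[of 1], of True 0 n] by simp
    then have "(\<integral>\<omega>. Z \<omega> \<partial>Omega) = (\<integral>\<omega>. Z \<omega> - zm n \<omega> \<partial>Omega)" using iZ izm by simp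
    also have "\<bar>\<dots>\<bar> \<le> (\<integral>\<omega>. \<bar>Z \<omega> - zm n \<omega>\<bar> \<partial>Omega)" by (rule integral_abs_bound)
    finally have "ennreal \<bar>\<integral>\<omega>. Z \<omega> \<partial>Omega\<bar> \<le> ennreal (\<integral>\<omega>. \<bar>Z \<omega> - zm n \<omega>\<bar> \<partial>Omega)"
      by (rule ennreal_leI)
    also have "\<dots> = moment1 (\<lambda>\<omega>. Z \<omega> - zm n \<omega>)"
      using iZ izm by (intro nn_integral_eq_integral[symmetric]) auto
    also have "\<dots> \<le> ennreal (sqrt (g n))"
      using ZM[of n] by (intro O.nn_integral_abs_le_sqrt g0) (auto simp: zm_def g_def)
    finally show ?thesis using g0 by (simp add: ennreal_le_iff)
  qed
  moreover have "(\<lambda>n. sqrt (g n)) \<longlonglongrightarrow> 0" using tendsto_real_sqrt[OF glim] by simp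
  ultimately have "\<bar>\<integral>\<omega>. Z \<omega> \<partial>Omega\<bar> \<le> 0"
    using LIMSEQ_le_const[of "\<lambda>n. sqrt (g n)" 0 "\<bar>\<integral>\<omega>. Z \<omega> \<partial>Omega\<bar>"] by auto
  then show "(\<integral>\<omega>. Z \<omega> \<partial>Omega) = 0" by simp
qed

lemma centered_law_eq: "centered_law d R = distr Omega borel (centered d R)"
  unfolding centered_law_def centered_def[abs_def] ..

lemma char_distr_Omega:
  assumes [measurable]: "h \<in> borel_measurable Omega"
  shows "char (distr Omega borel h) t = (CLINT \<omega>|Omega. iexp (t * h \<omega>))"
  unfolding char_def by (rule integral_distr) measurable

theorem theorem3:
  fixes d :: nat
  assumes "d > 2"
  shows "\<exists>\<Xi> :: real measure.
           real_distribution \<Xi> \<and>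
           conv_in_law_at_top (centered_law d) \<Xi> \<and>
           \<not> gaussian \<Xi> \<and>
           integrable \<Xi> (\<lambda>x. x\<^sup>2) \<and>
           (\<integral>x. x\<^sup>2 \<partial>\<Xi>) - (\<integral>x. x \<partial>\<Xi>)\<^sup>2
             = var_formula d (box_d d (\<lambda>_. 0) (\<lambda>_. 1))"
proof -
  interpret O: prob_space Omega by (rule prob_space_Omega)
  obtain r where r: "\<And>n. moment2 (\<lambda>\<omega>. limit_rv d r \<omega> - unit_mart d True n 0 \<omega>) \<le> ennreal (tail_energy d n)"
    "moment2 (limit_rv d r) \<le> ennreal (tail_energy d 0)"
    using limit_rv_exists[OF assms] by blast
  define Z where "Z = limit_rv d r"
  have [measurable]: "Z \<in> borel_measurable Omega" by (simp add: Z_def)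
  note mom = second_moment_limit[OF assms measurable_limit_rv r, folded Z_def]
  have Z1: "moment1 (\<lambda>\<omega>. Z \<omega> - unit_mart d True n 0 \<omega>) \<le> ennreal (sqrt (tail_energy d n))" for n
    unfolding Z_def by (rule O.nn_integral_abs_le_sqrt[OF _ r(1) tail_energy_nonneg]) measurable
  define \<Xi> where "\<Xi> = distr Omega borel Z"
  have "real_distribution \<Xi>" unfolding \<Xi>_def by simp
  moreover have "conv_in_law_at_top (centered_law d) \<Xi>"
    unfolding conv_in_law_at_top_def
  proof (intro allI impI)
    fix Rs :: "nat \<Rightarrow> real" assume Rs: "filterlim Rs at_top sequentially"
    show "weak_conv_m (\<lambda>n. centered_law d (Rs n)) \<Xi>"
      unfolding \<Xi>_def centered_law_eq
    proof (rule levy_continuity)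
      fix t
      have "Z \<in> borel_measurable Omega" by measurable
      from char_centered_tendsto[OF assms Rs this Z1, of t]
      show "(\<lambda>n. char (distr Omega borel (centered d (Rs n))) t) \<longlonglongrightarrow> char (distr Omega borel Z) t"
        by (simp only: char_distr_Omega measurable_centered \<open>Z \<in> borel_measurable Omega\<close>)
    qed simp_all
  qed
  moreover have "\<not> gaussian \<Xi>"
  proof
    assume "gaussian \<Xi>"
    then obtain m \<sigma> where g: "0 < \<sigma>" "\<Xi> = density lborel (normal_density m \<sigma>)"
      unfolding gaussian_def by blast
    have "(\<integral>\<^sup>+x. ennreal (exp (- 2 * x)) \<partial>\<Xi>) = (\<integral>\<^sup>+\<omega>. ennreal (exp (- 2 * Z \<omega>)) \<partial>Omega)"
      unfolding \<Xi>_def by (rule nn_integral_distr) measurable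
    also have "\<dots> = \<infinity>" unfolding Z_def using assms by (intro nn_integral_exp_limit_rv) simp
    finally show False using nn_integral_exp_normal_density[OF g(1), of m] by (simp add: g(2))
  qed
  moreover have "integrable \<Xi> (\<lambda>x. x\<^sup>2)"
    unfolding \<Xi>_def using mom(1) by (subst integrable_distr_eq) auto
  moreover have "(\<integral>x. x\<^sup>2 \<partial>\<Xi>) - (\<integral>x. x \<partial>\<Xi>)\<^sup>2 = var_formula d (box_d d (\<lambda>_. 0) (\<lambda>_. 1))"
  proof -
    \<comment> \<open>The limit is centred, so its variance is the energy of all pairs with kernel
      1/L, that is, the sum of the facet energies.\<close>
    have "(\<integral>x. x\<^sup>2 \<partial>\<Xi>) = tail_energy d 0" "(\<integral>x. x \<partial>\<Xi>) = 0"
      unfolding \<Xi>_def using mom(2,3) by (simp_all add: integral_distr)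
    then show ?thesis
      by (simp add: var_formula_unit[OF assms] tail_energy_def pair_int_kern0_unit)
  qed
  ultimately show ?thesis by blast
qed

end
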